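(* Let $d\ge2$ be an integer, let $\underline{\ell}$ be a Kupisch series of type $\mathbb{A}_\infty^\infty$ and consider a subset $I\subseteq\operatorname{os}_{\underline{\ell}}^{d+1}$. The subcategory $\mathcal{U}_I=\operatorname{add}\{M_y\mid y\in I\}$ is a $d$-torsion class in $\mathcal{M}_{\underline{\ell}}^d$ if and only if the following hold for any elements $x,z\in\operatorname{os}_{\underline{\ell}}^{d+1}$: (1) If $x\le z$ and $x_d=z_d$, then $x\in I$ implies $z\in I$. (2) If $x\rightsquigarrow\tau_d(z)$ and $x,z\in I$, then any $y\in\operatorname{os}_{\underline{\ell}}^{d+1}$ with $y_i\in\{x_i,z_i\}$ for each $i$ must be in $I$.
   Context: Let $\Bbbk$ be a field. All subcategories are full and closed under isomorphisms, finite direct sums and direct summands; $\operatorname{add}(\mathcal{X})$ is the smallest such subcategory containing $\mathcal{X}$. A right module over a $\Bbbk$-linear category $\mathcal{C}$ is a $\Bbbk$-linear functor $M\colon\mathcal{C}^{\mathrm{op}}\to\operatorname{Mod}\Bbbk$; it is finite-dimensional if $\bigoplus_{x\in\mathcal{C}}M(x)$ is finite-dimensional. $\operatorname{fd}\mathcal{C}$ denotes the category of finite-dimensional right modules. For $m\ge1$, $\operatorname{os}^m$ is the set of non-decreasing $m$-tuples $(x_0,\dots,x_{m-1})$ over $\mathbb{Z}$. View $\mathbb{Z}^d$ with the product order ($x\le y$ iff $x_i\le y_i$ for all $i$) as a $\Bbbk$-linear category ($\Bbbk$-linearisation of the poset). The mesh category of type $\mathbb{Z}\mathbb{A}_\infty^{d-1}$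 is the additive quotient $A_\infty^d=\mathbb{Z}^d/(\mathbb{Z}^d\setminus\operatorname{os}^d)$ (quotient by the ideal of morphisms factoring through objects in $\mathbb{Z}^d\setminus\operatorname{os}^d$). For $x\in\operatorname{os}^{d+1}$, $M_x$ is the indecomposable $A_\infty^d$-module with support in all $y\in\operatorname{os}^d$ with $x_0\le y_0\le x_1\le\cdots\le x_{d-1}\le y_{d-1}\le x_d$ (the interval module: $\Bbbk$ at each such $y$, zero elsewhere, with identity structure maps inside the support). A Kupisch series of type $\mathbb{A}_\infty^\infty$ is an infinite tuple $\underline{\ell}=(\dots,\ell_{-1},\ell_0,\ell_1,\dots)$ where each $\ell_i$ is a non-negative integer or $\infty$ and $\ell_i\le\ell_{i-1}+1$ for all $i\in\mathbb{Z}$. Set $\operatorname{os}_{\underline{\ell}}^m=\{y\in\operatorname{os}^m\mid y_{m-1}-y_0+1\le\ell_{y_{m-1}}\}$. For $d\ge2$, $A_{\underline{\ell}}^d=A_\infty^d/(\operatorname{os}^d\setminus\operatorname{os}_{\underline{\ell}}^d)$ (idempotent quotient), so $\operatorname{fd}A_{\underline{\ell}}^d\subseteq\operatorname{fd}A_\infty^d$, and $\mathcal{M}_{\underline{\ell}}^d=\operatorname{add}\{M_x\mid x\in\operatorname{os}_{\underline{\ell}}^{d+1}\}$, which is known to be a $d$-cluster tilting subcategory of $\operatorname{fd}A_{\underline{\ell}}^d$. On $\mathbb{Z}^{d+1}$ write $x\rightsquigarrow y$ iff $x_0\le y_0\le x_1\le y_1\le\cdots\le x_d\le y_d$, and $\tau_d(x_0,\dots,x_d)=(x_0-1,\dots,x_d-1)$.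 $d$-torsion classes: put $\mathcal{M}=\mathcal{M}_{\underline{\ell}}^d$. A $d$-cokernel of $f_0\colon X_0\to X_1$ in $\mathcal{M}$ is a sequence $X_1\xrightarrow{f_1}\cdots\xrightarrow{f_d}X_{d+1}\to0$ in $\mathcal{M}$ such that $0\to\operatorname{Hom}(X_{d+1},M)\to\cdots\to\operatorname{Hom}(X_1,M)\to\operatorname{Hom}(X_0,M)$ is exact for every $M\in\mathcal{M}$; $d$-kernels are dual. A sequence $0\to X_0\xrightarrow{f_0}\cdots\xrightarrow{f_d}X_{d+1}\to0$ in $\mathcal{M}$ is $d$-exact if $(f_1,\dots,f_d)$ is a $d$-cokernel of $f_0$ and $(f_0,\dots,f_{d-1})$ is a $d$-kernel of $f_d$. A subcategory $\mathcal{U}\subseteq\mathcal{M}$ is a $d$-torsion class in $\mathcal{M}$ if for every $M\in\mathcal{M}$ there is a $d$-exact sequence $0\to U_M\to M\to V_1\to\cdots\to V_d\to0$ in $\mathcal{M}$ with $U_M\in\mathcal{U}$ such that $0\to\operatorname{Hom}(U,V_1)\to\cdots\to\operatorname{Hom}(U,V_d)\to0$ is exact for every $U\in\mathcal{U}$. *)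

theory Defs
  imports Main "HOL-Library.Function_Algebras" "HOL-Library.Extended_Nat"
begin

section \<open>Linear categories and their quotients\<close>

text \<open>
  \<^term>\<open>hcomp C x y z g f\<close> is the composite of \<open>f : x \<rightarrow> y\<close> and \<open>g : y \<rightarrow> z\<close>. The operations
  carry the objects as arguments because a morphism, as a bare element, does not determine
  its source and target.
\<close>

record ('o, 'm, 'k) lincat =
  Ob :: "'o set"
  Hom :: "'o \<Rightarrow> 'o \<Rightarrow> 'm set"
  hzero :: "'o \<Rightarrow> 'o \<Rightarrow> 'm"
  hadd :: "'o \<Rightarrow> 'o \<Rightarrow> 'm \<Rightarrow> 'm \<Rightarrow> 'm"
  hscale :: "'o \<Rightarrow> 'o \<Rightarrow> 'k \<Rightarrow> 'm \<Rightarrow> 'm"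
  hone :: "'o \<Rightarrow> 'm"
  hcomp :: "'o \<Rightarrow> 'o \<Rightarrow> 'o \<Rightarrow> 'm \<Rightarrow> 'm \<Rightarrow> 'm"

text \<open>
  The linearisation of a poset: the morphism space is the ground field if \<open>x \<le> y\<close> and zero
  otherwise. Composition is multiplication of scalars; this stays inside the morphism spaces,
  since a product of morphisms along \<open>x, y, z\<close> can be nonzero only if \<open>x \<le> y \<le> z\<close>.
\<close>

definition poset_lincat :: "'o set \<Rightarrow> ('o \<Rightarrow> 'o \<Rightarrow> bool) \<Rightarrow> ('o, 'k::field, 'k) lincat" where
  "poset_lincat P le =
    \<lparr>Ob = P,
     Hom = (\<lambda>x y. if le x y then UNIV else {0}),
     hzero = (\<lambda>x y. 0),
     hadd = (\<lambda>x y a b. a + b),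
     hscale = (\<lambda>x y c a. c * a),
     hone = (\<lambda>x. 1),
     hcomp = (\<lambda>x y z b a. b * a)\<rparr>"

text \<open>
  The ideal of morphisms factoring through objects in \<open>S\<close>. As the category need not have
  direct sums, finite sums of morphisms each factoring through a single object of \<open>S\<close> are included.
\<close>

inductive_set thru :: "('o, 'm, 'k) lincat \<Rightarrow> 'o set \<Rightarrow> 'o \<Rightarrow> 'o \<Rightarrow> 'm set"
  for C :: "('o, 'm, 'k) lincat" and S :: "'o set" and x y :: 'o where
  zero: "hzero C x y \<in> thru C S x y"
| factor: "w \<in> S \<Longrightarrow> w \<in> Ob C \<Longrightarrow> f \<in> Hom C x w \<Longrightarrow> g \<in> Hom C w y \<Longrightarrow>
    hcomp C x w y g f \<in> thru C S x y"
| add: "a \<in> thru C S x y \<Longrightarrow> b \<in> thru C S x y \<Longrightarrow> hadd C x y a b \<in> thru C S x y"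

definition qcoset :: "('o, 'm, 'k) lincat \<Rightarrow> 'o set \<Rightarrow> 'o \<Rightarrow> 'o \<Rightarrow> 'm \<Rightarrow> 'm set" where
  "qcoset C S x y f = {hadd C x y f j | j. j \<in> thru C S x y}"

text \<open>
  The additive quotient \<open>C/S\<close> has the same objects as \<open>C\<close>; those in \<open>S\<close> become zero objects.
\<close>

definition quot_cat :: "('o, 'm, 'k) lincat \<Rightarrow> 'o set \<Rightarrow> ('o, 'm set, 'k) lincat" where
  "quot_cat C S =
    \<lparr>Ob = Ob C,
     Hom = (\<lambda>x y. qcoset C S x y ` Hom C x y),
     hzero = (\<lambda>x y. qcoset C S x y (hzero C x y)),
     hadd = (\<lambda>x y A B. \<Union>a\<in>A. \<Union>b\<in>B. qcoset C S x y (hadd C x y a b)),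
     hscale = (\<lambda>x y c A. \<Union>a\<in>A. qcoset C S x y (hscale C x y c a)),
     hone = (\<lambda>x. qcoset C S x x (hone C x)),
     hcomp = (\<lambda>x y z B A. \<Union>b\<in>B. \<Union>a\<in>A. qcoset C S x z (hcomp C x y z b a))\<rparr>"


section \<open>Finite-dimensional right modules\<close>

text \<open>
  The vector spaces \<open>M(x)\<close> are subspaces of the space of all sequences over the ground field.
  Every finite-dimensional space occurs there up to isomorphism, so this yields the
  category of finite-dimensional modules up to equivalence.
\<close>

type_synonym 'k kvec = "nat \<Rightarrow> 'k"

definition vscale :: "'k::field \<Rightarrow> 'k kvec \<Rightarrow> 'k kvec" where
  "vscale c v = (\<lambda>n. c * v n)"

global_interpretation kvec: vector_space vscale
  by unfold_locales (auto simp: vscale_def fun_eq_iff algebra_simps)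

definition linear_between :: "'k::field kvec set \<Rightarrow> 'k kvec set \<Rightarrow> ('k kvec \<Rightarrow> 'k kvec) \<Rightarrow> bool" where
  "linear_between V W h \<longleftrightarrow>
    h ` V \<subseteq> W \<and>
    (\<forall>u\<in>V. \<forall>v\<in>V. h (u + v) = h u + h v) \<and>
    (\<forall>c. \<forall>v\<in>V. h (vscale c v) = vscale c (h v))"

text \<open>
  \<^term>\<open>act M x y f\<close> is the map \<open>M(y) \<rightarrow> M(x)\<close> induced by \<open>f : x \<rightarrow> y\<close>.
\<close>

record ('o, 'm, 'k) rmod =
  car :: "'o \<Rightarrow> 'k kvec set"
  act :: "'o \<Rightarrow> 'o \<Rightarrow> 'm \<Rightarrow> 'k kvec \<Rightarrow> 'k kvec"

definition right_module :: "('o, 'm, 'k::field) lincat \<Rightarrow> ('o, 'm, 'k) rmod \<Rightarrow> bool" where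
  "right_module C M \<longleftrightarrow>
    (\<forall>x\<in>Ob C. kvec.subspace (car M x)) \<and>
    (\<forall>x\<in>Ob C. \<forall>y\<in>Ob C. \<forall>f\<in>Hom C x y. linear_between (car M y) (car M x) (act M x y f)) \<and>
    (\<forall>x\<in>Ob C. \<forall>y\<in>Ob C. \<forall>f\<in>Hom C x y. \<forall>g\<in>Hom C x y. \<forall>v\<in>car M y.
       act M x y (hadd C x y f g) v = act M x y f v + act M x y g v) \<and>
    (\<forall>x\<in>Ob C. \<forall>y\<in>Ob C. \<forall>f\<in>Hom C x y. \<forall>c. \<forall>v\<in>car M y.
       act M x y (hscale C x y c f) v = vscale c (act M x y f v)) \<and>
    (\<forall>x\<in>Ob C. \<forall>v\<in>car M x. act M x x (hone C x) v = v) \<and>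
    (\<forall>x\<in>Ob C. \<forall>y\<in>Ob C. \<forall>z\<in>Ob C. \<forall>f\<in>Hom C x y. \<forall>g\<in>Hom C y z. \<forall>v\<in>car M z.
       act M x z (hcomp C x y z g f) v = act M x y f (act M y z g v))"

text \<open>
  The last two conditions say that the direct sum of all \<open>M(x)\<close> is finite-dimensional.
\<close>

definition fd_modules :: "('o, 'm, 'k::field) lincat \<Rightarrow> ('o, 'm, 'k) rmod set" where
  "fd_modules C = {M. right_module C M \<and>
     finite {x \<in> Ob C. car M x \<noteq> {0}} \<and>
     (\<forall>x\<in>Ob C. \<exists>B. finite B \<and> car M x = kvec.span B)}"

text \<open>
  Natural transformations. A component is set to zero outside its domain, and so is the
  family outside the objects. Thus equality of morphisms is equality of functions,
  and sums, zero morphisms and composites are pointwise.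
\<close>

definition mhom :: "('o, 'm, 'k::field) lincat \<Rightarrow> ('o, 'm, 'k) rmod \<Rightarrow> ('o, 'm, 'k) rmod \<Rightarrow>
    ('o \<Rightarrow> 'k kvec \<Rightarrow> 'k kvec) set" where
  "mhom C M N = {\<phi>.
     (\<forall>x\<in>Ob C. linear_between (car M x) (car N x) (\<phi> x)) \<and>
     (\<forall>x\<in>Ob C. \<forall>y\<in>Ob C. \<forall>f\<in>Hom C x y. \<forall>v\<in>car M y.
        \<phi> x (act M x y f v) = act N x y f (\<phi> y v)) \<and>
     (\<forall>x v. x \<notin> Ob C \<or> v \<notin> car M x \<longrightarrow> \<phi> x v = 0)}"

definition mcomp :: "('o \<Rightarrow> 'k kvec \<Rightarrow> 'k kvec) \<Rightarrow> ('o \<Rightarrow> 'k kvec \<Rightarrow> 'k kvec) \<Rightarrow>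
    'o \<Rightarrow> 'k kvec \<Rightarrow> 'k kvec" (infixr "\<odot>" 70) where
  "\<psi> \<odot> \<phi> = (\<lambda>x. \<psi> x \<circ> \<phi> x)"

definition mone :: "('o, 'm, 'k::field) lincat \<Rightarrow> ('o, 'm, 'k) rmod \<Rightarrow> 'o \<Rightarrow> 'k kvec \<Rightarrow> 'k kvec" where
  "mone C M = (\<lambda>x v. if x \<in> Ob C \<and> v \<in> car M x then v else 0)"

definition miso :: "('o, 'm, 'k::field) lincat \<Rightarrow> ('o, 'm, 'k) rmod \<Rightarrow> ('o, 'm, 'k) rmod \<Rightarrow> bool" where
  "miso C M N \<longleftrightarrow>
    (\<exists>\<phi>\<in>mhom C M N. \<exists>\<psi>\<in>mhom C N M. \<psi> \<odot> \<phi> = mone C M \<and> \<phi> \<odot> \<psi> = mone C N)"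

text \<open>
  \<open>Y\<close> is a direct sum of the (possibly empty) list \<open>Xs\<close>, with injections \<open>\<iota>\<close> and projections \<open>\<pi>\<close>.
\<close>

definition is_dsum :: "('o, 'm, 'k::field) lincat \<Rightarrow> ('o, 'm, 'k) rmod \<Rightarrow> ('o, 'm, 'k) rmod list \<Rightarrow> bool" where
  "is_dsum C Y Xs \<longleftrightarrow>
    (\<exists>\<iota> \<pi>.
      (\<forall>i<length Xs. \<iota> i \<in> mhom C (Xs ! i) Y \<and> \<pi> i \<in> mhom C Y (Xs ! i)) \<and>
      (\<forall>i<length Xs. \<forall>j<length Xs. \<pi> j \<odot> \<iota> i = (if i = j then mone C (Xs ! i) else 0)) \<and>
      (\<Sum>i<length Xs. \<iota> i \<odot> \<pi> i) = mone C Y)"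

text \<open>
  Full subcategories of \<open>\<A>\<close> closed under isomorphisms, finite direct sums and direct summands,
  given by their sets of objects.
\<close>

definition subcategory :: "('o, 'm, 'k::field) lincat \<Rightarrow> ('o, 'm, 'k) rmod set \<Rightarrow>
    ('o, 'm, 'k) rmod set \<Rightarrow> bool" where
  "subcategory C \<A> \<U> \<longleftrightarrow>
    \<U> \<subseteq> \<A> \<and>
    (\<forall>X\<in>\<U>. \<forall>Y\<in>\<A>. miso C X Y \<longrightarrow> Y \<in> \<U>) \<and>
    (\<forall>Xs. \<forall>Y\<in>\<A>. set Xs \<subseteq> \<U> \<longrightarrow> is_dsum C Y Xs \<longrightarrow> Y \<in> \<U>) \<and>
    (\<forall>Y\<in>\<U>. \<forall>X\<in>\<A>. \<forall>Z\<in>\<A>. is_dsum C Y [X, Z] \<longrightarrow> X \<in> \<U>)"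

definition add_closure :: "('o, 'm, 'k::field) lincat \<Rightarrow> ('o, 'm, 'k) rmod set \<Rightarrow>
    ('o, 'm, 'k) rmod set \<Rightarrow> ('o, 'm, 'k) rmod set" where
  "add_closure C \<A> \<X> = \<Inter>{\<U>. subcategory C \<A> \<U> \<and> \<X> \<subseteq> \<U>}"

text \<open>
  Restriction of a module along the quotient functor \<open>C \<rightarrow> C/S\<close>, and the resulting
  inclusion of the finite-dimensional modules over \<open>C/S\<close> into those over \<open>C\<close>, as an
  isomorphism-closed full subcategory.
\<close>

definition restrict_quot :: "('o, 'm, 'k::field) lincat \<Rightarrow> 'o set \<Rightarrow> ('o, 'm set, 'k) rmod \<Rightarrow>
    ('o, 'm, 'k) rmod" where
  "restrict_quot C S M = \<lparr>car = car M, act = (\<lambda>x y f. act M x y (qcoset C S x y f))\<rparr>"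

definition fd_modules_quot :: "('o, 'm, 'k::field) lincat \<Rightarrow> 'o set \<Rightarrow> ('o, 'm, 'k) rmod set" where
  "fd_modules_quot C S =
    {N \<in> fd_modules C. \<exists>M\<in>fd_modules (quot_cat C S). miso C N (restrict_quot C S M)}"


section \<open>Higher torsion classes\<close>

text \<open>
  Exactness at \<open>B\<close> of homomorphisms \<open>\<alpha>\<close> from \<open>A\<close> to \<open>B\<close> and \<open>\<beta>\<close> out of \<open>B\<close>. The zero term at
  the left end of a sequence is \<open>A = {0}\<close> with \<open>\<alpha> = id\<close>, at the right end it is \<open>\<beta> = 0\<close>.
\<close>

definition exact_at :: "('a \<Rightarrow> 'b) \<Rightarrow> 'a set \<Rightarrow> ('b \<Rightarrow> 'c::zero) \<Rightarrow> 'b set \<Rightarrow> bool" where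
  "exact_at \<alpha> A \<beta> B \<longleftrightarrow> \<alpha> ` A = {b \<in> B. \<beta> b = 0}"

text \<open>
  All sequences below are indexed as \<open>f i : X i \<rightarrow> X (i + 1)\<close> for \<open>0 \<le> i \<le> d\<close>.
\<close>

definition is_sequence :: "('o, 'm, 'k::field) lincat \<Rightarrow> nat \<Rightarrow> ('o, 'm, 'k) rmod set \<Rightarrow>
    (nat \<Rightarrow> ('o, 'm, 'k) rmod) \<Rightarrow> (nat \<Rightarrow> 'o \<Rightarrow> 'k kvec \<Rightarrow> 'k kvec) \<Rightarrow> bool" where
  "is_sequence C d \<M> X f \<longleftrightarrow>
    (\<forall>i\<le>d + 1. X i \<in> \<M>) \<and> (\<forall>i\<le>d. f i \<in> mhom C (X i) (X (i + 1)))"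

text \<open>\<open>(f 1, \<dots>, f d)\<close> is a \<open>d\<close>-cokernel of \<open>f 0\<close>.\<close>

definition d_cokernel :: "('o, 'm, 'k::field) lincat \<Rightarrow> nat \<Rightarrow> ('o, 'm, 'k) rmod set \<Rightarrow>
    (nat \<Rightarrow> ('o, 'm, 'k) rmod) \<Rightarrow> (nat \<Rightarrow> 'o \<Rightarrow> 'k kvec \<Rightarrow> 'k kvec) \<Rightarrow> bool" where
  "d_cokernel C d \<M> X f \<longleftrightarrow> is_sequence C d \<M> X f \<and>
    (\<forall>M\<in>\<M>.
      exact_at id {0} (\<lambda>h. h \<odot> f d) (mhom C (X (d + 1)) M) \<and>
      (\<forall>i\<in>{1..d}. exact_at (\<lambda>h. h \<odot> f i) (mhom C (X (i + 1)) M)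
                           (\<lambda>h. h \<odot> f (i - 1)) (mhom C (X i) M)))"

text \<open>\<open>(f 0, \<dots>, f (d - 1))\<close> is a \<open>d\<close>-kernel of \<open>f d\<close>.\<close>

definition d_kernel :: "('o, 'm, 'k::field) lincat \<Rightarrow> nat \<Rightarrow> ('o, 'm, 'k) rmod set \<Rightarrow>
    (nat \<Rightarrow> ('o, 'm, 'k) rmod) \<Rightarrow> (nat \<Rightarrow> 'o \<Rightarrow> 'k kvec \<Rightarrow> 'k kvec) \<Rightarrow> bool" where
  "d_kernel C d \<M> X f \<longleftrightarrow> is_sequence C d \<M> X f \<and>
    (\<forall>M\<in>\<M>.
      exact_at id {0} (\<lambda>h. f 0 \<odot> h) (mhom C M (X 0)) \<and>
      (\<forall>i\<in>{1..d}. exact_at (\<lambda>h. f (i - 1) \<odot> h) (mhom C M (X (i - 1)))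
                           (\<lambda>h. f i \<odot> h) (mhom C M (X i))))"

definition d_exact :: "('o, 'm, 'k::field) lincat \<Rightarrow> nat \<Rightarrow> ('o, 'm, 'k) rmod set \<Rightarrow>
    (nat \<Rightarrow> ('o, 'm, 'k) rmod) \<Rightarrow> (nat \<Rightarrow> 'o \<Rightarrow> 'k kvec \<Rightarrow> 'k kvec) \<Rightarrow> bool" where
  "d_exact C d \<M> X f \<longleftrightarrow> d_cokernel C d \<M> X f \<and> d_kernel C d \<M> X f"

text \<open>
  The sequence \<open>0 \<rightarrow> U\<^sub>M \<rightarrow> M \<rightarrow> V\<^sub>1 \<rightarrow> \<dots> \<rightarrow> V\<^sub>d \<rightarrow> 0\<close> has \<open>U\<^sub>M = X 0\<close>, \<open>M = X 1\<close> and \<open>V\<^sub>i = X (i + 1)\<close>.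
  The definition is meant for \<open>d \<ge> 2\<close>.
\<close>

definition d_torsion_class :: "('o, 'm, 'k::field) lincat \<Rightarrow> nat \<Rightarrow> ('o, 'm, 'k) rmod set \<Rightarrow>
    ('o, 'm, 'k) rmod set \<Rightarrow> bool" where
  "d_torsion_class C d \<M> \<U> \<longleftrightarrow> subcategory C \<M> \<U> \<and>
    (\<forall>M\<in>\<M>. \<exists>X f. d_exact C d \<M> X f \<and> X 0 \<in> \<U> \<and> X 1 = M \<and>
      (\<forall>U\<in>\<U>.
        exact_at id {0} (\<lambda>h. f 2 \<odot> h) (mhom C U (X 2)) \<and>
        (\<forall>i\<in>{3..d}. exact_at (\<lambda>h. f (i - 1) \<odot> h) (mhom C U (X (i - 1)))
                             (\<lambda>h. f i \<odot> h) (mhom C U (X i))) \<and>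
        exact_at (\<lambda>h. f d \<odot> h) (mhom C U (X d)) (\<lambda>_. 0 :: nat) (mhom C U (X (d + 1)))))"


section \<open>Higher Nakayama algebras of type \<open>A\<^sub>\<infinity>\<^sup>\<infinity>\<close>\<close>

text \<open>Integer tuples are lists; \<open>x ! i\<close> is the entry \<open>x\<^sub>i\<close>.\<close>

definition tuples :: "nat \<Rightarrow> int list set" where
  "tuples m = {x. length x = m}"

definition os :: "nat \<Rightarrow> int list set" where
  "os m = {x \<in> tuples m. sorted x}"

definition prod_le :: "int list \<Rightarrow> int list \<Rightarrow> bool" where
  "prod_le x y \<longleftrightarrow> list_all2 (\<le>) x y"

definition mesh_cat :: "nat \<Rightarrow> (int list, 'k::field set, 'k) lincat" where
  "mesh_cat d = quot_cat (poset_lincat (tuples d) prod_le) (tuples d - os d)"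

definition msupp :: "nat \<Rightarrow> int list \<Rightarrow> int list set" where
  "msupp d x = {y \<in> os d. \<forall>i<d. x ! i \<le> y ! i \<and> y ! i \<le> x ! (i + 1)}"

text \<open>
  Here \<open>\<Bbbk>\<close> is the line of sequences supported at index 0. A morphism of \<^term>\<open>mesh_cat d\<close> is
  a coset of scalars; if \<open>y\<close> and \<open>z\<close> both lie in the support, then no morphism from \<open>y\<close> to \<open>z\<close>
  but zero factors through an object outside \<^term>\<open>os d\<close>, so that the coset consists of a
  single scalar.
\<close>

definition interval_module :: "nat \<Rightarrow> int list \<Rightarrow> (int list, 'k::field set, 'k) rmod" where
  "interval_module d x =
    \<lparr>car = (\<lambda>y. if y \<in> msupp d x then {v. \<forall>n>0. v n = 0} else {0}),
     act = (\<lambda>y z c v. if y \<in> msupp d x \<and> z \<in> msupp d x then vscale (the_elem c) v else 0)\<rparr>"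

definition kupisch_series :: "(int \<Rightarrow> enat) \<Rightarrow> bool" where
  "kupisch_series l \<longleftrightarrow> (\<forall>i. l i \<le> l (i - 1) + 1)"

definition os_kup :: "(int \<Rightarrow> enat) \<Rightarrow> nat \<Rightarrow> int list set" where
  "os_kup l m = {y \<in> os m. enat (nat (y ! (m - 1) - y ! 0 + 1)) \<le> l (y ! (m - 1))}"

definition nakayama_cat :: "(int \<Rightarrow> enat) \<Rightarrow> nat \<Rightarrow> (int list, 'k::field set set, 'k) lincat" where
  "nakayama_cat l d = quot_cat (mesh_cat d) (os d - os_kup l d)"

text \<open>The modules over \<^term>\<open>nakayama_cat l d\<close>, viewed as modules over \<^term>\<open>mesh_cat d\<close>.\<close>

definition fd_nakayama :: "(int \<Rightarrow> enat) \<Rightarrow> nat \<Rightarrow> (int list, 'k::field set, 'k) rmod set" where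
  "fd_nakayama l d = fd_modules_quot (mesh_cat d) (os d - os_kup l d)"

definition add_intervals :: "(int \<Rightarrow> enat) \<Rightarrow> nat \<Rightarrow> int list set \<Rightarrow> (int list, 'k::field set, 'k) rmod set" where
  "add_intervals l d J = add_closure (mesh_cat d) (fd_nakayama l d) (interval_module d ` J)"

definition M_kup :: "(int \<Rightarrow> enat) \<Rightarrow> nat \<Rightarrow> (int list, 'k::field set, 'k) rmod set" where
  "M_kup l d = add_intervals l d (os_kup l (d + 1))"

definition interlaced :: "nat \<Rightarrow> int list \<Rightarrow> int list \<Rightarrow> bool" where
  "interlaced d x y \<longleftrightarrow> x \<in> tuples (d + 1) \<and> y \<in> tuples (d + 1) \<and>
    (\<forall>i\<le>d. x ! i \<le> y ! i) \<and> (\<forall>i<d. y ! i \<le> x ! (i + 1))"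

definition tau :: "int list \<Rightarrow> int list" where
  "tau x = map (\<lambda>a. a - 1) x"

end

theory Submission
  imports Defs
begin

text \<open>
  Write \<open>M(x)\<close> for the interval module of \<open>x\<close>, and \<open>x \<leadsto> y\<close> for the interlacing relation. The proof
  takes place inside the additive category generated by the \<open>M(x)\<close>, and this category is very thin:
  there is a nonzero morphism from \<open>M(x)\<close> to \<open>M(y)\<close> iff \<open>x \<leadsto> y\<close>, it is then unique up to a scalar, and
  the composite of two basis morphisms is the basis morphism of the composite or zero. Hence, if a
  complex is a direct sum of sequences of basis morphisms between \<open>M(e\<^sub>0), M(e\<^sub>1), \<dots>\<close>, then applying
  \<open>Hom(M(u), -)\<close> to a summand gives a sequence of spaces of dimension at most one. It is exact at place \<open>k\<close>
  iff \<open>u \<leadsto> e\<^sub>k\<close> implies that exactly one of \<open>u \<leadsto> e\<^sub>k\<^sub>-\<^sub>1\<close> and \<open>u \<leadsto> e\<^sub>k\<^sub>+\<^sub>1\<close> holds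
  (\<open>exact_at_based\<close>, \<open>diag_sequence\<close>), and dually for \<open>Hom(-, M(u))\<close>.

  A nonzero torsion part of \<open>M(x)\<close> contains the simple socle of \<open>M(x)\<close>; being a sum of intervals, it is \<open>M(s)\<close>,
  where \<open>s\<close> is \<open>x\<close> with its last entry lowered to some \<open>t\<close>. The inclusion of \<open>M(s)\<close> in \<open>M(x)\<close> extends to an
  explicit \<open>d\<close>-exact sequence of intervals. Its tuples arise from \<open>s\<close> by raising the last entry to \<open>x\<^sub>d\<close> and
  then replacing, from right to left, one entry after the other by the successor of its right
  neighbour in \<open>s\<close>; the sequence is called a staircase below
  (\<open>stair\<close>, \<open>stair_d_exact\<close>). With \<open>t = x\<^sub>d\<^sub>-\<^sub>1 - 1\<close> the tuple \<open>s\<close> is not sorted, \<open>M(s)\<close> vanishes, and the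
  same formula gives the sequence from \<open>M(x)\<close> to itself that is needed when the torsion part is zero.

  Suppose that the two closure conditions hold. Let \<open>t\<close> be the largest last entry of an element \<open>u\<close> of \<open>I\<close>
  with \<open>u \<leadsto> x\<close>; the first condition puts \<open>s\<close> into \<open>I\<close>. Exactness of \<open>Hom(M(u), -)\<close> for \<open>u\<close> in \<open>I\<close> is automatic
  except at the two ends. At the first end it fails only if \<open>u \<leadsto> x\<close> and \<open>u\<^sub>d > t\<close>, which contradicts
  maximality; at the last end it fails only if \<open>s \<leadsto> \<tau>(u)\<close> and \<open>u\<^sub>d \<le> x\<^sub>d\<close>, and then the second condition produces an element of
  \<open>I\<close> that contradicts maximality too (\<open>torsion_stair_exists\<close>). A general object is a finite direct sum
  of intervals (\<open>retract_decomp\<close>), and the sequences of its summands are added up.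

  Conversely, consider a torsion class. For the first condition the tuple is raised one entry at a time, so that
  \<open>x \<leadsto> z\<close>; the morphism from \<open>M(x)\<close> to \<open>M(z)\<close> factors through the torsion part of \<open>M(z)\<close>, and since the
  torsion part is a monomorphism with respect to all test objects, this forces \<open>z\<close> into \<open>I\<close>
  (\<open>torsion_upward_step\<close>). For the second condition, the first one reduces the claim to the case in which \<open>x\<close> and \<open>z\<close> are the
  two end terms of a staircase sequence with second term \<open>w\<close>. The staircase sequence is mapped to the
  torsion sequence of \<open>M(w)\<close> by a chain map that is the identity on \<open>M(w)\<close>. As \<open>z\<close> lies in \<open>I\<close>, its last
  component lifts, so the chain map is homotopic to zero from \<open>M(w)\<close> on, and the identity of \<open>M(w)\<close>
  factors through the torsion part. Hence \<open>w\<close> lies in \<open>I\<close> (\<open>torsion_stair\<close>).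
\<close>

section \<open>Morphisms of modules\<close>

definition msmul :: "'k::field \<Rightarrow> ('o \<Rightarrow> 'k kvec \<Rightarrow> 'k kvec) \<Rightarrow> 'o \<Rightarrow> 'k kvec \<Rightarrow> 'k kvec" where
  "msmul c \<phi> = (\<lambda>x v. vscale c (\<phi> x v))"

lemma vscale_simps [simp]:
  "vscale 1 v = v" "vscale 0 v = 0" "vscale c 0 = (0::'k::field kvec)"
  "vscale a (vscale b v) = vscale (a * b) v"
  by (auto simp: vscale_def fun_eq_iff)

lemma msmul_simps [simp]:
  "msmul 1 \<phi> = \<phi>" "msmul 0 \<phi> = 0" "msmul c 0 = 0" "msmul a (msmul b \<phi>) = msmul (a * b) \<phi>"
  by (auto simp: msmul_def fun_eq_iff vscale_def)

lemma linear_between_zero: "linear_between V W h \<Longrightarrow> 0 \<in> V \<Longrightarrow> h 0 = 0"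
  unfolding linear_between_def by (metis vscale_simps(2))

text \<open>
  A component is additive on its domain and zero outside it, so it preserves zero whether or not zero
  lies in its domain. This makes composition distribute over sums without conditions on the modules.
\<close>

lemma mhom_at_zero:
  assumes "\<psi> \<in> mhom C N P"
  shows "\<psi> x 0 = 0"
proof (cases "x \<in> Ob C \<and> 0 \<in> car N x")
  case True
  then show ?thesis using assms linear_between_zero unfolding mhom_def by blast
next
  case False
  then show ?thesis using assms unfolding mhom_def by auto
qed

lemma mhom_in: "\<phi> \<in> mhom C M N \<Longrightarrow> x \<in> Ob C \<Longrightarrow> v \<in> car M x \<Longrightarrow> \<phi> x v \<in> car N x"
  unfolding mhom_def linear_between_def by blast

lemma mhom_out: "\<phi> \<in> mhom C M N \<Longrightarrow> x \<notin> Ob C \<or> v \<notin> car M x \<Longrightarrow> \<phi> x v = 0"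
  unfolding mhom_def by blast

lemma mhom_nat:
  "\<phi> \<in> mhom C M N \<Longrightarrow> x \<in> Ob C \<Longrightarrow> y \<in> Ob C \<Longrightarrow> f \<in> Hom C x y \<Longrightarrow> v \<in> car M y \<Longrightarrow>
   \<phi> x (act M x y f v) = act N x y f (\<phi> y v)"
  unfolding mhom_def by blast

lemma mhom_plus_arg:
  "\<phi> \<in> mhom C M N \<Longrightarrow> x \<in> Ob C \<Longrightarrow> u \<in> car M x \<Longrightarrow> v \<in> car M x \<Longrightarrow> \<phi> x (u + v) = \<phi> x u + \<phi> x v"
  unfolding mhom_def linear_between_def by blast

lemma mhom_scale_arg:
  "\<phi> \<in> mhom C M N \<Longrightarrow> x \<in> Ob C \<Longrightarrow> v \<in> car M x \<Longrightarrow> \<phi> x (vscale c v) = vscale c (\<phi> x v)"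
  unfolding mhom_def linear_between_def by blast

lemma right_module_subspace: "right_module C M \<Longrightarrow> x \<in> Ob C \<Longrightarrow> kvec.subspace (car M x)"
  by (simp add: right_module_def)

lemma right_module_linear:
  "right_module C M \<Longrightarrow> x \<in> Ob C \<Longrightarrow> y \<in> Ob C \<Longrightarrow> f \<in> Hom C x y \<Longrightarrow>
   linear_between (car M y) (car M x) (act M x y f)"
  by (simp add: right_module_def)

lemma mhomI:
  assumes "\<And>x v. x \<in> Ob C \<Longrightarrow> v \<in> car M x \<Longrightarrow> \<phi> x v \<in> car N x"
    and "\<And>x u v. x \<in> Ob C \<Longrightarrow> u \<in> car M x \<Longrightarrow> v \<in> car M x \<Longrightarrow> \<phi> x (u + v) = \<phi> x u + \<phi> x v"
    and "\<And>x c v. x \<in> Ob C \<Longrightarrow> v \<in> car M x \<Longrightarrow> \<phi> x (vscale c v) = vscale c (\<phi> x v)"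
    and "\<And>x y f v. x \<in> Ob C \<Longrightarrow> y \<in> Ob C \<Longrightarrow> f \<in> Hom C x y \<Longrightarrow> v \<in> car M y \<Longrightarrow>
      \<phi> x (act M x y f v) = act N x y f (\<phi> y v)"
    and "\<And>x v. x \<notin> Ob C \<or> v \<notin> car M x \<Longrightarrow> \<phi> x v = 0"
  shows "\<phi> \<in> mhom C M N"
  unfolding mhom_def linear_between_def using assms by blast

lemma mhom_zero: assumes "right_module C N" shows "0 \<in> mhom C M N"
proof (rule mhomI)
  show "(0 :: 'a \<Rightarrow> 'c kvec \<Rightarrow> 'c kvec) x v \<in> car N x" if "x \<in> Ob C" for x v
    using kvec.subspace_0[OF right_module_subspace[OF assms that]] by simp
  fix x y f v assume *: "x \<in> Ob C" "y \<in> Ob C" "f \<in> Hom C x y"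
  show "(0 :: 'a \<Rightarrow> 'c kvec \<Rightarrow> 'c kvec) x (act M x y f v)
      = act N x y f ((0 :: 'a \<Rightarrow> 'c kvec \<Rightarrow> 'c kvec) y v)"
    using linear_between_zero[OF right_module_linear[OF assms *]]
      kvec.subspace_0[OF right_module_subspace[OF assms *(2)]] by simp
qed simp_all

lemma mhom_add:
  assumes N: "right_module C N" and \<phi>: "\<phi> \<in> mhom C M N" and \<psi>: "\<psi> \<in> mhom C M N"
  shows "\<phi> + \<psi> \<in> mhom C M N"
proof (rule mhomI)
  show "(\<phi> + \<psi>) x v \<in> car N x" if "x \<in> Ob C" "v \<in> car M x" for x v
    using kvec.subspace_add[OF right_module_subspace[OF N that(1)]]
      mhom_in[OF \<phi> that] mhom_in[OF \<psi> that] by simp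
next
  fix x y f v assume *: "x \<in> Ob C" "y \<in> Ob C" "f \<in> Hom C x y" and v: "v \<in> car M y"
  show "(\<phi> + \<psi>) x (act M x y f v) = act N x y f ((\<phi> + \<psi>) y v)"
    using right_module_linear[OF N *] mhom_in[OF \<phi> *(2) v] mhom_in[OF \<psi> *(2) v]
    by (simp add: mhom_nat[OF \<phi> * v] mhom_nat[OF \<psi> * v] linear_between_def)
qed (auto simp: mhom_plus_arg[OF \<phi>] mhom_plus_arg[OF \<psi>] mhom_scale_arg[OF \<phi>]
      mhom_scale_arg[OF \<psi>] mhom_out[OF \<phi>] mhom_out[OF \<psi>] kvec.scale_right_distrib)

lemma mhom_smul:
  assumes N: "right_module C N" and \<phi>: "\<phi> \<in> mhom C M N"
  shows "msmul c \<phi> \<in> mhom C M N"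
proof (rule mhomI; unfold msmul_def)
  show "vscale c (\<phi> x v) \<in> car N x" if "x \<in> Ob C" "v \<in> car M x" for x v
    using kvec.subspace_scale[OF right_module_subspace[OF N that(1)]] mhom_in[OF \<phi> that] by simp
next
  fix x y f v assume *: "x \<in> Ob C" "y \<in> Ob C" "f \<in> Hom C x y" and v: "v \<in> car M y"
  show "vscale c (\<phi> x (act M x y f v)) = act N x y f (vscale c (\<phi> y v))"
    using right_module_linear[OF N *] mhom_in[OF \<phi> *(2) v]
    by (simp add: mhom_nat[OF \<phi> * v] linear_between_def)
qed (auto simp: mhom_plus_arg[OF \<phi>] mhom_scale_arg[OF \<phi>] mhom_out[OF \<phi>]
      kvec.scale_right_distrib mult.commute)

lemma uminus_eq_msmul: "- \<phi> = msmul (- 1) \<phi>"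
  by (auto simp: msmul_def vscale_def fun_eq_iff)

lemma mhom_diff:
  assumes "right_module C N" "\<phi> \<in> mhom C M N" "\<psi> \<in> mhom C M N"
  shows "\<phi> - \<psi> \<in> mhom C M N"
  using mhom_add[OF assms(1,2) mhom_smul[OF assms(1,3), of "- 1"]]
  unfolding uminus_eq_msmul[symmetric] by (simp add: fun_eq_iff)

lemma mhom_sum:
  assumes "right_module C N" "\<And>i. i \<in> S \<Longrightarrow> \<phi> i \<in> mhom C M N"
  shows "(\<Sum>i\<in>S. \<phi> i) \<in> mhom C M N"
  using assms(2) by (induction S rule: infinite_finite_induct) (auto intro: mhom_zero mhom_add assms(1))

lemma mhom_comp:
  assumes \<phi>: "\<phi> \<in> mhom C M N" and \<psi>: "\<psi> \<in> mhom C N P"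
  shows "\<psi> \<odot> \<phi> \<in> mhom C M P"
  by (rule mhomI) (auto simp: mcomp_def mhom_in[OF \<phi>] mhom_in[OF \<psi>] mhom_plus_arg[OF \<phi>]
      mhom_plus_arg[OF \<psi>] mhom_scale_arg[OF \<phi>] mhom_scale_arg[OF \<psi>] mhom_nat[OF \<phi>]
      mhom_nat[OF \<psi>] mhom_out[OF \<phi>] mhom_at_zero[OF \<psi>])

lemma mone_mhom: assumes "right_module C M" shows "mone C M \<in> mhom C M M"
proof (rule mhomI)
  fix x y f v assume *: "x \<in> Ob C" "y \<in> Ob C" "f \<in> Hom C x y" and v: "v \<in> car M y"
  have "act M x y f v \<in> car M x"
    using right_module_linear[OF assms *] v unfolding linear_between_def by blast
  then show "mone C M x (act M x y f v) = act M x y f (mone C M y v)"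
    using * v by (simp add: mone_def)
qed (auto simp: mone_def kvec.subspace_add[OF right_module_subspace[OF assms]]
      kvec.subspace_scale[OF right_module_subspace[OF assms]])

lemma mcomp_assoc: "(\<chi> \<odot> \<psi>) \<odot> \<phi> = \<chi> \<odot> \<psi> \<odot> \<phi>"
  by (simp add: mcomp_def comp_assoc)

lemma mcomp_zero_left [simp]: "0 \<odot> \<phi> = 0"
  by (simp add: mcomp_def fun_eq_iff)

lemma mcomp_zero_right: "\<psi> \<in> mhom C N P \<Longrightarrow> \<psi> \<odot> 0 = 0"
  by (simp add: mcomp_def fun_eq_iff mhom_at_zero)

lemma mone_left: "\<phi> \<in> mhom C M N \<Longrightarrow> mone C N \<odot> \<phi> = \<phi>"
  using mhom_in[of \<phi> C M N] mhom_out[of \<phi> C M N] by (force simp: mcomp_def mone_def fun_eq_iff)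

lemma mone_right: "\<phi> \<in> mhom C M N \<Longrightarrow> \<phi> \<odot> mone C M = \<phi>"
  using mhom_out[of \<phi> C M N] mhom_at_zero[of \<phi> C M N]
  by (force simp: mcomp_def mone_def fun_eq_iff)

lemma mcomp_add_left: "(\<psi> + \<psi>') \<odot> \<phi> = \<psi> \<odot> \<phi> + \<psi>' \<odot> \<phi>"
  by (simp add: mcomp_def fun_eq_iff)

lemma mcomp_diff_left: "(\<psi> - \<psi>') \<odot> \<phi> = \<psi> \<odot> \<phi> - \<psi>' \<odot> \<phi>"
  by (simp add: mcomp_def fun_eq_iff)

lemma mcomp_smul_left: "msmul c \<psi> \<odot> \<phi> = msmul c (\<psi> \<odot> \<phi>)"
  by (simp add: mcomp_def msmul_def fun_eq_iff)

lemma mcomp_sum_left: "(\<Sum>i\<in>S. \<psi> i) \<odot> \<phi> = (\<Sum>i\<in>S. \<psi> i \<odot> \<phi>)"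
  using sum_comp_morphism[of "\<lambda>\<chi>. \<chi> \<odot> \<phi>" \<psi> S] by (simp add: mcomp_add_left comp_def)

lemma mcomp_smul_right:
  assumes \<phi>: "\<phi> \<in> mhom C M N" and \<psi>: "\<psi> \<in> mhom C N P"
  shows "\<psi> \<odot> msmul c \<phi> = msmul c (\<psi> \<odot> \<phi>)"
proof (rule ext, rule ext)
  fix x v show "(\<psi> \<odot> msmul c \<phi>) x v = msmul c (\<psi> \<odot> \<phi>) x v"
    using mhom_in[OF \<phi>, of x v] mhom_out[OF \<phi>, of x v] mhom_scale_arg[OF \<psi>, of x "\<phi> x v" c]
      mhom_at_zero[OF \<psi>, of x]
    by (cases "x \<in> Ob C \<and> v \<in> car M x") (auto simp: mcomp_def msmul_def)
qed

lemma mcomp_add_right: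
  assumes \<phi>: "\<phi> \<in> mhom C M N" and \<phi>': "\<phi>' \<in> mhom C M N" and \<psi>: "\<psi> \<in> mhom C N P"
  shows "\<psi> \<odot> (\<phi> + \<phi>') = \<psi> \<odot> \<phi> + \<psi> \<odot> \<phi>'"
proof (rule ext, rule ext)
  fix x v show "(\<psi> \<odot> (\<phi> + \<phi>')) x v = (\<psi> \<odot> \<phi> + \<psi> \<odot> \<phi>') x v"
    using mhom_in[OF \<phi>, of x v] mhom_in[OF \<phi>', of x v] mhom_out[OF \<phi>, of x v]
      mhom_out[OF \<phi>', of x v] mhom_plus_arg[OF \<psi>, of x "\<phi> x v" "\<phi>' x v"] mhom_at_zero[OF \<psi>, of x]
    by (cases "x \<in> Ob C \<and> v \<in> car M x") (auto simp: mcomp_def)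
qed

lemma mcomp_diff_right:
  assumes N: "right_module C N"
    and \<phi>: "\<phi> \<in> mhom C M N" and \<phi>': "\<phi>' \<in> mhom C M N" and \<psi>: "\<psi> \<in> mhom C N P"
  shows "\<psi> \<odot> (\<phi> - \<phi>') = \<psi> \<odot> \<phi> - \<psi> \<odot> \<phi>'"
  using mcomp_add_right[OF mhom_diff[OF N \<phi> \<phi>'] \<phi>' \<psi>] by (simp add: algebra_simps)

lemma mcomp_sum_right:
  assumes N: "right_module C N" and \<phi>: "\<And>i. i \<in> S \<Longrightarrow> \<phi> i \<in> mhom C M N" and \<psi>: "\<psi> \<in> mhom C N P"
  shows "\<psi> \<odot> (\<Sum>i\<in>S. \<phi> i) = (\<Sum>i\<in>S. \<psi> \<odot> \<phi> i)"
proof (cases "finite S")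
  case True
  then show ?thesis using \<phi>
  proof (induction S)
    case empty
    then show ?case using mcomp_zero_right[OF \<psi>] by (metis sum.empty)
  next
    case (insert i S)
    have "\<psi> \<odot> (\<phi> i + (\<Sum>j\<in>S. \<phi> j)) = \<psi> \<odot> \<phi> i + \<psi> \<odot> (\<Sum>j\<in>S. \<phi> j)"
      using insert.prems by (intro mcomp_add_right[OF _ _ \<psi>] mhom_sum[OF N]) auto
    then show ?case
      using insert.hyps insert.IH insert.prems by (metis insertCI sum.insert)
  qed
qed (simp add: mcomp_zero_right[OF \<psi>])

text \<open>
  From here on sums of morphisms are elements of an abelian group, not functions to be evaluated.
\<close>

declare plus_fun_apply [simp del] zero_fun_apply [simp del] minus_apply [simp del]

section \<open>Retracts of sums\<close>

text \<open>
  The ideal of morphisms that factor through a finite direct sum of objects of \<open>\<X>\<close>. A module is a direct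
  summand of such a sum iff its identity lies in the ideal, and in this form no sum has to be formed.
\<close>

inductive_set factor_ideal :: "('o, 'm, 'k::field) lincat \<Rightarrow> ('o, 'm, 'k) rmod set \<Rightarrow> ('o, 'm, 'k) rmod \<Rightarrow>
    ('o, 'm, 'k) rmod \<Rightarrow> ('o \<Rightarrow> 'k kvec \<Rightarrow> 'k kvec) set"
  for C \<X> X Y where
  zero: "0 \<in> factor_ideal C \<X> X Y"
| comp: "Z \<in> \<X> \<Longrightarrow> a \<in> mhom C Z Y \<Longrightarrow> b \<in> mhom C X Z \<Longrightarrow> a \<odot> b \<in> factor_ideal C \<X> X Y"
| add: "\<phi> \<in> factor_ideal C \<X> X Y \<Longrightarrow> \<psi> \<in> factor_ideal C \<X> X Y \<Longrightarrow> \<phi> + \<psi> \<in> factor_ideal C \<X> X Y"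

lemma factor_ideal_mhom:
  assumes "right_module C Y" "\<phi> \<in> factor_ideal C \<X> X Y"
  shows "\<phi> \<in> mhom C X Y"
  using assms(2) by induction (auto intro: mhom_zero mhom_comp mhom_add assms(1))

lemma factor_ideal_post:
  assumes Y: "right_module C Y" and \<phi>: "\<phi> \<in> factor_ideal C \<X> X Y" and \<psi>: "\<psi> \<in> mhom C Y Z"
  shows "\<psi> \<odot> \<phi> \<in> factor_ideal C \<X> X Z"
  using \<phi>
proof induction
  case (comp W a b)
  then have "(\<psi> \<odot> a) \<odot> b \<in> factor_ideal C \<X> X Z" by (blast intro: factor_ideal.comp mhom_comp \<psi>)
  then show ?case by (simp only: mcomp_assoc)
next
  case (add \<phi> \<phi>')
  then show ?case
    using mcomp_add_right[OF factor_ideal_mhom[OF Y add.hyps(1)] factor_ideal_mhom[OF Y add.hyps(2)] \<psi>]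
    by (simp only: factor_ideal.add)
qed (use factor_ideal.zero in \<open>simp add: mcomp_zero_right[OF \<psi>]\<close>)

lemma factor_ideal_pre:
  assumes \<phi>: "\<phi> \<in> factor_ideal C \<X> Y Z" and \<psi>: "\<psi> \<in> mhom C X Y"
  shows "\<phi> \<odot> \<psi> \<in> factor_ideal C \<X> X Z"
  using \<phi>
proof induction
  case (comp W a b)
  then have "a \<odot> (b \<odot> \<psi>) \<in> factor_ideal C \<X> X Z" by (blast intro: factor_ideal.comp mhom_comp \<psi>)
  then show ?case by (simp only: mcomp_assoc)
next
  case (add \<phi> \<phi>')
  then show ?case by (simp only: factor_ideal.add mcomp_add_left)
qed (use factor_ideal.zero in simp)

lemma factor_ideal_sum: "(\<And>i. i \<in> S \<Longrightarrow> \<phi> i \<in> factor_ideal C \<X> X Y) \<Longrightarrow> (\<Sum>i\<in>S. \<phi> i) \<in> factor_ideal C \<X> X Y"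
  by (induction S rule: infinite_finite_induct) (auto intro: factor_ideal.zero factor_ideal.add)

lemma factor_ideal_mono: "\<X> \<subseteq> \<Y> \<Longrightarrow> \<phi> \<in> factor_ideal C \<X> X Y \<Longrightarrow> \<phi> \<in> factor_ideal C \<Y> X Y"
  by (rotate_tac, induction rule: factor_ideal.induct) (auto intro: factor_ideal.intros)

definition retracts :: "('o, 'm, 'k::field) lincat \<Rightarrow> ('o, 'm, 'k) rmod set \<Rightarrow>
    ('o, 'm, 'k) rmod set \<Rightarrow> ('o, 'm, 'k) rmod set" where
  "retracts C \<A> \<X> = {Y \<in> \<A>. mone C Y \<in> factor_ideal C \<X> Y Y}"

lemma factor_ideal_conj:
  assumes X: "right_module C X" and m: "mone C X \<in> factor_ideal C \<X> X X"
    and \<pi>: "\<pi> \<in> mhom C X Y" and \<iota>: "\<iota> \<in> mhom C Y X"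
  shows "\<pi> \<odot> \<iota> \<in> factor_ideal C \<X> Y Y"
  using factor_ideal_post[OF X factor_ideal_pre[OF m \<iota>] \<pi>] by (simp add: mone_left[OF \<iota>])

text \<open>
  All closure properties hold because the ideal passes along every split pair of morphisms.
\<close>

lemma subcategory_retracts:
  assumes \<A>: "\<And>X. X \<in> \<A> \<Longrightarrow> right_module C X"
  shows "subcategory C \<A> (retracts C \<A> \<X>)"
  unfolding subcategory_def
proof (intro conjI ballI allI impI)
  show "retracts C \<A> \<X> \<subseteq> \<A>" by (auto simp: retracts_def)
next
  fix X Y assume X: "X \<in> retracts C \<A> \<X>" and Y: "Y \<in> \<A>" and "miso C X Y"
  then obtain \<phi> \<psi> where "\<phi> \<in> mhom C X Y" "\<psi> \<in> mhom C Y X" "\<phi> \<odot> \<psi> = mone C Y"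
    unfolding miso_def by blast
  then show "Y \<in> retracts C \<A> \<X>"
    using factor_ideal_conj[of C X \<X> \<phi> Y \<psi>] X Y \<A> by (auto simp: retracts_def)
next
  fix Xs Y assume Y: "Y \<in> \<A>" and Xs: "set Xs \<subseteq> retracts C \<A> \<X>" and "is_dsum C Y Xs"
  then obtain \<iota> \<pi> where *: "\<forall>i<length Xs. \<iota> i \<in> mhom C (Xs ! i) Y \<and> \<pi> i \<in> mhom C Y (Xs ! i)"
    and s: "(\<Sum>i<length Xs. \<iota> i \<odot> \<pi> i) = mone C Y"
    unfolding is_dsum_def by blast
  have "\<iota> i \<odot> \<pi> i \<in> factor_ideal C \<X> Y Y" if "i < length Xs" for i
    using factor_ideal_conj[of C "Xs ! i" \<X> "\<iota> i" Y "\<pi> i"] * \<A> that subsetD[OF Xs nth_mem[OF that]]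
    by (auto simp: retracts_def)
  then have "mone C Y \<in> factor_ideal C \<X> Y Y" unfolding s[symmetric] by (intro factor_ideal_sum) auto
  then show "Y \<in> retracts C \<A> \<X>" using Y by (simp add: retracts_def)
next
  fix X Y Z assume Y: "Y \<in> retracts C \<A> \<X>" and X: "X \<in> \<A>" and "is_dsum C Y [X, Z]"
  then obtain \<iota> \<pi> where *: "\<forall>i<length [X, Z]. \<iota> i \<in> mhom C ([X, Z] ! i) Y \<and> \<pi> i \<in> mhom C Y ([X, Z] ! i)"
    and s: "\<forall>i<length [X,Z]. \<forall>j<length [X,Z]. \<pi> j \<odot> \<iota> i = (if i = j then mone C ([X,Z] ! i) else 0)"
    unfolding is_dsum_def by blast
  have "\<pi> 0 \<odot> \<iota> 0 = mone C X" "\<iota> 0 \<in> mhom C X Y" "\<pi> 0 \<in> mhom C Y X"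
    using * s by (auto dest: spec[of _ 0])
  then show "X \<in> retracts C \<A> \<X>"
    using factor_ideal_conj[of C Y \<X> "\<pi> 0" X "\<iota> 0"] X Y \<A> by (auto simp: retracts_def)
qed

lemma subcategory_subset:
  assumes "subcategory C \<A> \<U>" "\<U> \<subseteq> \<M>" "\<M> \<subseteq> \<A>"
  shows "subcategory C \<M> \<U>"
proof -
  have 1: "\<forall>X\<in>\<U>. \<forall>Y\<in>\<A>. miso C X Y \<longrightarrow> Y \<in> \<U>"
    and 2: "\<forall>Xs. \<forall>Y\<in>\<A>. set Xs \<subseteq> \<U> \<longrightarrow> is_dsum C Y Xs \<longrightarrow> Y \<in> \<U>"
    and 3: "\<forall>Y\<in>\<U>. \<forall>X\<in>\<A>. \<forall>Z\<in>\<A>. is_dsum C Y [X, Z] \<longrightarrow> X \<in> \<U>"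
    using assms(1) unfolding subcategory_def by - (elim conjE, assumption)+
  note sub = subsetD[OF assms(3)]
  show ?thesis
    unfolding subcategory_def
  proof (intro conjI ballI allI impI)
    show "Y \<in> \<U>" if "X \<in> \<U>" "Y \<in> \<M>" "miso C X Y" for X Y
      using 1 that(1,3) sub[OF that(2)] by blast
    show "Y \<in> \<U>" if "Y \<in> \<M>" "set Xs \<subseteq> \<U>" "is_dsum C Y Xs" for Xs Y
      using 2 that(2,3) sub[OF that(1)] by blast
    show "X \<in> \<U>" if "Y \<in> \<U>" "X \<in> \<M>" "Z \<in> \<M>" "is_dsum C Y [X, Z]" for X Y Z
      using 3 that(1,4) sub[OF that(2)] sub[OF that(3)] by blast
  qed (rule assms(2))
qed

section \<open>Exactness\<close>

lemma exact_at_iff: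
  "exact_at \<alpha> A \<beta> B \<longleftrightarrow>
    (\<forall>a\<in>A. \<alpha> a \<in> B \<and> \<beta> (\<alpha> a) = 0) \<and> (\<forall>b\<in>B. \<beta> b = 0 \<longrightarrow> (\<exists>a\<in>A. \<alpha> a = b))"
proof
  assume "exact_at \<alpha> A \<beta> B"
  then have *: "\<alpha> ` A = {b \<in> B. \<beta> b = 0}" by (simp add: exact_at_def)
  show "(\<forall>a\<in>A. \<alpha> a \<in> B \<and> \<beta> (\<alpha> a) = 0) \<and> (\<forall>b\<in>B. \<beta> b = 0 \<longrightarrow> (\<exists>a\<in>A. \<alpha> a = b))"
  proof (intro conjI ballI impI)
    fix a assume "a \<in> A"
    then have "\<alpha> a \<in> {b \<in> B. \<beta> b = 0}" unfolding *[symmetric] by (rule imageI)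
    then show "\<alpha> a \<in> B" "\<beta> (\<alpha> a) = 0" by simp_all
  next
    fix b assume "b \<in> B" "\<beta> b = 0"
    then have "b \<in> \<alpha> ` A" unfolding * by simp
    then show "\<exists>a\<in>A. \<alpha> a = b" by blast
  qed
qed (auto simp: exact_at_def image_iff)

text \<open>
  For \<open>g\<close> with \<open>\<beta> g = 0\<close> the maps \<open>\<phi>\<close> such that \<open>g \<phi>\<close> lifts through \<open>\<alpha>\<close> include those that factor through a
  single test object, and they are closed under sums. So they contain the whole ideal, and in
  particular the identity.
\<close>

lemma exact_at_retract_left:
  assumes mods: "right_module C A" "right_module C B" "right_module C D" "right_module C N"
    and \<alpha>: "\<alpha> \<in> mhom C A B" and \<beta>: "\<beta> \<in> mhom C B D"
    and ex: "\<And>Z. Z \<in> \<X> \<Longrightarrow> exact_at (\<lambda>h. \<alpha> \<odot> h) (mhom C Z A) (\<lambda>h. \<beta> \<odot> h) (mhom C Z B)"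
    and N: "mone C N \<in> factor_ideal C \<X> N N"
  shows "exact_at (\<lambda>h. \<alpha> \<odot> h) (mhom C N A) (\<lambda>h. \<beta> \<odot> h) (mhom C N B)"
proof -
  have 1: "\<exists>h\<in>mhom C N A. \<alpha> \<odot> h = g \<odot> \<phi>"
    if "\<phi> \<in> factor_ideal C \<X> N N" and g: "g \<in> mhom C N B" and 0: "\<beta> \<odot> g = 0" for g \<phi>
    using that(1)
  proof induction
    case zero
    show ?case
      by (rule bexI[OF _ mhom_zero[OF mods(1)]]) (simp add: mcomp_zero_right[OF g] mcomp_zero_right[OF \<alpha>])
  next
    case (comp Z a b)
    have "g \<odot> a \<in> mhom C Z B" "\<beta> \<odot> g \<odot> a = 0"
      using mhom_comp[OF comp(2) g] 0 by (simp_all add: mcomp_assoc[symmetric])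
    then obtain h where "h \<in> mhom C Z A" "\<alpha> \<odot> h = g \<odot> a"
      using ex[OF comp(1)] unfolding exact_at_iff by blast
    then show ?case
      by (intro bexI[of _ "h \<odot> b"] mhom_comp[OF comp(3)]) (simp_all add: mcomp_assoc[symmetric])
  next
    case (add \<phi> \<psi>)
    then obtain h h' where h: "h \<in> mhom C N A" "\<alpha> \<odot> h = g \<odot> \<phi>" "h' \<in> mhom C N A" "\<alpha> \<odot> h' = g \<odot> \<psi>"
      by blast
    show ?case
      using mcomp_add_right[OF h(1,3) \<alpha>] h
        mcomp_add_right[OF factor_ideal_mhom[OF mods(4) add(1)] factor_ideal_mhom[OF mods(4) add(2)] g]
      by (intro bexI[of _ "h + h'"] mhom_add[OF mods(1)]) simp_all
  qed
  have 2: "\<beta> \<odot> \<alpha> \<odot> h \<odot> \<phi> = 0" if "\<phi> \<in> factor_ideal C \<X> N N" and h: "h \<in> mhom C N A" for h \<phi>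
    using that(1)
  proof induction
    case zero
    then show ?case
      using mcomp_zero_right[OF mhom_comp[OF h mhom_comp[OF \<alpha> \<beta>]]] by (simp add: mcomp_assoc)
  next
    case (comp Z a b)
    have "\<beta> \<odot> \<alpha> \<odot> h \<odot> a = 0"
      using ex[OF comp(1)] mhom_comp[OF comp(2) h] unfolding exact_at_iff by blast
    then have "(\<beta> \<odot> \<alpha> \<odot> h \<odot> a) \<odot> b = 0" by simp
    then show ?case by (simp only: mcomp_assoc)
  next
    case (add \<phi> \<psi>)
    have "\<beta> \<odot> \<alpha> \<odot> h \<in> mhom C N D" by (rule mhom_comp[OF mhom_comp[OF h \<alpha>] \<beta>])
    then have "(\<beta> \<odot> \<alpha> \<odot> h) \<odot> (\<phi> + \<psi>) = (\<beta> \<odot> \<alpha> \<odot> h) \<odot> \<phi> + (\<beta> \<odot> \<alpha> \<odot> h) \<odot> \<psi>"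
      by (rule mcomp_add_right[OF factor_ideal_mhom[OF mods(4) add(1)] factor_ideal_mhom[OF mods(4) add(2)]])
    then show ?case using add(3,4) by (simp add: mcomp_assoc)
  qed
  show ?thesis
    unfolding exact_at_iff
  proof (intro conjI ballI impI)
    fix h assume h: "h \<in> mhom C N A"
    then show "\<alpha> \<odot> h \<in> mhom C N B" by (rule mhom_comp[OF _ \<alpha>])
    show "\<beta> \<odot> \<alpha> \<odot> h = 0" using 2[OF N h] by (simp add: mone_right[OF h])
  next
    fix g assume g: "g \<in> mhom C N B" "\<beta> \<odot> g = 0"
    show "\<exists>h\<in>mhom C N A. \<alpha> \<odot> h = g" using 1[OF N g] by (simp only: mone_right[OF g(1)])
  qed
qed

text \<open>
  The dual statement, with extensions in place of lifts.
\<close>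

lemma exact_at_retract_right:
  assumes mods: "right_module C A" "right_module C B" "right_module C D" "right_module C N"
    and \<alpha>: "\<alpha> \<in> mhom C A B" and \<beta>: "\<beta> \<in> mhom C B D"
    and ex: "\<And>Z. Z \<in> \<X> \<Longrightarrow> exact_at (\<lambda>h. h \<odot> \<beta>) (mhom C D Z) (\<lambda>h. h \<odot> \<alpha>) (mhom C B Z)"
    and N: "mone C N \<in> factor_ideal C \<X> N N"
  shows "exact_at (\<lambda>h. h \<odot> \<beta>) (mhom C D N) (\<lambda>h. h \<odot> \<alpha>) (mhom C B N)"
proof -
  have 1: "\<exists>h\<in>mhom C D N. h \<odot> \<beta> = \<phi> \<odot> g"
    if "\<phi> \<in> factor_ideal C \<X> N N" and g: "g \<in> mhom C B N" and 0: "g \<odot> \<alpha> = 0" for g \<phi>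
    using that(1)
  proof induction
    case zero
    then show ?case by (intro bexI[of _ 0] mhom_zero[OF mods(4)]) simp
  next
    case (comp Z a b)
    have "b \<odot> g \<in> mhom C B Z" "(b \<odot> g) \<odot> \<alpha> = 0"
      using mhom_comp[OF g comp(3)] 0 mcomp_zero_right[OF comp(3)] by (simp_all add: mcomp_assoc)
    then obtain h where "h \<in> mhom C D Z" "h \<odot> \<beta> = b \<odot> g"
      using ex[OF comp(1)] unfolding exact_at_iff by blast
    then show ?case
      by (intro bexI[of _ "a \<odot> h"] mhom_comp[OF _ comp(2)]) (simp_all add: mcomp_assoc)
  next
    case (add \<phi> \<psi>)
    then obtain h h' where h: "h \<in> mhom C D N" "h \<odot> \<beta> = \<phi> \<odot> g" "h' \<in> mhom C D N" "h' \<odot> \<beta> = \<psi> \<odot> g"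
      by blast
    show ?case
      using h by (intro bexI[of _ "h + h'"] mhom_add[OF mods(4)]) (simp_all add: mcomp_add_left)
  qed
  have 2: "\<phi> \<odot> h \<odot> \<beta> \<odot> \<alpha> = 0" if "\<phi> \<in> factor_ideal C \<X> N N" and h: "h \<in> mhom C D N" for h \<phi>
    using that(1)
  proof induction
    case (comp Z a b)
    have "((b \<odot> h) \<odot> \<beta>) \<odot> \<alpha> = 0"
      using ex[OF comp(1)] mhom_comp[OF h comp(3)] unfolding exact_at_iff by blast
    then show ?case by (simp add: mcomp_assoc mcomp_zero_right[OF comp(2)])
  next
    case (add \<phi> \<psi>)
    then show ?case by (simp add: mcomp_add_left)
  qed simp
  show ?thesis
    unfolding exact_at_iff
  proof (intro conjI ballI impI)
    fix h assume h: "h \<in> mhom C D N"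
    then show "h \<odot> \<beta> \<in> mhom C B N" by (rule mhom_comp[OF \<beta>])
    show "(h \<odot> \<beta>) \<odot> \<alpha> = 0"
      using 2[OF N h] by (simp only: mcomp_assoc mone_left[OF mhom_comp[OF mhom_comp[OF \<alpha> \<beta>] h]])
  next
    fix g assume g: "g \<in> mhom C B N" "g \<odot> \<alpha> = 0"
    show "\<exists>h\<in>mhom C D N. h \<odot> \<beta> = g" using 1[OF N g] by (simp only: mone_left[OF g(1)])
  qed
qed

text \<open>
  The zero term at an end of a sequence may be replaced by any object with the zero map, so that the
  results on inner places apply to the ends as well.
\<close>

lemma exact_at_start_left:
  assumes "right_module C A"
  shows "exact_at id {0} \<beta> (mhom C N B) \<longleftrightarrow> exact_at (\<lambda>h. 0 \<odot> h) (mhom C N A) \<beta> (mhom C N B)"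
proof -
  have "(\<lambda>h. 0 \<odot> h) ` mhom C N A = {0}" using mhom_zero[OF assms] by auto
  then show ?thesis unfolding exact_at_def by simp
qed

lemma exact_at_start_right:
  assumes "right_module C N"
  shows "exact_at id {0} \<beta> (mhom C B N) \<longleftrightarrow> exact_at (\<lambda>h. h \<odot> 0) (mhom C A N) \<beta> (mhom C B N)"
proof -
  have "(\<lambda>h. h \<odot> 0) ` mhom C A N = {0}"
    using mhom_zero[OF assms] mcomp_zero_right[of _ C A N] by (auto simp: image_iff)
  then show ?thesis unfolding exact_at_def by simp
qed

lemma exact_at_end_left:
  "exact_at \<alpha> A (\<lambda>_. 0 :: nat) B \<longleftrightarrow> exact_at \<alpha> A (\<lambda>h. 0 \<odot> h) B"
  unfolding exact_at_def by simp

section \<open>Chain maps between exact sequences\<close>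

lemma d_kernel_is_sequence: "d_kernel C d \<M> X f \<Longrightarrow> is_sequence C d \<M> X f"
  unfolding d_kernel_def by simp

lemma is_sequence_mhom: "is_sequence C d \<M> X f \<Longrightarrow> i \<le> d \<Longrightarrow> f i \<in> mhom C (X i) (X (Suc i))"
  unfolding is_sequence_def by simp

lemma is_sequence_in: "is_sequence C d \<M> X f \<Longrightarrow> i \<le> d + 1 \<Longrightarrow> X i \<in> \<M>"
  unfolding is_sequence_def by simp

lemma d_kernel_exact:
  assumes "d_kernel C d \<M> X f" "M \<in> \<M>" "i < d"
  shows "exact_at (\<lambda>h. f i \<odot> h) (mhom C M (X i)) (\<lambda>h. f (Suc i) \<odot> h) (mhom C M (X (Suc i)))"
proof -
  have "\<forall>j\<in>{1..d}. exact_at (\<lambda>h. f (j - 1) \<odot> h) (mhom C M (X (j - 1)))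
      (\<lambda>h. f j \<odot> h) (mhom C M (X j))"
    using assms(1,2) unfolding d_kernel_def by simp
  from bspec[OF this, of "Suc i"] assms(3) show ?thesis by simp
qed

lemma d_cokernel_exact:
  assumes "d_cokernel C d \<M> X f" "M \<in> \<M>" "i < d"
  shows "exact_at (\<lambda>h. h \<odot> f (Suc i)) (mhom C (X (Suc (Suc i))) M)
           (\<lambda>h. h \<odot> f i) (mhom C (X (Suc i)) M)"
proof -
  have "\<forall>j\<in>{1..d}. exact_at (\<lambda>h. h \<odot> f j) (mhom C (X (j + 1)) M)
      (\<lambda>h. h \<odot> f (j - 1)) (mhom C (X j) M)"
    using assms(1,2) unfolding d_cokernel_def by simp
  from bspec[OF this, of "Suc i"] assms(3) show ?thesis by simp
qed

lemma d_kernel_complex: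
  assumes k: "d_kernel C d \<M> X f" and \<M>: "\<And>M. M \<in> \<M> \<Longrightarrow> right_module C M" and i: "i < d"
  shows "f (Suc i) \<odot> f i = 0"
proof -
  note s = d_kernel_is_sequence[OF k]
  have X: "X i \<in> \<M>" using is_sequence_in[OF s] i by simp
  have "f i \<odot> mone C (X i) = f i" using mone_right[OF is_sequence_mhom[OF s]] i by simp
  moreover have "f (Suc i) \<odot> f i \<odot> mone C (X i) = 0"
    using d_kernel_exact[OF k X i] mone_mhom[OF \<M>[OF X]] unfolding exact_at_iff by blast
  ultimately show ?thesis by simp
qed

text \<open>
  The component \<open>\<phi> k\<close> belongs to the terms with index \<open>k + 1\<close>. The sequence \<open>E\<close> is a \<open>d\<close>-cokernel sequence
  for test objects in \<open>\<M>\<close>, so a map on its second term extends step by step as soon as it is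
  annihilated by the two adjacent maps together.
\<close>

lemma chain_map_extension:
  assumes E: "d_cokernel C d \<M> E g" and X: "d_kernel C d \<M> X f"
    and \<M>: "\<And>M. M \<in> \<M> \<Longrightarrow> right_module C M"
    and \<phi>1: "\<phi>1 \<in> mhom C (E 1) (X 1)" "(f 1 \<odot> \<phi>1) \<odot> g 0 = 0" and n: "n \<le> d"
  shows "\<exists>\<phi>. \<phi> 0 = \<phi>1 \<and> (\<forall>k\<le>n. \<phi> k \<in> mhom C (E (Suc k)) (X (Suc k))) \<and>
    (\<forall>k<n. \<phi> (Suc k) \<odot> g (Suc k) = f (Suc k) \<odot> \<phi> k)"
  using n
proof (induction n)
  case 0
  then show ?case using \<phi>1 by (intro exI[of _ "\<lambda>_. \<phi>1"]) simp
next
  case (Suc n)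
  then obtain \<phi> where \<phi>: "\<phi> 0 = \<phi>1" "\<forall>k\<le>n. \<phi> k \<in> mhom C (E (Suc k)) (X (Suc k))"
    "\<forall>k<n. \<phi> (Suc k) \<odot> g (Suc k) = f (Suc k) \<odot> \<phi> k" by auto
  note s = d_kernel_is_sequence[OF X]
  have f: "f (Suc n) \<in> mhom C (X (Suc n)) (X (Suc (Suc n)))"
    using is_sequence_mhom[OF s] Suc.prems by simp
  have in1: "f (Suc n) \<odot> \<phi> n \<in> mhom C (E (Suc n)) (X (Suc (Suc n)))"
    using \<phi>(2) by (auto intro: mhom_comp f)
  have "(f (Suc n) \<odot> \<phi> n) \<odot> g n = 0"
  proof (cases n)
    case 0
    then show ?thesis using \<phi>1 \<phi>(1) by simp
  next
    case (Suc m)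
    then have "\<phi> n \<odot> g n = f n \<odot> \<phi> m" using \<phi>(3) by simp
    moreover have "f (Suc n) \<odot> f n = 0" using d_kernel_complex[OF X \<M>] Suc.prems by simp
    ultimately show ?thesis by (metis mcomp_assoc mcomp_zero_left)
  qed
  moreover have "X (Suc (Suc n)) \<in> \<M>" using is_sequence_in[OF s] Suc.prems by simp
  ultimately obtain h where h: "h \<in> mhom C (E (Suc (Suc n))) (X (Suc (Suc n)))"
    "h \<odot> g (Suc n) = f (Suc n) \<odot> \<phi> n"
    using d_cokernel_exact[OF E, of _ n] in1 Suc.prems unfolding exact_at_iff by (metis Suc_le_eq)
  show ?case
    using \<phi> h by (intro exI[of _ "\<phi>(Suc n := h)"]) (auto simp: less_Suc_eq le_Suc_eq)
qed

text \<open>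
  If the last component of a chain map lifts through the last map of the target, the chain map is
  homotopic to zero: subtracting the homotopy found so far leaves a map that is killed by the next
  map of \<open>X\<close>, and so lifts because \<open>X\<close> is a \<open>d\<close>-kernel sequence.
\<close>

lemma chain_homotopy_descent:
  assumes E: "d_kernel C d \<M> E g" and X: "d_kernel C d \<M> X f"
    and \<M>: "\<And>M. M \<in> \<M> \<Longrightarrow> right_module C M"
    and \<phi>: "\<And>k. k \<le> d \<Longrightarrow> \<phi> k \<in> mhom C (E (Suc k)) (X (Suc k))"
      "\<And>k. k < d \<Longrightarrow> \<phi> (Suc k) \<odot> g (Suc k) = f (Suc k) \<odot> \<phi> k"
    and h: "h \<in> mhom C (E (Suc d)) (X d)" "\<phi> d = f d \<odot> h" and d: "1 \<le> d"
  shows "\<exists>h1\<in>mhom C (E 1) (X 0). \<exists>h2\<in>mhom C (E 2) (X 1). \<phi> 0 = h2 \<odot> g 1 + f 0 \<odot> h1"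
proof -
  note sX = d_kernel_is_sequence[OF X] and sE = d_kernel_is_sequence[OF E]
  have mod: "right_module C (X i)" "E i \<in> \<M>" if "i \<le> d + 1" for i
    using \<M>[OF is_sequence_in[OF sX that]] is_sequence_in[OF sE that] by simp_all
  have step: "\<exists>h'\<in>mhom C (E (Suc k)) (X k). \<phi> k = h \<odot> g (Suc k) + f k \<odot> h'"
    if k: "k < d" and h: "h \<in> mhom C (E (Suc (Suc k))) (X (Suc k))"
      and 0: "(\<phi> (Suc k) - f (Suc k) \<odot> h) \<odot> g (Suc k) = 0" for k h
  proof -
    have g: "g (Suc k) \<in> mhom C (E (Suc k)) (E (Suc (Suc k)))" using is_sequence_mhom[OF sE] k by simp
    have f: "f (Suc k) \<in> mhom C (X (Suc k)) (X (Suc (Suc k)))" using is_sequence_mhom[OF sX] k by simp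
    have hg: "h \<odot> g (Suc k) \<in> mhom C (E (Suc k)) (X (Suc k))" by (rule mhom_comp[OF g h])
    have \<phi>k: "\<phi> k \<in> mhom C (E (Suc k)) (X (Suc k))" using \<phi>(1) k by simp
    have R: "right_module C (X (Suc k))" using mod(1)[of "Suc k"] k by simp
    have "f (Suc k) \<odot> (\<phi> k - h \<odot> g (Suc k)) = f (Suc k) \<odot> \<phi> k - f (Suc k) \<odot> h \<odot> g (Suc k)"
      by (rule mcomp_diff_right[OF R \<phi>k hg f])
    also have "\<dots> = 0" using 0 \<phi>(2)[OF k] by (simp add: mcomp_diff_left mcomp_assoc)
    finally obtain h' where "h' \<in> mhom C (E (Suc k)) (X k)" "f k \<odot> h' = \<phi> k - h \<odot> g (Suc k)"
      using d_kernel_exact[OF X mod(2)[of "Suc k"] k] mhom_diff[OF R \<phi>k hg] k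
      unfolding exact_at_iff by (metis Suc_eq_plus1 Suc_le_mono less_imp_le_nat)
    then show ?thesis by (intro bexI[of _ h']) simp_all
  qed
  have "\<exists>h\<in>mhom C (E (Suc (d - m))) (X (d - m)). (\<phi> (d - m) - f (d - m) \<odot> h) \<odot> g (d - m) = 0"
    if "m < d" for m
    using that
  proof (induction m)
    case 0
    then show ?case using h by (intro bexI[of _ h]) simp_all
  next
    case (Suc m)
    define k where "k = d - Suc m"
    have k: "d - m = Suc k" "d - Suc m = k" "k < d" using Suc.prems by (auto simp: k_def)
    from Suc obtain h where h: "h \<in> mhom C (E (Suc (Suc k))) (X (Suc k))"
      "(\<phi> (Suc k) - f (Suc k) \<odot> h) \<odot> g (Suc k) = 0" unfolding k by auto
    obtain h' where h': "h' \<in> mhom C (E (Suc k)) (X k)" "\<phi> k = h \<odot> g (Suc k) + f k \<odot> h'"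
      using step[OF k(3) h] by blast
    have "g (Suc k) \<odot> g k = 0" by (rule d_kernel_complex[OF E \<M> k(3)])
    then have "(\<phi> k - f k \<odot> h') \<odot> g k = 0"
      using mcomp_zero_right[OF h(1)] by (simp add: h' mcomp_assoc)
    then show ?case unfolding k using h' by blast
  qed
  from this[of "d - 1"] d obtain h where "h \<in> mhom C (E (Suc (Suc 0))) (X (Suc 0))"
    "(\<phi> (Suc 0) - f (Suc 0) \<odot> h) \<odot> g (Suc 0) = 0" by auto
  with step[of 0 h] d show ?thesis by (auto simp: numeral_2_eq_2)
qed

section \<open>Decompositions\<close>

definition decomp :: "('o, 'm, 'k::field) lincat \<Rightarrow> nat \<Rightarrow> ('o, 'm, 'k) rmod \<Rightarrow>
    (nat \<Rightarrow> ('o, 'm, 'k) rmod) \<Rightarrow> (nat \<Rightarrow> 'o \<Rightarrow> 'k kvec \<Rightarrow> 'k kvec) \<Rightarrow>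
    (nat \<Rightarrow> 'o \<Rightarrow> 'k kvec \<Rightarrow> 'k kvec) \<Rightarrow> bool" where
  "decomp C n Y Z a b \<longleftrightarrow>
    (\<forall>i<n. a i \<in> mhom C (Z i) Y \<and> b i \<in> mhom C Y (Z i)) \<and>
    (\<forall>i<n. \<forall>j<n. b j \<odot> a i = (if i = j then mone C (Z i) else 0)) \<and>
    (\<Sum>i<n. a i \<odot> b i) = mone C Y"

lemma decompD:
  assumes "decomp C n Y Z a b" "i < n"
  shows "a i \<in> mhom C (Z i) Y" "b i \<in> mhom C Y (Z i)"
    "\<And>j. j < n \<Longrightarrow> b j \<odot> a i = (if i = j then mone C (Z i) else 0)"
  using assms unfolding decomp_def by blast+

lemma decomp_sum: "decomp C n Y Z a b \<Longrightarrow> (\<Sum>i<n. a i \<odot> b i) = mone C Y"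
  unfolding decomp_def by blast

lemma is_dsum_decomp: "is_dsum C Y Xs \<longleftrightarrow> (\<exists>a b. decomp C (length Xs) Y (\<lambda>i. Xs ! i) a b)"
  unfolding is_dsum_def decomp_def by simp

lemma sum_append_index:
  fixes f g :: "nat \<Rightarrow> 'a::comm_monoid_add"
  shows "(\<Sum>i<n + m. if i < n then f i else g (i - n)) = (\<Sum>i<n. f i) + (\<Sum>i<m. g i)"
proof (induction m)
  case 0
  have "(\<Sum>i<n. if i < n then f i else g (i - n)) = (\<Sum>i<n. f i)" by (intro sum.cong) auto
  then show ?case by simp
next
  case (Suc m)
  then show ?case by (simp add: add.assoc)
qed

lemma factor_ideal_finite_sum:
  fixes C :: "('o, 'm, 'k::field) lincat"
  assumes "\<phi> \<in> factor_ideal C \<X> X Y"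
  shows "\<exists>n Z a b. (\<forall>i<n. Z i \<in> \<X> \<and> a i \<in> mhom C (Z i) Y \<and> b i \<in> mhom C X (Z i)) \<and>
    \<phi> = (\<Sum>i<(n::nat). a i \<odot> b i)"
  using assms
proof induction
  case zero
  show ?case by (rule exI[of _ 0]) simp
next
  case (comp Z a b)
  then show ?case
    by (intro exI[of _ 1] exI[of _ "\<lambda>_. Z"] exI[of _ "\<lambda>_. a"] exI[of _ "\<lambda>_. b"]) simp
next
  case (add \<phi> \<psi>)
  obtain n Z a b where 1: "\<forall>i<n. Z i \<in> \<X> \<and> a i \<in> mhom C (Z i) Y \<and> b i \<in> mhom C X (Z i)"
    "\<phi> = (\<Sum>i<(n::nat). a i \<odot> b i)" using add(3) by blast
  obtain m Z' a' b' where 2: "\<forall>i<m. Z' i \<in> \<X> \<and> a' i \<in> mhom C (Z' i) Y \<and> b' i \<in> mhom C X (Z' i)"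
    "\<psi> = (\<Sum>i<(m::nat). a' i \<odot> b' i)" using add(4) by blast
  define K where "K f g i = (if i < n then f i else g (i - n))"
    for f g :: "nat \<Rightarrow> 'o \<Rightarrow> 'k kvec \<Rightarrow> 'k kvec" and i
  define L where "L i = (if i < n then Z i else Z' (i - n))" for i
  have "(\<Sum>i<n + m. K a a' i \<odot> K b b' i) = (\<Sum>i<n + m. if i < n then a i \<odot> b i else a' (i - n) \<odot> b' (i - n))"
    by (intro sum.cong) (auto simp: K_def)
  then have "\<phi> + \<psi> = (\<Sum>i<n + m. K a a' i \<odot> K b b' i)"
    using 1(2) 2(2) sum_append_index[where f = "\<lambda>i. a i \<odot> b i" and g = "\<lambda>i. a' i \<odot> b' i"] by simp
  moreover have "\<forall>i<n + m. L i \<in> \<X> \<and> K a a' i \<in> mhom C (L i) Y \<and> K b b' i \<in> mhom C X (L i)"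
    using 1(1) 2(1) by (auto simp: K_def L_def)
  ultimately show ?case by blast
qed

section \<open>Families with at most one-dimensional morphism spaces\<close>

text \<open>
  What is used of the interval modules. The morphism \<open>\<epsilon> x y\<close> spans the morphism space, and \<open>R x y\<close> says
  that it is nonzero. An object with \<open>\<not> R x x\<close> is zero; such objects are allowed, since they occur at the
  degenerate places of a staircase. The weight \<open>\<mu>\<close> rules out cycles of nonzero morphisms between
  different objects.
\<close>

locale thin_family =
  fixes C :: "('o, 'm, 'k::field) lincat" and V :: "'x set" and E :: "'x \<Rightarrow> ('o, 'm, 'k) rmod"
    and R :: "'x \<Rightarrow> 'x \<Rightarrow> bool" and \<epsilon> :: "'x \<Rightarrow> 'x \<Rightarrow> 'o \<Rightarrow> 'k kvec \<Rightarrow> 'k kvec" and \<mu> :: "'x \<Rightarrow> int"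
  assumes module: "right_module C (E x)"
    and hom: "x \<in> V \<Longrightarrow> y \<in> V \<Longrightarrow> mhom C (E x) (E y) = range (\<lambda>c. msmul c (\<epsilon> x y))"
    and eps_zero: "\<not> R x y \<Longrightarrow> \<epsilon> x y = 0"
    and eps_nonzero: "R x y \<Longrightarrow> msmul c (\<epsilon> x y) = 0 \<Longrightarrow> c = 0"
    and eps_comp: "R x y \<Longrightarrow> R y z \<Longrightarrow> \<epsilon> y z \<odot> \<epsilon> x y = \<epsilon> x z"
    and eps_id: "x \<in> V \<Longrightarrow> \<epsilon> x x = mone C (E x)"
    and mu: "R x y \<Longrightarrow> x \<noteq> y \<Longrightarrow> \<mu> x < \<mu> y"
begin

lemma homE:
  assumes "x \<in> V" "y \<in> V" "\<phi> \<in> mhom C (E x) (E y)"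
  obtains c where "\<phi> = msmul c (\<epsilon> x y)"
  using assms hom by blast

lemma eps_hom: assumes "x \<in> V" "y \<in> V" shows "\<epsilon> x y \<in> mhom C (E x) (E y)"
  using hom[OF assms] msmul_simps(1) by (metis rangeI)

definition component :: "('o, 'm, 'k) rmod \<Rightarrow> ('o \<Rightarrow> 'k kvec \<Rightarrow> 'k kvec) \<Rightarrow> 'x \<Rightarrow>
    ('o \<Rightarrow> 'k kvec \<Rightarrow> 'k kvec) \<Rightarrow> ('o \<Rightarrow> 'k kvec \<Rightarrow> 'k kvec) \<Rightarrow> bool" where
  "component X p y a b \<longleftrightarrow>
    a \<in> mhom C (E y) X \<and> b \<in> mhom C X (E y) \<and> p \<odot> a = a \<and> b \<odot> p = b"

text \<open>
  The idempotent \<open>p\<close> is a sum of orthogonal idempotents, each of which splits through some \<open>E (x i)\<close> with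
  \<open>i \<in> S\<close>. The tuple \<open>x\<close> of objects stays the same while the morphisms may change.
\<close>

definition splits :: "('o, 'm, 'k) rmod \<Rightarrow> (nat \<Rightarrow> 'x) \<Rightarrow> nat set \<Rightarrow> ('o \<Rightarrow> 'k kvec \<Rightarrow> 'k kvec) \<Rightarrow> bool" where
  "splits X x S p \<longleftrightarrow> (\<exists>S' a' b'. S' \<subseteq> S \<and>
    (\<forall>i\<in>S'. component X p (x i) (a' i) (b' i)) \<and>
    (\<forall>i\<in>S'. \<forall>j\<in>S'. b' j \<odot> a' i = (if i = j then mone C (E (x i)) else 0)) \<and>
    p = (\<Sum>i\<in>S'. a' i \<odot> b' i))"

text \<open>
  The exchange argument behind the Krull-Schmidt theorem. If some composite \<open>b\<^sub>i a\<^sub>j\<close> between equal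
  objects is nonzero, it is an invertible scalar, and a copy of that object splits off; the rest of
  \<open>p\<close> needs one summand less. Otherwise the matrix of all \<open>b\<^sub>i a\<^sub>j\<close> is strictly triangular with respect
  to \<open>\<mu>\<close>. Being idempotent as well, it is zero, and then \<open>p\<close> is zero.
\<close>

lemma split_idempotent:
  fixes S :: "nat set"
  assumes X: "right_module C X"
  shows "finite S \<Longrightarrow> p \<in> mhom C X X \<Longrightarrow>
    (\<forall>i\<in>S. x i \<in> V \<and> component X p (x i) (a i) (b i)) \<Longrightarrow>
    p = (\<Sum>i\<in>S. a i \<odot> b i) \<Longrightarrow>
    splits X x S p"
proof (induction S arbitrary: p a b rule: measure_induct_rule[of card])
  case (less S)
  note fin = less.prems(1) and p = less.prems(2)
  have x: "x i \<in> V" and a: "a i \<in> mhom C (E (x i)) X" and b: "b i \<in> mhom C X (E (x i))"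
    and pa: "p \<odot> a i = a i" and bp: "b i \<odot> p = b i" if "i \<in> S" for i
    using bspec[OF less.prems(3) that] by (simp_all add: component_def)
  have ab: "a i \<odot> b i \<in> mhom C X X" if "i \<in> S" for i using mhom_comp[OF b a] that by blast
  have right: "\<psi> \<odot> p = (\<Sum>i\<in>S. \<psi> \<odot> a i \<odot> b i)" if "\<psi> \<in> mhom C X Z" for \<psi> Z
    unfolding less.prems(4) by (rule mcomp_sum_right[OF X ab that])
  show ?case
  proof (cases "\<exists>i\<in>S. \<exists>j\<in>S. x i = x j \<and> b i \<odot> a j \<noteq> 0")
    case True
    then obtain i j where ij: "i \<in> S" "j \<in> S" "x i = x j" and ne: "b i \<odot> a j \<noteq> 0" by blast
    let ?e = "mone C (E (x j))"
    have "b i \<odot> a j \<in> mhom C (E (x j)) (E (x j))" using mhom_comp[OF a[OF ij(2)] b[OF ij(1)]] ij(3) by simp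
    then obtain c where c: "b i \<odot> a j = msmul c ?e"
      using homE[OF x x] ij(2) eps_id[OF x[OF ij(2)]] by metis
    have c0: "c \<noteq> 0" using ne c by auto
    \<comment> \<open>Rescaling makes \<open>\<beta> \<alpha>\<close> the identity; the idempotent \<open>\<alpha> \<beta>\<close> is then split off from \<open>p\<close>.\<close>
    define \<alpha> where "\<alpha> = msmul (1 / c) (a j)"
    define \<beta> where "\<beta> = b i"
    define q where "q = p - \<alpha> \<odot> \<beta>"
    have \<alpha>: "\<alpha> \<in> mhom C (E (x j)) X" unfolding \<alpha>_def by (rule mhom_smul[OF X a[OF ij(2)]])
    have \<beta>: "\<beta> \<in> mhom C X (E (x j))" unfolding \<beta>_def using b[OF ij(1)] ij(3) by simp
    have \<beta>\<alpha>: "\<beta> \<odot> \<alpha> = ?e"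
      unfolding \<alpha>_def \<beta>_def using mcomp_smul_right[OF a b, of j i "1 / c"] ij c c0
      by simp
    have p\<alpha>: "p \<odot> \<alpha> = \<alpha>" unfolding \<alpha>_def using mcomp_smul_right[OF a p] pa ij(2) by metis
    have \<beta>p: "\<beta> \<odot> p = \<beta>" unfolding \<beta>_def by (rule bp[OF ij(1)])
    have \<alpha>\<beta>: "\<alpha> \<odot> \<beta> \<in> mhom C X X" by (rule mhom_comp[OF \<beta> \<alpha>])
    have q: "q \<in> mhom C X X" unfolding q_def by (rule mhom_diff[OF X p \<alpha>\<beta>])
    have pp: "p \<odot> p = p"
    proof -
      have "p \<odot> p = (\<Sum>i\<in>S. p \<odot> a i \<odot> b i)" by (rule right[OF p])
      also have "\<dots> = (\<Sum>i\<in>S. a i \<odot> b i)" by (intro sum.cong refl) (simp add: mcomp_assoc[symmetric] pa)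
      finally show ?thesis using less.prems(4) by simp
    qed
    have q\<alpha>: "q \<odot> \<alpha> = 0"
      unfolding q_def mcomp_diff_left by (simp add: mcomp_assoc \<beta>\<alpha> p\<alpha> mone_right[OF \<alpha>])
    have \<beta>q: "\<beta> \<odot> q = 0"
      unfolding q_def mcomp_diff_right[OF X p \<alpha>\<beta> \<beta>] \<beta>p
      by (simp add: mcomp_assoc[symmetric] \<beta>\<alpha> mone_left[OF \<beta>])
    have pq: "p \<odot> q = q"
      unfolding q_def mcomp_diff_right[OF X p \<alpha>\<beta> p] pp by (simp add: mcomp_assoc[symmetric] p\<alpha>)
    have qp: "q \<odot> p = q" unfolding q_def mcomp_diff_left pp by (simp add: mcomp_assoc \<beta>p)
    have qq: "q \<odot> q = q"
    proof -
      have "(p - \<alpha> \<odot> \<beta>) \<odot> q = q" unfolding mcomp_diff_left pq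
        by (simp add: mcomp_assoc \<beta>q mcomp_zero_right[OF \<alpha>])
      then show ?thesis by (simp add: q_def)
    qed
    define a0 where "a0 k = q \<odot> a k" for k
    define b0 where "b0 k = b k \<odot> q" for k
    have qaj: "a0 j = 0"
    proof -
      have "a j = msmul c \<alpha>" using c0 by (simp add: \<alpha>_def)
      then show ?thesis unfolding a0_def using mcomp_smul_right[OF \<alpha> q, of c] by (simp add: q\<alpha>)
    qed
    have S0: "card (S - {j}) < card S" by (rule card_Diff1_less[OF fin ij(2)])
    have P3: "\<forall>k\<in>S - {j}. x k \<in> V \<and> component X q (x k) (a0 k) (b0 k)"
      using x a b q by (auto simp: component_def a0_def b0_def mcomp_assoc[symmetric] qq intro: mhom_comp)
        (simp add: mcomp_assoc qq)
    have P4: "q = (\<Sum>k\<in>S - {j}. a0 k \<odot> b0 k)"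
    proof -
      have "q = q \<odot> p \<odot> q" by (simp add: pq qq)
      also have "\<dots> = (q \<odot> p) \<odot> q" by (simp add: mcomp_assoc)
      also have "\<dots> = (\<Sum>k\<in>S. q \<odot> a k \<odot> b k) \<odot> q" by (simp only: right[OF q])
      also have "\<dots> = (\<Sum>k\<in>S. a0 k \<odot> b0 k)"
        unfolding mcomp_sum_left by (simp add: a0_def b0_def mcomp_assoc)
      also have "\<dots> = a0 j \<odot> b0 j + (\<Sum>k\<in>S - {j}. a0 k \<odot> b0 k)"
        by (rule sum.remove[OF fin ij(2)])
      finally show ?thesis by (simp add: qaj)
    qed
    obtain S' a' b' where S': "S' \<subseteq> S - {j}"
      and 1: "\<forall>i\<in>S'. component X q (x i) (a' i) (b' i)"
      and 2: "\<forall>i\<in>S'. \<forall>j\<in>S'. b' j \<odot> a' i = (if i = j then mone C (E (x i)) else 0)"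
      and 3: "q = (\<Sum>i\<in>S'. a' i \<odot> b' i)"
      using less.IH[OF S0 _ q P3 P4] fin unfolding splits_def by auto
    have j: "j \<notin> S'" using S' by blast
    have comp: "a' k \<in> mhom C (E (x k)) X" "b' k \<in> mhom C X (E (x k))" "q \<odot> a' k = a' k" "b' k \<odot> q = b' k"
      if "k \<in> S'" for k using 1 that unfolding component_def by blast+
    have b'\<alpha>: "b' k \<odot> \<alpha> = 0" if "k \<in> S'" for k
    proof -
      have "(b' k \<odot> q) \<odot> \<alpha> = 0" unfolding mcomp_assoc q\<alpha> by (rule mcomp_zero_right[OF comp(2)[OF that]])
      then show ?thesis by (simp only: comp(4)[OF that])
    qed
    have \<beta>a': "\<beta> \<odot> a' k = 0" if "k \<in> S'" for k
    proof -
      have "\<beta> \<odot> q \<odot> a' k = 0" unfolding mcomp_assoc[symmetric] \<beta>q by simp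
      then show ?thesis by (simp only: comp(3)[OF that])
    qed
    have pa': "p \<odot> a' k = a' k" "b' k \<odot> p = b' k" if "k \<in> S'" for k
    proof -
      have "p \<odot> q \<odot> a' k = q \<odot> a' k" unfolding mcomp_assoc[symmetric] pq ..
      then show "p \<odot> a' k = a' k" by (simp only: comp(3)[OF that])
      have "(b' k \<odot> q) \<odot> p = b' k \<odot> q" unfolding mcomp_assoc qp ..
      then show "b' k \<odot> p = b' k" by (simp only: comp(4)[OF that])
    qed
    define a'' where "a'' = a'(j := \<alpha>)"
    define b'' where "b'' = b'(j := \<beta>)"
    have fS': "finite S'" using S' fin by (auto intro: finite_subset)
    have "(\<Sum>k\<in>S'. a'' k \<odot> b'' k) = q"
      unfolding 3 using j by (intro sum.cong) (auto simp: a''_def b''_def)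
    then have "(\<Sum>k\<in>insert j S'. a'' k \<odot> b'' k) = a'' j \<odot> b'' j + q"
      using sum.insert[OF fS' j, of "\<lambda>k. a'' k \<odot> b'' k"] by simp
    then have "p = (\<Sum>k\<in>insert j S'. a'' k \<odot> b'' k)"
      by (simp add: q_def a''_def b''_def)
    moreover have "\<forall>k\<in>insert j S'. component X p (x k) (a'' k) (b'' k)"
      using comp \<alpha> \<beta> p\<alpha> \<beta>p pa' by (simp add: a''_def b''_def component_def)
    moreover have "\<forall>k\<in>insert j S'. \<forall>l\<in>insert j S'. b'' l \<odot> a'' k = (if k = l then mone C (E (x k)) else 0)"
      using 2 \<beta>\<alpha> b'\<alpha> \<beta>a' j by (simp add: a''_def b''_def)
    moreover have "insert j S' \<subseteq> S" using S' ij(2) by blast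
    ultimately show ?thesis unfolding splits_def by blast
  next
    case False
    \<comment> \<open>A nonzero \<open>b\<^sub>m\<close> of least weight is zero after all, since \<open>b\<^sub>m = b\<^sub>m p\<close> and every \<open>b\<^sub>m a\<^sub>k b\<^sub>k\<close> vanishes.\<close>
    have b0: "b i = 0" if "i \<in> S" for i
    proof (rule ccontr)
      assume "b i \<noteq> 0"
      define T where "T = {i \<in> S. b i \<noteq> 0}"
      have T: "finite T" "T \<noteq> {}" using fin that \<open>b i \<noteq> 0\<close> by (auto simp: T_def)
      obtain m where m: "m \<in> T" "\<And>k. k \<in> T \<Longrightarrow> \<mu> (x m) \<le> \<mu> (x k)"
        using ex_min_if_finite[of "(\<lambda>i. \<mu> (x i)) ` T"] T by (auto simp: not_less)
      then have mS: "m \<in> S" by (simp add: T_def)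
      have "b m \<odot> a k \<odot> b k = 0" if k: "k \<in> S" for k
      proof (cases "b k = 0")
        case True
        then show ?thesis using mcomp_zero_right[OF mhom_comp[OF a[OF k] b[OF mS]]] by (simp add: mcomp_assoc)
      next
        case nz: False
        have le: "\<mu> (x m) \<le> \<mu> (x k)" using m(2) k nz by (simp add: T_def)
        have "b m \<odot> a k = 0"
        proof (cases "x m = x k")
          case True
          then show ?thesis using False mS k by blast
        next
          case ne: False
          then have "\<not> R (x k) (x m)" using mu[of "x k" "x m"] le by auto
          then show ?thesis using homE[OF x x mhom_comp[OF a b], OF k mS k mS] eps_zero by (metis msmul_simps(3))
        qed
        then show ?thesis by (simp add: mcomp_assoc[symmetric])
      qed
      then have "b m \<odot> p = 0" unfolding right[OF b[OF mS]] by simp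
      then show False using bp[OF mS] m(1) by (simp add: T_def)
    qed
    have "a i \<odot> b i = 0" if "i \<in> S" for i using b0[OF that] mcomp_zero_right[OF a[OF that]] by simp
    then have "p = 0" unfolding less.prems(4) by simp
    then show ?thesis unfolding splits_def by (intro exI[of _ "{}"]) simp
  qed
qed

lemma retract_decomp:
  assumes X: "right_module C X" and J: "J \<subseteq> V" and m: "mone C X \<in> factor_ideal C (E ` J) X X"
  shows "\<exists>xs a b. set xs \<subseteq> J \<and> decomp C (length xs) X (\<lambda>i. E (xs ! i)) a b"
proof -
  obtain n Z a b where 1: "\<forall>i<n. Z i \<in> E ` J \<and> a i \<in> mhom C (Z i) X \<and> b i \<in> mhom C X (Z i)"
    and s: "mone C X = (\<Sum>i<(n::nat). a i \<odot> b i)" using factor_ideal_finite_sum[OF m] by blast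
  have "\<forall>i. \<exists>y. i < n \<longrightarrow> y \<in> J \<and> Z i = E y" using 1 by blast
  then obtain x where x: "\<And>i. i < n \<Longrightarrow> x i \<in> J \<and> Z i = E (x i)" by metis
  have ab: "\<forall>i\<in>{..<n}. x i \<in> V \<and> component X (mone C X) (x i) (a i) (b i)"
  proof
    fix i assume "i \<in> {..<n}"
    then have "Z i \<in> E ` J \<and> a i \<in> mhom C (Z i) X \<and> b i \<in> mhom C X (Z i)" "x i \<in> J" "Z i = E (x i)"
      using 1 x by auto
    then show "x i \<in> V \<and> component X (mone C X) (x i) (a i) (b i)"
      using J mone_left[of "a i"] mone_right[of "b i"] by (auto simp: component_def)
  qed
  obtain S' a' b' where S': "S' \<subseteq> {..<n}"
    and 2: "\<forall>i\<in>S'. component X (mone C X) (x i) (a' i) (b' i)"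
    and 3: "\<forall>i\<in>S'. \<forall>j\<in>S'. b' j \<odot> a' i = (if i = j then mone C (E (x i)) else 0)"
    and 4: "mone C X = (\<Sum>i\<in>S'. a' i \<odot> b' i)"
    using split_idempotent[OF X finite_lessThan mone_mhom[OF X] ab s] unfolding splits_def by blast
  define L where "L = sorted_list_of_set S'"
  have fS: "finite S'" using S' finite_subset by blast
  have L: "set L = S'" "distinct L" using fS by (auto simp: L_def)
  have Lin: "L ! i \<in> S'" if "i < length L" for i using nth_mem[OF that] L(1) by simp
  have "(\<Sum>i<length L. a' (L ! i) \<odot> b' (L ! i)) = mone C X"
    unfolding 4 by (rule sum.reindex_bij_betw) (rule bij_betw_nth[OF L(2)], simp_all add: L(1))
  then have "decomp C (length (map x L)) X (\<lambda>i. E (map x L ! i)) (\<lambda>i. a' (L ! i)) (\<lambda>i. b' (L ! i))"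
    unfolding decomp_def using 2[unfolded component_def] 3 Lin nth_eq_iff_index_eq[OF L(2)] by simp
  moreover have "set (map x L) \<subseteq> J" using x L(1) S' by auto
  ultimately show ?thesis by blast
qed

end

section \<open>Exactness of diagonal complexes\<close>

text \<open>
  Three spaces with bases indexed by \<open>P\<close>, \<open>Q\<close> and \<open>R\<close>, and maps that fix the basis vectors with a common
  index and kill the others. The kernel of the second map is spanned by \<open>Q - R\<close> and the image of the
  first one by \<open>P \<inter> Q\<close>. The first and the third space enter only through the parametrisation \<open>SA\<close> and
  the description of the kernel, so that the zero terms at the ends of a sequence are covered.
\<close>

lemma exact_at_based:
  fixes vB :: "nat \<Rightarrow> 'o \<Rightarrow> 'k::field kvec \<Rightarrow> 'k kvec"
  assumes fin: "finite P" "finite Q"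
    and HA: "HA = range (\<lambda>c. SA c)"
    and HB: "HB = range (\<lambda>c. \<Sum>i\<in>Q. msmul (c i) (vB i))"
    and \<alpha>: "\<And>c. \<alpha> (SA c) = (\<Sum>i\<in>P \<inter> Q. msmul (c i) (vB i))"
    and \<beta>: "\<And>c. \<beta> (\<Sum>i\<in>Q. msmul (c i) (vB i)) = 0 \<longleftrightarrow> (\<forall>i\<in>Q \<inter> R. c i = 0)"
    and cond: "\<And>i. i \<in> Q \<Longrightarrow> i \<in> P \<longleftrightarrow> i \<notin> R"
  shows "exact_at \<alpha> HA \<beta> HB"
  unfolding exact_at_iff
proof (intro conjI ballI impI)
  have cut: "(\<Sum>i\<in>P \<inter> Q. msmul (c i) (vB i)) = (\<Sum>i\<in>Q. msmul (if i \<in> P then c i else 0) (vB i))" for c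
  proof -
    have "(\<Sum>i\<in>P \<inter> Q. msmul (c i) (vB i)) = (\<Sum>i\<in>P \<inter> Q. msmul (if i \<in> P then c i else 0) (vB i))"
      by (intro sum.cong) auto
    also have "\<dots> = (\<Sum>i\<in>Q. msmul (if i \<in> P then c i else 0) (vB i))"
      using fin by (intro sum.mono_neutral_left) auto
    finally show ?thesis .
  qed
  {
    fix a assume "a \<in> HA"
    then obtain c where a: "a = SA c" using HA by blast
    show "\<alpha> a \<in> HB" unfolding a \<alpha> cut HB by (rule rangeI)
    show "\<beta> (\<alpha> a) = 0" unfolding a \<alpha> cut \<beta> using cond by simp
  }
  fix b assume "b \<in> HB" and 0: "\<beta> b = 0"
  then obtain c where b: "b = (\<Sum>i\<in>Q. msmul (c i) (vB i))" using HB by blast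
  have "\<forall>i\<in>Q \<inter> R. c i = 0" using 0 unfolding b \<beta> .
  then have "(\<Sum>i\<in>Q. msmul (if i \<in> P then c i else 0) (vB i)) = b"
    unfolding b using cond by (intro sum.cong refl) (metis IntI)
  then have "\<alpha> (SA c) = b" unfolding \<alpha> cut .
  then show "\<exists>a\<in>HA. \<alpha> a = b" using HA by blast
qed

context thin_family
begin

text \<open>
  The diagonal map between two direct sums over the same index set, with the basis morphism in each
  place.
\<close>

definition diag :: "nat \<Rightarrow> (nat \<Rightarrow> 'x) \<Rightarrow> (nat \<Rightarrow> 'x) \<Rightarrow> (nat \<Rightarrow> 'o \<Rightarrow> 'k kvec \<Rightarrow> 'k kvec) \<Rightarrow>
    (nat \<Rightarrow> 'o \<Rightarrow> 'k kvec \<Rightarrow> 'k kvec) \<Rightarrow> 'o \<Rightarrow> 'k kvec \<Rightarrow> 'k kvec" where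
  "diag n p q a b = (\<Sum>i<n. a i \<odot> \<epsilon> (p i) (q i) \<odot> b i)"

lemma diag_hom:
  assumes A: "decomp C n A (\<lambda>i. E (p i)) aA bA" and B: "decomp C n B (\<lambda>i. E (q i)) aB bB"
    and V: "\<And>i. i < n \<Longrightarrow> p i \<in> V \<and> q i \<in> V" and mB: "right_module C B"
  shows "diag n p q aB bA \<in> mhom C A B"
  unfolding diag_def
  by (intro mhom_sum[OF mB] mhom_comp[OF mhom_comp[OF decompD(2)[OF A] eps_hom] decompD(1)[OF B]])
    (use V in auto)

lemma diag_inj:
  assumes A: "decomp C n A (\<lambda>i. E (p i)) aA bA" and mA: "right_module C A" and j: "j < n"
    and B: "\<And>i. i < n \<Longrightarrow> aB i \<in> mhom C (E (q i)) B" and V: "\<And>i. i < n \<Longrightarrow> p i \<in> V \<and> q i \<in> V"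
    and mB: "right_module C B"
  shows "diag n p q aB bA \<odot> aA j = aB j \<odot> \<epsilon> (p j) (q j)"
proof -
  have "diag n p q aB bA \<odot> aA j = (\<Sum>i<n. (aB i \<odot> \<epsilon> (p i) (q i)) \<odot> bA i \<odot> aA j)"
    unfolding diag_def mcomp_sum_left by (simp add: mcomp_assoc)
  also have "\<dots> = (\<Sum>i<n. if i = j then aB j \<odot> \<epsilon> (p j) (q j) else 0)"
  proof (intro sum.cong refl)
    fix i assume "i \<in> {..<n}"
    then have i: "i < n" by simp
    have h: "aB i \<odot> \<epsilon> (p i) (q i) \<in> mhom C (E (p i)) B"
      using mhom_comp[OF eps_hom B[OF i]] V[OF i] by blast
    show "(aB i \<odot> \<epsilon> (p i) (q i)) \<odot> bA i \<odot> aA j = (if i = j then aB j \<odot> \<epsilon> (p j) (q j) else 0)"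
      using decompD(3)[OF A j i] mone_right[OF h] mcomp_zero_right[OF h] by auto
  qed
  also have "\<dots> = aB j \<odot> \<epsilon> (p j) (q j)" using j by simp
  finally show ?thesis .
qed

lemma diag_proj:
  assumes B: "decomp C n B (\<lambda>i. E (q i)) aB bB" and j: "j < n"
    and A: "\<And>i. i < n \<Longrightarrow> bA i \<in> mhom C A (E (p i))" and V: "\<And>i. i < n \<Longrightarrow> p i \<in> V \<and> q i \<in> V"
    and mB: "right_module C B"
  shows "bB j \<odot> diag n p q aB bA = \<epsilon> (p j) (q j) \<odot> bA j"
proof -
  have h: "\<epsilon> (p i) (q i) \<odot> bA i \<in> mhom C A (E (q i))" if "i < n" for i
    using mhom_comp[OF A[OF that] eps_hom] V[OF that] by blast
  have "bB j \<odot> diag n p q aB bA = (\<Sum>i<n. bB j \<odot> aB i \<odot> \<epsilon> (p i) (q i) \<odot> bA i)"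
    unfolding diag_def
    by (rule mcomp_sum_right[OF mB mhom_comp[OF h decompD(1)[OF B]] decompD(2)[OF B j]]) auto
  also have "\<dots> = (\<Sum>i<n. if i = j then \<epsilon> (p j) (q j) \<odot> bA j else 0)"
  proof (intro sum.cong refl)
    fix i assume "i \<in> {..<n}"
    then have i: "i < n" by simp
    show "bB j \<odot> aB i \<odot> \<epsilon> (p i) (q i) \<odot> bA i = (if i = j then \<epsilon> (p j) (q j) \<odot> bA j else 0)"
      using decompD(3)[OF B i j] mone_left[OF h[OF i]]
      by (auto simp: mcomp_assoc[symmetric, of "bB j" "aB i"])
  qed
  also have "\<dots> = \<epsilon> (p j) (q j) \<odot> bA j" using j by simp
  finally show ?thesis .
qed

text \<open>
  The places of a direct sum that receive a nonzero morphism from \<open>u\<close>. They index a basis of the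
  morphisms from \<open>E u\<close> to the sum.
\<close>

definition row :: "'x \<Rightarrow> nat \<Rightarrow> (nat \<Rightarrow> 'x) \<Rightarrow> nat set" where
  "row u n p = {i. i < n \<and> R u (p i)}"

definition col :: "'x \<Rightarrow> nat \<Rightarrow> (nat \<Rightarrow> 'x) \<Rightarrow> nat set" where
  "col u n p = {i. i < n \<and> R (p i) u}"

definition row_sum :: "'x \<Rightarrow> nat \<Rightarrow> (nat \<Rightarrow> 'x) \<Rightarrow> (nat \<Rightarrow> 'o \<Rightarrow> 'k kvec \<Rightarrow> 'k kvec) \<Rightarrow> (nat \<Rightarrow> 'k) \<Rightarrow>
    'o \<Rightarrow> 'k kvec \<Rightarrow> 'k kvec" where
  "row_sum u n p a c = (\<Sum>i\<in>row u n p. msmul (c i) (a i \<odot> \<epsilon> u (p i)))"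

definition col_sum :: "'x \<Rightarrow> nat \<Rightarrow> (nat \<Rightarrow> 'x) \<Rightarrow> (nat \<Rightarrow> 'o \<Rightarrow> 'k kvec \<Rightarrow> 'k kvec) \<Rightarrow> (nat \<Rightarrow> 'k) \<Rightarrow>
    'o \<Rightarrow> 'k kvec \<Rightarrow> 'k kvec" where
  "col_sum u n p b c = (\<Sum>i\<in>col u n p. msmul (c i) (\<epsilon> (p i) u \<odot> b i))"

lemma finite_row [simp]: "finite (row u n p)" and finite_col [simp]: "finite (col u n p)"
  by (simp_all add: row_def col_def)

lemma row_sum_hom:
  assumes A: "\<And>i. i < n \<Longrightarrow> a i \<in> mhom C (E (p i)) A" and mA: "right_module C A" and u: "u \<in> V"
    and V: "\<And>i. i < n \<Longrightarrow> p i \<in> V"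
  shows "row_sum u n p a c \<in> mhom C (E u) A"
  unfolding row_sum_def
  by (intro mhom_sum[OF mA] mhom_smul[OF mA] mhom_comp[OF eps_hom A]) (use u V in \<open>auto simp: row_def\<close>)

lemma col_sum_hom:
  assumes A: "\<And>i. i < n \<Longrightarrow> b i \<in> mhom C A (E (p i))" and u: "u \<in> V"
    and V: "\<And>i. i < n \<Longrightarrow> p i \<in> V"
  shows "col_sum u n p b c \<in> mhom C A (E u)"
  unfolding col_sum_def
  by (intro mhom_sum[OF module] mhom_smul[OF module] mhom_comp[OF A eps_hom])
    (use u V in \<open>auto simp: col_def\<close>)

lemma hom_row:
  assumes A: "decomp C n A (\<lambda>i. E (p i)) a b" and mA: "right_module C A" and u: "u \<in> V"
    and V: "\<And>i. i < n \<Longrightarrow> p i \<in> V"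
  shows "mhom C (E u) A = range (row_sum u n p a)"
proof (intro equalityI subsetI)
  fix h assume h: "h \<in> mhom C (E u) A"
  have "\<exists>c. b i \<odot> h = msmul c (\<epsilon> u (p i))" if "i < n" for i
    using homE[OF u V[OF that] mhom_comp[OF h decompD(2)[OF A that]]] by blast
  then obtain c where c: "\<And>i. i < n \<Longrightarrow> b i \<odot> h = msmul (c i) (\<epsilon> u (p i))" by metis
  have ca: "a i \<odot> b i \<odot> h = msmul (c i) (a i \<odot> \<epsilon> u (p i))" if "i < n" for i
    unfolding c[OF that] using mcomp_smul_right[OF eps_hom[OF u V[OF that]] decompD(1)[OF A that]] .
  have "h = mone C A \<odot> h" by (simp add: mone_left[OF h])
  also have "\<dots> = (\<Sum>i<n. a i \<odot> b i \<odot> h)"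
    unfolding decomp_sum[OF A, symmetric] mcomp_sum_left by (simp add: mcomp_assoc)
  also have "\<dots> = (\<Sum>i<n. msmul (c i) (a i \<odot> \<epsilon> u (p i)))" by (intro sum.cong) (auto simp: ca)
  also have "\<dots> = row_sum u n p a c"
    unfolding row_sum_def using mcomp_zero_right[OF decompD(1)[OF A]]
    by (intro sum.mono_neutral_right) (auto simp: row_def eps_zero)
  finally show "h \<in> range (row_sum u n p a)" by blast
next
  fix h assume "h \<in> range (row_sum u n p a)"
  then show "h \<in> mhom C (E u) A" using row_sum_hom[OF decompD(1)[OF A] mA u V] by auto
qed

lemma hom_col:
  assumes A: "decomp C n A (\<lambda>i. E (p i)) a b" and mA: "right_module C A" and u: "u \<in> V"
    and V: "\<And>i. i < n \<Longrightarrow> p i \<in> V"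
  shows "mhom C A (E u) = range (col_sum u n p b)"
proof (intro equalityI subsetI)
  fix h assume h: "h \<in> mhom C A (E u)"
  have "\<exists>c. h \<odot> a i = msmul c (\<epsilon> (p i) u)" if "i < n" for i
    using homE[OF V[OF that] u mhom_comp[OF decompD(1)[OF A that] h]] by blast
  then obtain c where c: "\<And>i. i < n \<Longrightarrow> h \<odot> a i = msmul (c i) (\<epsilon> (p i) u)" by metis
  have ca: "h \<odot> a i \<odot> b i = msmul (c i) (\<epsilon> (p i) u \<odot> b i)" if "i < n" for i
    unfolding mcomp_assoc[symmetric] c[OF that] by (rule mcomp_smul_left)
  have "h = h \<odot> mone C A" by (simp add: mone_right[OF h])
  also have "\<dots> = (\<Sum>i<n. h \<odot> a i \<odot> b i)"
    unfolding decomp_sum[OF A, symmetric]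
    by (rule mcomp_sum_right[OF mA mhom_comp[OF decompD(2)[OF A] decompD(1)[OF A]] h]) auto
  also have "\<dots> = (\<Sum>i<n. msmul (c i) (\<epsilon> (p i) u \<odot> b i))" by (intro sum.cong) (auto simp: ca)
  also have "\<dots> = col_sum u n p b c"
    unfolding col_sum_def by (intro sum.mono_neutral_right) (auto simp: col_def eps_zero)
  finally show "h \<in> range (col_sum u n p b)" by blast
next
  fix h assume "h \<in> range (col_sum u n p b)"
  then show "h \<in> mhom C A (E u)" using col_sum_hom[OF decompD(2)[OF A] u V] by auto
qed

lemma row_sum_zero_iff:
  assumes A: "decomp C n A (\<lambda>i. E (p i)) a b" and mA: "right_module C A" and u: "u \<in> V"
    and V: "\<And>i. i < n \<Longrightarrow> p i \<in> V" and S: "S \<subseteq> row u n p"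
  shows "(\<Sum>i\<in>S. msmul (c i) (a i \<odot> \<epsilon> u (p i))) = 0 \<longleftrightarrow> (\<forall>i\<in>S. c i = 0)"
proof
  assume 0: "(\<Sum>i\<in>S. msmul (c i) (a i \<odot> \<epsilon> u (p i))) = 0"
  have fS: "finite S" by (rule finite_subset[OF S finite_row])
  show "\<forall>i\<in>S. c i = 0"
  proof
    fix j assume j: "j \<in> S"
    then have jn: "j < n" "R u (p j)" using S by (auto simp: row_def)
    have summand: "msmul (c i) (a i \<odot> \<epsilon> u (p i)) \<in> mhom C (E u) A" if "i \<in> S" for i
      using that S u V by (intro mhom_smul[OF mA] mhom_comp[OF eps_hom decompD(1)[OF A]]) (auto simp: row_def)
    have "0 = b j \<odot> (\<Sum>i\<in>S. msmul (c i) (a i \<odot> \<epsilon> u (p i)))"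
      unfolding 0 by (rule mcomp_zero_right[OF decompD(2)[OF A jn(1)], symmetric])
    also have "\<dots> = (\<Sum>i\<in>S. b j \<odot> msmul (c i) (a i \<odot> \<epsilon> u (p i)))"
      by (rule mcomp_sum_right[OF mA summand decompD(2)[OF A jn(1)]])
    also have "\<dots> = (\<Sum>i\<in>S. if i = j then msmul (c j) (\<epsilon> u (p j)) else 0)"
    proof (intro sum.cong refl)
      fix i assume "i \<in> S"
      then have i: "i < n" using S by (auto simp: row_def)
      have "b j \<odot> msmul (c i) (a i \<odot> \<epsilon> u (p i)) = msmul (c i) ((b j \<odot> a i) \<odot> \<epsilon> u (p i))"
        unfolding mcomp_assoc
        by (rule mcomp_smul_right[OF mhom_comp[OF eps_hom[OF u V[OF i]] decompD(1)[OF A i]] decompD(2)[OF A jn(1)]])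
      then show "b j \<odot> msmul (c i) (a i \<odot> \<epsilon> u (p i)) = (if i = j then msmul (c j) (\<epsilon> u (p j)) else 0)"
        using decompD(3)[OF A i jn(1)] mone_left[OF eps_hom[OF u V[OF i]]] by auto
    qed
    also have "\<dots> = msmul (c j) (\<epsilon> u (p j))" using fS j by simp
    finally show "c j = 0" using eps_nonzero[OF jn(2)] by simp
  qed
qed simp

lemma col_sum_zero_iff:
  assumes A: "decomp C n A (\<lambda>i. E (p i)) a b" and u: "u \<in> V"
    and V: "\<And>i. i < n \<Longrightarrow> p i \<in> V" and S: "S \<subseteq> col u n p"
  shows "(\<Sum>i\<in>S. msmul (c i) (\<epsilon> (p i) u \<odot> b i)) = 0 \<longleftrightarrow> (\<forall>i\<in>S. c i = 0)"
proof
  assume 0: "(\<Sum>i\<in>S. msmul (c i) (\<epsilon> (p i) u \<odot> b i)) = 0"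
  have fS: "finite S" by (rule finite_subset[OF S finite_col])
  show "\<forall>i\<in>S. c i = 0"
  proof
    fix j assume j: "j \<in> S"
    then have jn: "j < n" "R (p j) u" using S by (auto simp: col_def)
    have "0 = (\<Sum>i\<in>S. msmul (c i) (\<epsilon> (p i) u \<odot> b i)) \<odot> a j" unfolding 0 by simp
    also have "\<dots> = (\<Sum>i\<in>S. msmul (c i) (\<epsilon> (p i) u \<odot> b i \<odot> a j))"
      unfolding mcomp_sum_left mcomp_smul_left mcomp_assoc ..
    also have "\<dots> = (\<Sum>i\<in>S. if i = j then msmul (c j) (\<epsilon> (p j) u) else 0)"
    proof (intro sum.cong refl)
      fix i assume "i \<in> S"
      then have i: "i < n" using S by (auto simp: col_def)
      show "msmul (c i) (\<epsilon> (p i) u \<odot> b i \<odot> a j) = (if i = j then msmul (c j) (\<epsilon> (p j) u) else 0)"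
        using decompD(3)[OF A jn(1) i] mone_right[OF eps_hom[OF V[OF i] u]]
          mcomp_zero_right[OF eps_hom[OF V[OF i] u]] by auto
    qed
    also have "\<dots> = msmul (c j) (\<epsilon> (p j) u)" using fS j by simp
    finally show "c j = 0" using eps_nonzero[OF jn(2)] by simp
  qed
qed simp

text \<open>
  Composition with a diagonal map sends the basis morphism of a place to the basis morphism of the
  same place, because composites of basis morphisms are again basis morphisms or zero.
\<close>

lemma diag_row_sum:
  assumes A: "decomp C n A (\<lambda>i. E (p i)) aA bA" and B: "decomp C n B (\<lambda>i. E (q i)) aB bB"
    and mA: "right_module C A" and mB: "right_module C B"
    and V: "\<And>i. i < n \<Longrightarrow> p i \<in> V \<and> q i \<in> V" and u: "u \<in> V"
    and R: "\<And>i. i < n \<Longrightarrow> R u (p i) \<Longrightarrow> R u (q i) \<Longrightarrow> R (p i) (q i)"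
  shows "diag n p q aB bA \<odot> row_sum u n p aA c =
    (\<Sum>i\<in>row u n p \<inter> row u n q. msmul (c i) (aB i \<odot> \<epsilon> u (q i)))"
proof -
  have dh: "diag n p q aB bA \<in> mhom C A B" by (rule diag_hom[OF A B V mB])
  have 1: "aA i \<odot> \<epsilon> u (p i) \<in> mhom C (E u) A" if "i < n" for i
    using mhom_comp[OF eps_hom decompD(1)[OF A that]] V[OF that] u by blast
  have "diag n p q aB bA \<odot> row_sum u n p aA c =
      (\<Sum>i\<in>row u n p. diag n p q aB bA \<odot> msmul (c i) (aA i \<odot> \<epsilon> u (p i)))"
    unfolding row_sum_def
    by (rule mcomp_sum_right[OF mA mhom_smul[OF mA 1] dh]) (simp add: row_def)
  also have "\<dots> = (\<Sum>i\<in>row u n p. msmul (c i) (aB i \<odot> \<epsilon> (p i) (q i) \<odot> \<epsilon> u (p i)))"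
  proof (intro sum.cong refl)
    fix i assume "i \<in> row u n p"
    then have i: "i < n" by (simp add: row_def)
    have "diag n p q aB bA \<odot> aA i \<odot> \<epsilon> u (p i) = aB i \<odot> \<epsilon> (p i) (q i) \<odot> \<epsilon> u (p i)"
      using diag_inj[OF A mA i decompD(1)[OF B] V mB] by (simp add: mcomp_assoc[symmetric])
    then show "diag n p q aB bA \<odot> msmul (c i) (aA i \<odot> \<epsilon> u (p i)) =
        msmul (c i) (aB i \<odot> \<epsilon> (p i) (q i) \<odot> \<epsilon> u (p i))"
      using mcomp_smul_right[OF 1[OF i] dh] by simp
  qed
  also have "\<dots> = (\<Sum>i\<in>row u n p. msmul (c i) (aB i \<odot> \<epsilon> u (q i)))"
  proof (intro sum.cong refl)
    fix i assume "i \<in> row u n p"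
    then have i: "i < n" and r: "R u (p i)" by (simp_all add: row_def)
    have "\<epsilon> (p i) (q i) \<odot> \<epsilon> u (p i) = \<epsilon> u (q i)"
      using eps_comp[OF r] eps_zero R[OF i r] by (cases "R (p i) (q i)") auto
    then show "msmul (c i) (aB i \<odot> \<epsilon> (p i) (q i) \<odot> \<epsilon> u (p i)) = msmul (c i) (aB i \<odot> \<epsilon> u (q i))" by simp
  qed
  also have "\<dots> = (\<Sum>i\<in>row u n p \<inter> row u n q. msmul (c i) (aB i \<odot> \<epsilon> u (q i)))"
    using mcomp_zero_right[OF decompD(1)[OF B]]
    by (intro sum.mono_neutral_right) (auto simp: row_def eps_zero)
  finally show ?thesis .
qed

lemma diag_col_sum:
  assumes A: "decomp C n A (\<lambda>i. E (p i)) aA bA" and B: "decomp C n B (\<lambda>i. E (q i)) aB bB"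
    and mB: "right_module C B"
    and V: "\<And>i. i < n \<Longrightarrow> p i \<in> V \<and> q i \<in> V" and u: "u \<in> V"
    and R: "\<And>i. i < n \<Longrightarrow> R (p i) u \<Longrightarrow> R (q i) u \<Longrightarrow> R (p i) (q i)"
  shows "col_sum u n q bB c \<odot> diag n p q aB bA =
    (\<Sum>i\<in>col u n q \<inter> col u n p. msmul (c i) (\<epsilon> (p i) u \<odot> bA i))"
proof -
  have "col_sum u n q bB c \<odot> diag n p q aB bA =
      (\<Sum>i\<in>col u n q. msmul (c i) (\<epsilon> (q i) u \<odot> \<epsilon> (p i) (q i) \<odot> bA i))"
    unfolding col_sum_def mcomp_sum_left mcomp_smul_left mcomp_assoc
    using diag_proj[OF B _ decompD(2)[OF A] V mB] by (intro sum.cong) (auto simp: col_def)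
  also have "\<dots> = (\<Sum>i\<in>col u n q. msmul (c i) (\<epsilon> (p i) u \<odot> bA i))"
  proof (intro sum.cong refl)
    fix i assume "i \<in> col u n q"
    then have i: "i < n" and r: "R (q i) u" by (simp_all add: col_def)
    have "\<epsilon> (q i) u \<odot> \<epsilon> (p i) (q i) = \<epsilon> (p i) u"
      using eps_comp[OF _ r] eps_zero R[OF i _ r] mcomp_zero_right[OF eps_hom[OF _ u]] V[OF i]
      by (cases "R (p i) (q i)") auto
    then show "msmul (c i) (\<epsilon> (q i) u \<odot> \<epsilon> (p i) (q i) \<odot> bA i) = msmul (c i) (\<epsilon> (p i) u \<odot> bA i)"
      by (simp add: mcomp_assoc[symmetric])
  qed
  also have "\<dots> = (\<Sum>i\<in>col u n q \<inter> col u n p. msmul (c i) (\<epsilon> (p i) u \<odot> bA i))"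
    by (intro sum.mono_neutral_right) (auto simp: col_def eps_zero)
  finally show ?thesis .
qed

end

context thin_family
begin

lemma diag_row_sum_zero_iff:
  assumes B: "decomp C n B (\<lambda>i. E (q i)) aB bB" and D: "decomp C n D (\<lambda>i. E (r i)) aD bD"
    and m: "right_module C B" "right_module C D"
    and V: "\<And>i. i < n \<Longrightarrow> q i \<in> V \<and> r i \<in> V" and u: "u \<in> V"
    and R: "\<And>i. i < n \<Longrightarrow> R u (q i) \<Longrightarrow> R u (r i) \<Longrightarrow> R (q i) (r i)"
  shows "diag n q r aD bB \<odot> (\<Sum>i\<in>row u n q. msmul (c i) (aB i \<odot> \<epsilon> u (q i))) = 0 \<longleftrightarrow>
    (\<forall>i\<in>row u n q \<inter> row u n r. c i = 0)"
proof -
  have "\<And>i. i < n \<Longrightarrow> r i \<in> V" using V by blast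
  then show ?thesis
    using diag_row_sum[OF B D m V u R] row_sum_zero_iff[OF D m(2) u _ Int_lower2] unfolding row_sum_def by simp
qed

lemma diag_col_sum_zero_iff:
  assumes A: "decomp C n A (\<lambda>i. E (p i)) aA bA" and B: "decomp C n B (\<lambda>i. E (q i)) aB bB"
    and m: "right_module C B"
    and V: "\<And>i. i < n \<Longrightarrow> p i \<in> V \<and> q i \<in> V" and u: "u \<in> V"
    and R: "\<And>i. i < n \<Longrightarrow> R (p i) u \<Longrightarrow> R (q i) u \<Longrightarrow> R (p i) (q i)"
  shows "(\<Sum>i\<in>col u n q. msmul (c i) (\<epsilon> (q i) u \<odot> bB i)) \<odot> diag n p q aB bA = 0 \<longleftrightarrow>
    (\<forall>i\<in>col u n q \<inter> col u n p. c i = 0)"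
proof -
  have "\<And>i. i < n \<Longrightarrow> p i \<in> V" using V by blast
  then show ?thesis
    using diag_col_sum[OF A B m V u R] col_sum_zero_iff[OF A u _ Int_lower2] unfolding col_sum_def by simp
qed

lemma exact_row:
  assumes A: "decomp C n A (\<lambda>i. E (p i)) aA bA" and B: "decomp C n B (\<lambda>i. E (q i)) aB bB"
    and D: "decomp C n D (\<lambda>i. E (r i)) aD bD"
    and m: "right_module C A" "right_module C B" "right_module C D"
    and V: "\<And>i. i < n \<Longrightarrow> p i \<in> V \<and> q i \<in> V \<and> r i \<in> V" and u: "u \<in> V"
    and R1: "\<And>i. i < n \<Longrightarrow> R u (p i) \<Longrightarrow> R u (q i) \<Longrightarrow> R (p i) (q i)"
    and R2: "\<And>i. i < n \<Longrightarrow> R u (q i) \<Longrightarrow> R u (r i) \<Longrightarrow> R (q i) (r i)"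
    and cond: "\<And>i. i < n \<Longrightarrow> R u (q i) \<Longrightarrow> R u (p i) \<longleftrightarrow> \<not> R u (r i)"
  shows "exact_at (\<lambda>h. diag n p q aB bA \<odot> h) (mhom C (E u) A) (\<lambda>h. diag n q r aD bB \<odot> h) (mhom C (E u) B)"
proof (rule exact_at_based[where P = "row u n p" and Q = "row u n q" and R = "row u n r"
      and SA = "row_sum u n p aA" and vB = "\<lambda>i. aB i \<odot> \<epsilon> u (q i)"])
  show "mhom C (E u) A = range (row_sum u n p aA)" using hom_row[OF A m(1) u] V by blast
  show "mhom C (E u) B = range (\<lambda>c. \<Sum>i\<in>row u n q. msmul (c i) (aB i \<odot> \<epsilon> u (q i)))"
    using hom_row[OF B m(2) u] V unfolding row_sum_def by blast
  show "diag n p q aB bA \<odot> row_sum u n p aA c = (\<Sum>i\<in>row u n p \<inter> row u n q. msmul (c i) (aB i \<odot> \<epsilon> u (q i)))" for c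
    using diag_row_sum[OF A B m(1,2) _ u R1] V by blast
  show "diag n q r aD bB \<odot> (\<Sum>i\<in>row u n q. msmul (c i) (aB i \<odot> \<epsilon> u (q i))) = 0 \<longleftrightarrow>
      (\<forall>i\<in>row u n q \<inter> row u n r. c i = 0)" for c
    by (rule diag_row_sum_zero_iff[OF B D m(2,3) _ u R2]) (use V in blast)
  show "i \<in> row u n p \<longleftrightarrow> i \<notin> row u n r" if "i \<in> row u n q" for i
    using that cond by (auto simp: row_def)
qed simp_all

lemma exact_row_start:
  assumes B: "decomp C n B (\<lambda>i. E (q i)) aB bB" and D: "decomp C n D (\<lambda>i. E (r i)) aD bD"
    and m: "right_module C B" "right_module C D"
    and V: "\<And>i. i < n \<Longrightarrow> q i \<in> V \<and> r i \<in> V" and u: "u \<in> V"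
    and R2: "\<And>i. i < n \<Longrightarrow> R u (q i) \<Longrightarrow> R u (r i) \<Longrightarrow> R (q i) (r i)"
    and cond: "\<And>i. i < n \<Longrightarrow> R u (q i) \<Longrightarrow> R u (r i)"
  shows "exact_at id {0} (\<lambda>h. diag n q r aD bB \<odot> h) (mhom C (E u) B)"
proof (rule exact_at_based[where P = "{}" and Q = "row u n q" and R = "row u n r"
      and SA = "\<lambda>_. 0" and vB = "\<lambda>i. aB i \<odot> \<epsilon> u (q i)"])
  show "mhom C (E u) B = range (\<lambda>c. \<Sum>i\<in>row u n q. msmul (c i) (aB i \<odot> \<epsilon> u (q i)))"
    using hom_row[OF B m(1) u] V unfolding row_sum_def by blast
  show "diag n q r aD bB \<odot> (\<Sum>i\<in>row u n q. msmul (c i) (aB i \<odot> \<epsilon> u (q i))) = 0 \<longleftrightarrow>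
      (\<forall>i\<in>row u n q \<inter> row u n r. c i = 0)" for c
    by (rule diag_row_sum_zero_iff[OF B D m _ u R2]) (use V in blast)
  show "i \<in> {} \<longleftrightarrow> i \<notin> row u n r" if "i \<in> row u n q" for i
    using that cond by (auto simp: row_def)
qed auto

lemma exact_row_end:
  assumes A: "decomp C n A (\<lambda>i. E (p i)) aA bA" and B: "decomp C n B (\<lambda>i. E (q i)) aB bB"
    and m: "right_module C A" "right_module C B"
    and V: "\<And>i. i < n \<Longrightarrow> p i \<in> V \<and> q i \<in> V" and u: "u \<in> V"
    and R1: "\<And>i. i < n \<Longrightarrow> R u (p i) \<Longrightarrow> R u (q i) \<Longrightarrow> R (p i) (q i)"
    and cond: "\<And>i. i < n \<Longrightarrow> R u (q i) \<Longrightarrow> R u (p i)"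
  shows "exact_at (\<lambda>h. diag n p q aB bA \<odot> h) (mhom C (E u) A) (\<lambda>_. 0 :: nat) (mhom C (E u) B)"
proof (rule exact_at_based[where P = "row u n p" and Q = "row u n q" and R = "{}"
      and SA = "row_sum u n p aA" and vB = "\<lambda>i. aB i \<odot> \<epsilon> u (q i)"])
  show "mhom C (E u) A = range (row_sum u n p aA)" using hom_row[OF A m(1) u] V by blast
  show "mhom C (E u) B = range (\<lambda>c. \<Sum>i\<in>row u n q. msmul (c i) (aB i \<odot> \<epsilon> u (q i)))"
    using hom_row[OF B m(2) u] V unfolding row_sum_def by blast
  show "diag n p q aB bA \<odot> row_sum u n p aA c = (\<Sum>i\<in>row u n p \<inter> row u n q. msmul (c i) (aB i \<odot> \<epsilon> u (q i)))" for c
    using diag_row_sum[OF A B m _ u R1] V by blast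
  show "i \<in> row u n p \<longleftrightarrow> i \<notin> {}" if "i \<in> row u n q" for i
    using that cond by (auto simp: row_def)
qed simp_all

lemma exact_col:
  assumes A: "decomp C n A (\<lambda>i. E (p i)) aA bA" and B: "decomp C n B (\<lambda>i. E (q i)) aB bB"
    and D: "decomp C n D (\<lambda>i. E (r i)) aD bD"
    and m: "right_module C A" "right_module C B" "right_module C D"
    and V: "\<And>i. i < n \<Longrightarrow> p i \<in> V \<and> q i \<in> V \<and> r i \<in> V" and u: "u \<in> V"
    and R1: "\<And>i. i < n \<Longrightarrow> R (p i) u \<Longrightarrow> R (q i) u \<Longrightarrow> R (p i) (q i)"
    and R2: "\<And>i. i < n \<Longrightarrow> R (q i) u \<Longrightarrow> R (r i) u \<Longrightarrow> R (q i) (r i)"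
    and cond: "\<And>i. i < n \<Longrightarrow> R (q i) u \<Longrightarrow> R (r i) u \<longleftrightarrow> \<not> R (p i) u"
  shows "exact_at (\<lambda>h. h \<odot> diag n q r aD bB) (mhom C D (E u)) (\<lambda>h. h \<odot> diag n p q aB bA) (mhom C B (E u))"
proof (rule exact_at_based[where P = "col u n r" and Q = "col u n q" and R = "col u n p"
      and SA = "col_sum u n r bD" and vB = "\<lambda>i. \<epsilon> (q i) u \<odot> bB i"])
  show "mhom C D (E u) = range (col_sum u n r bD)" using hom_col[OF D m(3) u] V by blast
  show "mhom C B (E u) = range (\<lambda>c. \<Sum>i\<in>col u n q. msmul (c i) (\<epsilon> (q i) u \<odot> bB i))"
    using hom_col[OF B m(2) u] V unfolding col_sum_def by blast
  show "col_sum u n r bD c \<odot> diag n q r aD bB = (\<Sum>i\<in>col u n r \<inter> col u n q. msmul (c i) (\<epsilon> (q i) u \<odot> bB i))" for c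
    using diag_col_sum[OF B D m(3) _ u R2] V by blast
  show "(\<Sum>i\<in>col u n q. msmul (c i) (\<epsilon> (q i) u \<odot> bB i)) \<odot> diag n p q aB bA = 0 \<longleftrightarrow>
      (\<forall>i\<in>col u n q \<inter> col u n p. c i = 0)" for c
    by (rule diag_col_sum_zero_iff[OF A B m(2) _ u R1]) (use V in blast)
  show "i \<in> col u n r \<longleftrightarrow> i \<notin> col u n p" if "i \<in> col u n q" for i
    using that cond by (auto simp: col_def)
qed simp_all

lemma exact_col_start:
  assumes A: "decomp C n A (\<lambda>i. E (p i)) aA bA" and B: "decomp C n B (\<lambda>i. E (q i)) aB bB"
    and m: "right_module C A" "right_module C B"
    and V: "\<And>i. i < n \<Longrightarrow> p i \<in> V \<and> q i \<in> V" and u: "u \<in> V"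
    and R1: "\<And>i. i < n \<Longrightarrow> R (p i) u \<Longrightarrow> R (q i) u \<Longrightarrow> R (p i) (q i)"
    and cond: "\<And>i. i < n \<Longrightarrow> R (q i) u \<Longrightarrow> R (p i) u"
  shows "exact_at id {0} (\<lambda>h. h \<odot> diag n p q aB bA) (mhom C B (E u))"
proof (rule exact_at_based[where P = "{}" and Q = "col u n q" and R = "col u n p"
      and SA = "\<lambda>_. 0" and vB = "\<lambda>i. \<epsilon> (q i) u \<odot> bB i"])
  show "mhom C B (E u) = range (\<lambda>c. \<Sum>i\<in>col u n q. msmul (c i) (\<epsilon> (q i) u \<odot> bB i))"
    using hom_col[OF B m(2) u] V unfolding col_sum_def by blast
  show "(\<Sum>i\<in>col u n q. msmul (c i) (\<epsilon> (q i) u \<odot> bB i)) \<odot> diag n p q aB bA = 0 \<longleftrightarrow>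
      (\<forall>i\<in>col u n q \<inter> col u n p. c i = 0)" for c
    by (rule diag_col_sum_zero_iff[OF A B m(2) _ u R1]) (use V in blast)
  show "i \<in> {} \<longleftrightarrow> i \<notin> col u n p" if "i \<in> col u n q" for i
    using that cond by (auto simp: col_def)
qed auto

end

text \<open>
  A sequence of direct sums over one index set with diagonal maps, so \<open>e k i\<close> is the \<open>i\<close>-th summand of the
  \<open>k\<close>-th term. In assumption \<open>step\<close> the reflexive instances of \<open>R\<close> say that the two summands are not zero.
\<close>

locale diag_sequence = thin_family C V E R \<epsilon> \<mu>
  for C :: "('o, 'm, 'k::field) lincat" and V :: "'x set" and E R \<epsilon> \<mu> +
  fixes d n :: nat and \<M> :: "('o, 'm, 'k) rmod set" and J :: "'x set"
    and X :: "nat \<Rightarrow> ('o, 'm, 'k) rmod" and e :: "nat \<Rightarrow> nat \<Rightarrow> 'x"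
    and a b :: "nat \<Rightarrow> nat \<Rightarrow> 'o \<Rightarrow> 'k kvec \<Rightarrow> 'k kvec"
  assumes \<M>_module: "M \<in> \<M> \<Longrightarrow> right_module C M"
    and \<M>_retract: "M \<in> \<M> \<Longrightarrow> mone C M \<in> factor_ideal C (E ` J) M M"
    and J: "J \<subseteq> V"
    and X: "k \<le> Suc d \<Longrightarrow> X k \<in> \<M>"
    and dec: "k \<le> Suc d \<Longrightarrow> decomp C n (X k) (\<lambda>i. E (e k i)) (a k) (b k)"
    and eV: "k \<le> Suc d \<Longrightarrow> i < n \<Longrightarrow> e k i \<in> V"
    and step: "k \<le> d \<Longrightarrow> i < n \<Longrightarrow> R (e k i) (e k i) \<Longrightarrow> R (e (Suc k) i) (e (Suc k) i) \<Longrightarrow>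
      R (e k i) (e (Suc k) i)"
    and refl: "R x y \<Longrightarrow> R x x \<and> R y y"
begin

definition f :: "nat \<Rightarrow> 'o \<Rightarrow> 'k kvec \<Rightarrow> 'k kvec" where
  "f k = diag n (e k) (e (Suc k)) (a (Suc k)) (b k)"

lemma Xm: "k \<le> Suc d \<Longrightarrow> right_module C (X k)"
  using \<M>_module X by blast

lemma f_hom: "k \<le> d \<Longrightarrow> f k \<in> mhom C (X k) (X (Suc k))"
  unfolding f_def using eV by (intro diag_hom[OF dec dec] Xm) auto

lemma step_left: "k \<le> d \<Longrightarrow> i < n \<Longrightarrow> R u (e k i) \<Longrightarrow> R u (e (Suc k) i) \<Longrightarrow> R (e k i) (e (Suc k) i)"
  using step refl by blast

lemma step_right: "k \<le> d \<Longrightarrow> i < n \<Longrightarrow> R (e k i) u \<Longrightarrow> R (e (Suc k) i) u \<Longrightarrow> R (e k i) (e (Suc k) i)"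
  using step refl by blast

lemma seq: "is_sequence C d \<M> X f"
  unfolding is_sequence_def using X f_hom by simp

lemma exact_mid:
  assumes k: "k < d" and K: "K \<subseteq> V" and N: "right_module C N" "mone C N \<in> factor_ideal C (E ` K) N N"
    and cond: "\<And>u i. u \<in> K \<Longrightarrow> i < n \<Longrightarrow> R u (e (Suc k) i) \<Longrightarrow> R u (e k i) \<longleftrightarrow> \<not> R u (e (Suc (Suc k)) i)"
  shows "exact_at (\<lambda>h. f k \<odot> h) (mhom C N (X k)) (\<lambda>h. f (Suc k) \<odot> h) (mhom C N (X (Suc k)))"
proof (rule exact_at_retract_left[OF Xm Xm Xm N(1) f_hom f_hom _ N(2)])
  fix Z assume "Z \<in> E ` K"
  then obtain u where u: "u \<in> K" "Z = E u" "u \<in> V" using K by blast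
  show "exact_at (\<lambda>h. f k \<odot> h) (mhom C Z (X k)) (\<lambda>h. f (Suc k) \<odot> h) (mhom C Z (X (Suc k)))"
    unfolding u(2) f_def
    by (rule exact_row[OF dec dec dec Xm Xm Xm _ u(3) step_left step_left cond[OF u(1)]])
      (use k eV in auto)
qed (use k in auto)

lemma exact_start:
  assumes k: "k \<le> d" and K: "K \<subseteq> V" and N: "right_module C N" "mone C N \<in> factor_ideal C (E ` K) N N"
    and cond: "\<And>u i. u \<in> K \<Longrightarrow> i < n \<Longrightarrow> R u (e k i) \<Longrightarrow> R u (e (Suc k) i)"
  shows "exact_at id {0} (\<lambda>h. f k \<odot> h) (mhom C N (X k))"
proof -
  have m: "right_module C (X k)" "right_module C (X (Suc k))" using Xm k by simp_all
  show ?thesis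
    unfolding exact_at_start_left[OF m(1)]
  proof (rule exact_at_retract_left[OF m(1) m(1) m(2) N(1) mhom_zero[OF m(1)] f_hom[OF k] _ N(2)])
    fix Z assume "Z \<in> E ` K"
    then obtain u where u: "u \<in> K" "Z = E u" "u \<in> V" using K by blast
    show "exact_at (\<lambda>h. 0 \<odot> h) (mhom C Z (X k)) (\<lambda>h. f k \<odot> h) (mhom C Z (X k))"
      unfolding exact_at_start_left[OF m(1), symmetric]
      unfolding u(2) f_def
      by (rule exact_row_start[OF dec dec m _ u(3) step_left cond[OF u(1)]]) (use k eV in auto)
  qed
qed

lemma exact_end:
  assumes k: "k \<le> d" and K: "K \<subseteq> V" and N: "right_module C N" "mone C N \<in> factor_ideal C (E ` K) N N"
    and cond: "\<And>u i. u \<in> K \<Longrightarrow> i < n \<Longrightarrow> R u (e (Suc k) i) \<Longrightarrow> R u (e k i)"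
  shows "exact_at (\<lambda>h. f k \<odot> h) (mhom C N (X k)) (\<lambda>_. 0 :: nat) (mhom C N (X (Suc k)))"
proof -
  have m: "right_module C (X k)" "right_module C (X (Suc k))" using Xm k by simp_all
  show ?thesis
    unfolding exact_at_end_left
  proof (rule exact_at_retract_left[OF m(1) m(2) m(2) N(1) f_hom[OF k] mhom_zero[OF m(2)] _ N(2)])
    fix Z assume "Z \<in> E ` K"
    then obtain u where u: "u \<in> K" "Z = E u" "u \<in> V" using K by blast
    show "exact_at (\<lambda>h. f k \<odot> h) (mhom C Z (X k)) (\<lambda>h. 0 \<odot> h) (mhom C Z (X (Suc k)))"
      unfolding exact_at_end_left[symmetric]
      unfolding u(2) f_def
      by (rule exact_row_end[OF dec dec m _ u(3) step_left cond[OF u(1)]]) (use k eV in auto)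
  qed
qed

lemma d_kernelI:
  assumes start: "\<And>u i. u \<in> J \<Longrightarrow> i < n \<Longrightarrow> R u (e 0 i) \<Longrightarrow> R u (e (Suc 0) i)"
    and mid: "\<And>u k i. u \<in> J \<Longrightarrow> k < d \<Longrightarrow> i < n \<Longrightarrow> R u (e (Suc k) i) \<Longrightarrow>
      R u (e k i) \<longleftrightarrow> \<not> R u (e (Suc (Suc k)) i)"
  shows "d_kernel C d \<M> X f"
  unfolding d_kernel_def
proof (intro conjI ballI seq)
  fix N assume N: "N \<in> \<M>"
  show "exact_at id {0} (\<lambda>h. f 0 \<odot> h) (mhom C N (X 0))"
    by (rule exact_start[OF _ J \<M>_module[OF N] \<M>_retract[OF N] start]) auto
  fix i assume "i \<in> {1..d}"
  then obtain k where k: "i = Suc k" "k < d" by (cases i) auto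
  show "exact_at (\<lambda>h. f (i - 1) \<odot> h) (mhom C N (X (i - 1))) (\<lambda>h. f i \<odot> h) (mhom C N (X i))"
    using exact_mid[OF k(2) J \<M>_module[OF N] \<M>_retract[OF N] mid[OF _ k(2)]] by (simp add: k(1))
qed

lemma d_cokernelI:
  assumes start: "\<And>u i. u \<in> J \<Longrightarrow> i < n \<Longrightarrow> R (e (Suc d) i) u \<Longrightarrow> R (e d i) u"
    and mid: "\<And>u k i. u \<in> J \<Longrightarrow> k < d \<Longrightarrow> i < n \<Longrightarrow> R (e (Suc k) i) u \<Longrightarrow>
      R (e (Suc (Suc k)) i) u \<longleftrightarrow> \<not> R (e k i) u"
  shows "d_cokernel C d \<M> X f"
  unfolding d_cokernel_def
proof (intro conjI ballI seq)
  fix N assume N: "N \<in> \<M>"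
  note Nm = \<M>_module[OF N] and Nr = \<M>_retract[OF N]
  have m: "right_module C (X d)" "right_module C (X (Suc d))" using Xm by simp_all
  have f0: "(0 :: 'o \<Rightarrow> 'k kvec \<Rightarrow> 'k kvec) \<in> mhom C (X (Suc d)) (X (Suc d))" by (rule mhom_zero[OF m(2)])
  show "exact_at id {0} (\<lambda>h. h \<odot> f d) (mhom C (X (d + 1)) N)"
    unfolding Suc_eq_plus1[symmetric] exact_at_start_right[OF Nm, of _ _ "X (Suc d)"]
  proof (rule exact_at_retract_right[OF m m(2) Nm f_hom f0 _ Nr])
    fix Z assume "Z \<in> E ` J"
    then obtain u where u: "u \<in> J" "Z = E u" "u \<in> V" using J by blast
    show "exact_at (\<lambda>h. h \<odot> 0) (mhom C (X (Suc d)) Z) (\<lambda>h. h \<odot> f d) (mhom C (X (Suc d)) Z)"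
      unfolding u(2) exact_at_start_right[OF module, symmetric]
      unfolding f_def
      by (rule exact_col_start[OF dec dec m _ u(3) step_right start[OF u(1)]]) (use eV in auto)
  qed simp
  fix i assume "i \<in> {1..d}"
  then obtain k where k: "i = Suc k" "k < d" by (cases i) auto
  have "exact_at (\<lambda>h. h \<odot> f (Suc k)) (mhom C (X (Suc (Suc k))) N) (\<lambda>h. h \<odot> f k) (mhom C (X (Suc k)) N)"
  proof (rule exact_at_retract_right[OF Xm Xm Xm Nm f_hom f_hom _ Nr])
    fix Z assume "Z \<in> E ` J"
    then obtain u where u: "u \<in> J" "Z = E u" "u \<in> V" using J by blast
    show "exact_at (\<lambda>h. h \<odot> f (Suc k)) (mhom C (X (Suc (Suc k))) Z) (\<lambda>h. h \<odot> f k) (mhom C (X (Suc k)) Z)"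
      unfolding u(2) f_def
      by (rule exact_col[OF dec dec dec Xm Xm Xm _ u(3) step_right step_right mid[OF u(1) k(2)]])
        (use k eV in auto)
  qed (use k in auto)
  then show "exact_at (\<lambda>h. h \<odot> f i) (mhom C (X (i + 1)) N) (\<lambda>h. h \<odot> f (i - 1)) (mhom C (X i) N)"
    by (simp add: k(1))
qed

end

section \<open>Modules over a quotient category\<close>

lemma quot_cat_simps:
  "Ob (quot_cat C S) = Ob C"
  "Hom (quot_cat C S) x y = qcoset C S x y ` Hom C x y"
  "hzero (quot_cat C S) x y = qcoset C S x y (hzero C x y)"
  "hadd (quot_cat C S) x y A B = (\<Union>a\<in>A. \<Union>b\<in>B. qcoset C S x y (hadd C x y a b))"
  "hscale (quot_cat C S) x y c A = (\<Union>a\<in>A. qcoset C S x y (hscale C x y c a))"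
  "hone (quot_cat C S) x = qcoset C S x x (hone C x)"
  "hcomp (quot_cat C S) x y z B A = (\<Union>b\<in>B. \<Union>a\<in>A. qcoset C S x z (hcomp C x y z b a))"
  by (simp_all add: quot_cat_def)

lemma right_moduleD:
  assumes "right_module C M" and "x \<in> Ob C" "y \<in> Ob C"
  shows "f \<in> Hom C x y \<Longrightarrow> g \<in> Hom C x y \<Longrightarrow> v \<in> car M y \<Longrightarrow>
      act M x y (hadd C x y f g) v = act M x y f v + act M x y g v"
    and "f \<in> Hom C x y \<Longrightarrow> v \<in> car M y \<Longrightarrow> act M x y (hscale C x y c f) v = vscale c (act M x y f v)"
    and "v \<in> car M x \<Longrightarrow> act M x x (hone C x) v = v"
    and "z \<in> Ob C \<Longrightarrow> f \<in> Hom C x y \<Longrightarrow> g \<in> Hom C y z \<Longrightarrow> v \<in> car M z \<Longrightarrow>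
      act M x z (hcomp C x y z g f) v = act M x y f (act M y z g v)"
  using assms by (simp_all add: right_module_def)

lemma right_module_act_in:
  assumes "right_module C M" "x \<in> Ob C" "y \<in> Ob C" "f \<in> Hom C x y" "v \<in> car M y"
  shows "act M x y f v \<in> car M x"
  using right_module_linear[OF assms(1-4)] assms(5) unfolding linear_between_def by blast

text \<open>
  The part of the category axioms on which the descent of modules to a quotient depends.
\<close>

locale lincat_closed =
  fixes C :: "('o, 'm, 'k::field) lincat"
  assumes zero_closed: "x \<in> Ob C \<Longrightarrow> y \<in> Ob C \<Longrightarrow> hzero C x y \<in> Hom C x y"
    and add_closed: "x \<in> Ob C \<Longrightarrow> y \<in> Ob C \<Longrightarrow> f \<in> Hom C x y \<Longrightarrow> g \<in> Hom C x y \<Longrightarrow> hadd C x y f g \<in> Hom C x y"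
    and scale_closed: "x \<in> Ob C \<Longrightarrow> y \<in> Ob C \<Longrightarrow> f \<in> Hom C x y \<Longrightarrow> hscale C x y c f \<in> Hom C x y"
    and one_closed: "x \<in> Ob C \<Longrightarrow> hone C x \<in> Hom C x x"
    and comp_closed: "x \<in> Ob C \<Longrightarrow> y \<in> Ob C \<Longrightarrow> z \<in> Ob C \<Longrightarrow> f \<in> Hom C x y \<Longrightarrow> g \<in> Hom C y z \<Longrightarrow>
      hcomp C x y z g f \<in> Hom C x z"
    and add_zero: "x \<in> Ob C \<Longrightarrow> y \<in> Ob C \<Longrightarrow> f \<in> Hom C x y \<Longrightarrow> hadd C x y f (hzero C x y) = f"
begin

text \<open>
  A morphism through an object of \<open>S\<close> acts through the zero space that the module has there.
\<close>

lemma thru_acts_zero: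
  assumes N: "right_module C N" and S: "\<forall>w\<in>S. w \<in> Ob C \<longrightarrow> car N w = {0}"
    and xy: "x \<in> Ob C" "y \<in> Ob C" and v: "v \<in> car N y" and j: "j \<in> thru C S x y"
  shows "j \<in> Hom C x y \<and> act N x y j v = 0"
  using j
proof induction
  case zero
  have "act N x y (hadd C x y (hzero C x y) (hzero C x y)) v = act N x y (hzero C x y) v + act N x y (hzero C x y) v"
    using right_moduleD(1)[OF N xy _ _ v] zero_closed[OF xy] by blast
  then show ?case using zero_closed[OF xy] add_zero[OF xy] by simp
next
  case (factor w f g)
  have "act N w y g v \<in> car N w" using right_module_act_in[OF N factor(2) xy(2) factor(4) v] .
  then have "act N w y g v = 0" using S factor(1,2) by auto
  moreover have "act N x w f 0 = 0"
    using linear_between_zero[OF right_module_linear[OF N xy(1) factor(2,3)]]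
      kvec.subspace_0[OF right_module_subspace[OF N factor(2)]] by simp
  ultimately show ?case
    using right_moduleD(4)[OF N xy(1) factor(2) xy(2) factor(3,4) v] comp_closed[OF xy(1) factor(2) xy(2) factor(3,4)]
    by simp
next
  case (add a b)
  then show ?case using right_moduleD(1)[OF N xy _ _ v] add_closed[OF xy] by simp
qed

lemma qcoset_acts:
  assumes N: "right_module C N" and S: "\<forall>w\<in>S. w \<in> Ob C \<longrightarrow> car N w = {0}"
    and xy: "x \<in> Ob C" "y \<in> Ob C" and v: "v \<in> car N y" and f: "f \<in> Hom C x y"
    and g: "g \<in> qcoset C S x y f"
  shows "g \<in> Hom C x y" "act N x y g v = act N x y f v"
proof -
  obtain j where j: "j \<in> thru C S x y" "g = hadd C x y f j" using g unfolding qcoset_def by blast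
  have *: "j \<in> Hom C x y" "act N x y j v = 0" using thru_acts_zero[OF N S xy v j(1)] by blast+
  show "g \<in> Hom C x y" unfolding j(2) by (rule add_closed[OF xy f *(1)])
  show "act N x y g v = act N x y f v"
    unfolding j(2) right_moduleD(1)[OF N xy f *(1) v] by (simp add: *(2))
qed

lemma in_qcoset: "x \<in> Ob C \<Longrightarrow> y \<in> Ob C \<Longrightarrow> f \<in> Hom C x y \<Longrightarrow> f \<in> qcoset C S x y f"
  unfolding qcoset_def using add_zero[of x y f] thru.zero[of C x y S] by (metis (mono_tags, lifting) mem_Collect_eq)

text \<open>
  The action of a coset is that of an arbitrary representative.
\<close>

definition descend :: "('o, 'm, 'k) rmod \<Rightarrow> ('o, 'm set, 'k) rmod" where
  "descend N = \<lparr>car = car N, act = (\<lambda>x y F v. act N x y (SOME f. f \<in> F) v)\<rparr>"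

lemma descend_act:
  assumes N: "right_module C N" and S: "\<forall>w\<in>S. w \<in> Ob C \<longrightarrow> car N w = {0}"
    and xy: "x \<in> Ob C" "y \<in> Ob C" and v: "v \<in> car N y" and f: "f \<in> Hom C x y"
  shows "act (descend N) x y (qcoset C S x y f) v = act N x y f v"
proof -
  have "(SOME g. g \<in> qcoset C S x y f) \<in> qcoset C S x y f"
    using in_qcoset[OF xy f] by (rule someI)
  then show ?thesis using qcoset_acts(2)[OF N S xy v f] by (simp add: descend_def)
qed

lemma descend_act':
  assumes N: "right_module C N" and S: "\<forall>w\<in>S. w \<in> Ob C \<longrightarrow> car N w = {0}"
    and xy: "x \<in> Ob C" "y \<in> Ob C" and v: "v \<in> car N y"
    and F: "F \<noteq> {}" "\<And>g. g \<in> F \<Longrightarrow> act N x y g v = w"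
  shows "act (descend N) x y F v = w"
  using F someI_ex[of "\<lambda>g. g \<in> F"] by (auto simp: descend_def)

text \<open>
  A module vanishing on \<open>S\<close> is annihilated by the ideal of \<open>S\<close>. So the action of a coset does not depend on
  the representative, and restriction along the quotient functor gives the module back.
\<close>

lemma fd_modules_quotI:
  assumes N: "N \<in> fd_modules C" and S: "\<forall>w\<in>S. w \<in> Ob C \<longrightarrow> car N w = {0}"
  shows "N \<in> fd_modules_quot C S"
proof -
  have m: "right_module C N" using N by (simp add: fd_modules_def)
  note act = descend_act[OF m S]
  note acts = qcoset_acts[OF m S]
  have car: "car (descend N) = car N" by (simp add: descend_def)
  have "right_module (quot_cat C S) (descend N)"
    unfolding right_module_def quot_cat_simps car
  proof (intro conjI ballI allI)
    show "kvec.subspace (car N x)" if "x \<in> Ob C" for x by (rule right_module_subspace[OF m that])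
  next
    fix x y F assume xy: "x \<in> Ob C" "y \<in> Ob C" and "F \<in> qcoset C S x y ` Hom C x y"
    then obtain f where f: "f \<in> Hom C x y" "F = qcoset C S x y f" by blast
    have "\<And>v. v \<in> car N y \<Longrightarrow> act (descend N) x y F v = act N x y f v"
      using act[OF xy _ f(1)] unfolding f(2) by blast
    then show "linear_between (car N y) (car N x) (act (descend N) x y F)"
      using right_module_linear[OF m xy f(1)] kvec.subspace_add[OF right_module_subspace[OF m xy(2)]]
        kvec.subspace_scale[OF right_module_subspace[OF m xy(2)]]
      unfolding linear_between_def by auto
    fix v assume v: "v \<in> car N y"
    show "act (descend N) x y (\<Union>a\<in>F. qcoset C S x y (hscale C x y c a)) v = vscale c (act (descend N) x y F v)" for c
    proof (rule descend_act'[OF m S xy v])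
      show "(\<Union>a\<in>F. qcoset C S x y (hscale C x y c a)) \<noteq> {}"
        using in_qcoset[OF xy f(1)] in_qcoset[OF xy scale_closed[OF xy f(1)]] f(2) by blast
      fix g assume "g \<in> (\<Union>a\<in>F. qcoset C S x y (hscale C x y c a))"
      then obtain a where a: "a \<in> F" "g \<in> qcoset C S x y (hscale C x y c a)" by blast
      have a': "a \<in> Hom C x y" "act N x y a v = act N x y f v"
        using acts[OF xy v f(1)] a(1) f(2) by blast+
      have "act N x y g v = act N x y (hscale C x y c a) v"
        by (rule acts(2)[OF xy v scale_closed[OF xy a'(1)] a(2)])
      then show "act N x y g v = vscale c (act (descend N) x y F v)"
        using right_moduleD(2)[OF m xy a'(1) v] a'(2) act[OF xy v f(1)] f(2) by simp
    qed
    fix G assume "G \<in> qcoset C S x y ` Hom C x y"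
    then obtain g where g: "g \<in> Hom C x y" "G = qcoset C S x y g" by blast
    show "act (descend N) x y (\<Union>a\<in>F. \<Union>b\<in>G. qcoset C S x y (hadd C x y a b)) v =
        act (descend N) x y F v + act (descend N) x y G v"
    proof (rule descend_act'[OF m S xy v])
      show "(\<Union>a\<in>F. \<Union>b\<in>G. qcoset C S x y (hadd C x y a b)) \<noteq> {}"
        using in_qcoset[OF xy f(1)] in_qcoset[OF xy g(1)] in_qcoset[OF xy add_closed[OF xy f(1) g(1)]] f(2) g(2)
        by blast
      fix h assume "h \<in> (\<Union>a\<in>F. \<Union>b\<in>G. qcoset C S x y (hadd C x y a b))"
      then obtain a b where ab: "a \<in> F" "b \<in> G" "h \<in> qcoset C S x y (hadd C x y a b)" by blast
      have a': "a \<in> Hom C x y" "act N x y a v = act N x y f v"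
        using acts[OF xy v f(1)] ab(1) f(2) by blast+
      have b': "b \<in> Hom C x y" "act N x y b v = act N x y g v"
        using acts[OF xy v g(1)] ab(2) g(2) by blast+
      have "act N x y h v = act N x y (hadd C x y a b) v"
        by (rule acts(2)[OF xy v add_closed[OF xy a'(1) b'(1)] ab(3)])
      then show "act N x y h v = act (descend N) x y F v + act (descend N) x y G v"
        using right_moduleD(1)[OF m xy a'(1) b'(1) v] a'(2) b'(2) act[OF xy v f(1)] act[OF xy v g(1)] f(2) g(2)
        by simp
    qed
  next
    fix x v assume "x \<in> Ob C" "v \<in> car N x"
    then show "act (descend N) x x (qcoset C S x x (hone C x)) v = v"
      using act[of x x v "hone C x"] one_closed[of x] right_moduleD(3)[OF m] by simp
  next
    fix x y z F G v
    assume x: "x \<in> Ob C" and y: "y \<in> Ob C" and z: "z \<in> Ob C" and "F \<in> qcoset C S x y ` Hom C x y"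
      and "G \<in> qcoset C S y z ` Hom C y z" and v: "v \<in> car N z"
    then obtain f g where f: "f \<in> Hom C x y" "F = qcoset C S x y f" and g: "g \<in> Hom C y z" "G = qcoset C S y z g"
      by blast
    have gv: "act N y z g v \<in> car N y" by (rule right_module_act_in[OF m y z g(1) v])
    show "act (descend N) x z (\<Union>b\<in>G. \<Union>a\<in>F. qcoset C S x z (hcomp C x y z b a)) v =
        act (descend N) x y F (act (descend N) y z G v)"
    proof (rule descend_act'[OF m S x z v])
      show "(\<Union>b\<in>G. \<Union>a\<in>F. qcoset C S x z (hcomp C x y z b a)) \<noteq> {}"
        using in_qcoset[OF x y f(1)] in_qcoset[OF y z g(1)] in_qcoset[OF x z comp_closed[OF x y z f(1) g(1)]] f(2) g(2)
        by blast
      fix h assume "h \<in> (\<Union>b\<in>G. \<Union>a\<in>F. qcoset C S x z (hcomp C x y z b a))"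
      then obtain a b where ab: "a \<in> F" "b \<in> G" "h \<in> qcoset C S x z (hcomp C x y z b a)" by blast
      have b': "b \<in> Hom C y z" "act N y z b v = act N y z g v"
        using acts[OF y z v g(1)] ab(2) g(2) by blast+
      have a': "a \<in> Hom C x y" "act N x y a (act N y z g v) = act N x y f (act N y z g v)"
        using acts[OF x y gv f(1)] ab(1) f(2) by blast+
      have "act N x z h v = act N x z (hcomp C x y z b a) v"
        by (rule acts(2)[OF x z v comp_closed[OF x y z a'(1) b'(1)] ab(3)])
      then show "act N x z h v = act (descend N) x y F (act (descend N) y z G v)"
        using right_moduleD(4)[OF m x y z a'(1) b'(1) v] a'(2) b'(2) act[OF y z v g(1)] act[OF x y gv f(1)] f(2) g(2)
        by simp
    qed
  qed
  then have "descend N \<in> fd_modules (quot_cat C S)"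
    using N unfolding fd_modules_def by (simp add: car quot_cat_simps)
  moreover have "miso C N (restrict_quot C S (descend N))"
  proof -
    let ?R = "restrict_quot C S (descend N)"
    have R: "car ?R = car N" by (simp add: restrict_quot_def car)
    have Ra: "act ?R x y f v = act N x y f v" if "x \<in> Ob C" "y \<in> Ob C" "f \<in> Hom C x y" "v \<in> car N y" for x y f v
      using act[OF that(1,2,4,3)] by (simp add: restrict_quot_def)
    have 1: "mone C N \<in> mhom C N ?R" "mone C N \<in> mhom C ?R N"
      using mone_mhom[OF m] Ra unfolding mhom_def R by (auto simp: mone_def)
    have 2: "mone C N \<odot> mone C N = mone C N" by (rule mone_left[OF mone_mhom[OF m]])
    have "mone C ?R = mone C N" by (simp add: mone_def R)
    then show ?thesis unfolding miso_def using 1 2 by metis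
  qed
  ultimately show ?thesis using N unfolding fd_modules_quot_def by blast
qed

end

section \<open>The mesh category\<close>

text \<open>
  Between \<open>x\<close> and \<open>y\<close> lies a tuple that becomes zero in the mesh category, so the morphism space from \<open>x\<close>
  to \<open>y\<close> collapses: its only coset is the whole field.
\<close>

definition hit :: "nat \<Rightarrow> int list \<Rightarrow> int list \<Rightarrow> bool" where
  "hit d x y \<longleftrightarrow> (\<exists>w\<in>tuples d - os d. prod_le x w \<and> prod_le w y)"

definition scalar_coset :: "nat \<Rightarrow> int list \<Rightarrow> int list \<Rightarrow> 'k::field \<Rightarrow> 'k set" where
  "scalar_coset d x y c = (if hit d x y then UNIV else {c})"

definition scalars :: "int list \<Rightarrow> int list \<Rightarrow> 'k::field set" where
  "scalars x y = (if prod_le x y then UNIV else {0})"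

lemma prod_le_nth: "prod_le x y \<longleftrightarrow> length x = length y \<and> (\<forall>i<length x. x ! i \<le> y ! i)"
  by (simp add: prod_le_def list_all2_conv_all_nth)

lemma prod_le_refl [simp]: "prod_le x x"
  by (simp add: prod_le_nth)

lemma prod_le_trans: "prod_le x y \<Longrightarrow> prod_le y z \<Longrightarrow> prod_le x z"
  unfolding prod_le_nth by (metis order_trans)

lemma prod_le_antisym: "prod_le x y \<Longrightarrow> prod_le y x \<Longrightarrow> x = y"
  unfolding prod_le_nth by (metis nth_equalityI order_antisym)

lemma hit_le: "hit d x y \<Longrightarrow> prod_le x y"
  unfolding hit_def using prod_le_trans by blast

lemma hit_extend: "hit d y z \<Longrightarrow> prod_le x y \<Longrightarrow> hit d x z" "hit d x y \<Longrightarrow> prod_le y z \<Longrightarrow> hit d x z"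
  unfolding hit_def using prod_le_trans by blast+

lemma poset_lincat_simps:
  "Ob (poset_lincat P le) = P"
  "Hom (poset_lincat P le) x y = (if le x y then UNIV else {0})"
  "hzero (poset_lincat P le) x y = 0"
  "hadd (poset_lincat P le) x y a b = a + b"
  "hscale (poset_lincat P le) x y c a = c * a"
  "hone (poset_lincat P le) x = 1"
  "hcomp (poset_lincat P le) x y z b a = b * a"
  by (simp_all add: poset_lincat_def)

lemma thru_poset:
  "thru (poset_lincat (tuples d) prod_le) (tuples d - os d) x y = (if hit d x y then UNIV else {0 :: 'k::field})"
proof (cases "hit d x y")
  case True
  then obtain w where w: "w \<in> tuples d - os d" "prod_le x w" "prod_le w y" unfolding hit_def by blast
  have "c \<in> thru (poset_lincat (tuples d) prod_le) (tuples d - os d) x y" for c :: 'k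
    using thru.factor[of w "tuples d - os d" "poset_lincat (tuples d) prod_le" 1 x c y] w
    by (simp add: poset_lincat_simps)
  then show ?thesis using True by auto
next
  case False
  have "c = 0" if "c \<in> thru (poset_lincat (tuples d) prod_le) (tuples d - os d) x y" for c :: 'k
    using that
  proof induction
    case (factor w f g)
    then have "\<not> (prod_le x w \<and> prod_le w y)" using False unfolding hit_def by blast
    then show ?case using factor by (auto simp: poset_lincat_simps split: if_splits)
  qed (simp_all add: poset_lincat_simps)
  moreover have "0 \<in> thru (poset_lincat (tuples d) prod_le) (tuples d - os d) x y"
    using thru.zero[of "poset_lincat (tuples d) prod_le" x y] by (simp add: poset_lincat_simps)
  ultimately show ?thesis using False by auto
qed

lemma qcoset_poset:
  "qcoset (poset_lincat (tuples d) prod_le) (tuples d - os d) x y =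
    (scalar_coset d x y :: 'k::field \<Rightarrow> 'k set)"
proof
  fix c :: 'k
  have "\<exists>j. a = c + j" for a by (rule exI[of _ "a - c"]) simp
  then show "qcoset (poset_lincat (tuples d) prod_le) (tuples d - os d) x y c = scalar_coset d x y c"
    unfolding qcoset_def thru_poset scalar_coset_def by (auto simp: poset_lincat_simps)
qed

lemma mesh_Ob: "Ob (mesh_cat d) = tuples d"
  by (simp add: mesh_cat_def quot_cat_simps poset_lincat_simps)

lemma mesh_Hom: "Hom (mesh_cat d) x y = scalar_coset d x y ` scalars x y"
  by (simp add: mesh_cat_def quot_cat_simps poset_lincat_simps qcoset_poset scalars_def)

lemma mesh_zero: "hzero (mesh_cat d) x y = scalar_coset d x y 0"
  by (simp add: mesh_cat_def quot_cat_simps poset_lincat_simps qcoset_poset)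

lemma mesh_one: "hone (mesh_cat d) x = scalar_coset d x x 1"
  by (simp add: mesh_cat_def quot_cat_simps poset_lincat_simps qcoset_poset)

lemma mesh_add: "hadd (mesh_cat d) x y (scalar_coset d x y a) (scalar_coset d x y b) = scalar_coset d x y (a + b)"
  by (auto simp: mesh_cat_def quot_cat_simps poset_lincat_simps qcoset_poset scalar_coset_def)

lemma mesh_scale: "hscale (mesh_cat d) x y c (scalar_coset d x y a) = scalar_coset d x y (c * a)"
  by (auto simp: mesh_cat_def quot_cat_simps poset_lincat_simps qcoset_poset scalar_coset_def)

text \<open>
  If the outer morphism space does not collapse but one of the inner ones does, then the other inner
  one is zero. This is where it matters that the two scalars lie in the morphism spaces.
\<close>

lemma mesh_comp:
  assumes "a \<in> scalars x y" "b \<in> scalars y z"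
  shows "hcomp (mesh_cat d) x y z (scalar_coset d y z b) (scalar_coset d x y a) = scalar_coset d x z (b * a)"
proof (cases "hit d x z")
  case True
  then show ?thesis
    by (auto simp: mesh_cat_def quot_cat_simps poset_lincat_simps qcoset_poset scalar_coset_def)
next
  case False
  have "a = 0 \<and> \<not> hit d x y" if "hit d y z"
    using hit_extend(1)[OF that] False hit_le assms(1) by (auto simp: scalars_def split: if_splits)
  moreover have "b = 0 \<and> \<not> hit d y z" if "hit d x y"
    using hit_extend(2)[OF that] False hit_le assms(2) by (auto simp: scalars_def split: if_splits)
  ultimately show ?thesis using False
    by (auto simp: mesh_cat_def quot_cat_simps poset_lincat_simps qcoset_poset scalar_coset_def)
qed

lemma scalars_closed:
  "0 \<in> scalars x y" "a \<in> scalars x y \<Longrightarrow> b \<in> scalars x y \<Longrightarrow> a + b \<in> scalars x y"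
  "a \<in> scalars x y \<Longrightarrow> c * a \<in> scalars x y" "1 \<in> scalars x x"
  "a \<in> scalars x y \<Longrightarrow> b \<in> scalars y z \<Longrightarrow> b * a \<in> scalars x z"
  using prod_le_trans[of x y z] by (auto simp: scalars_def split: if_splits)

lemma lincat_closed_mesh: "lincat_closed (mesh_cat d :: (int list, 'k::field set, 'k) lincat)"
proof
  fix x y z :: "int list" and f g :: "'k set" and c :: 'k
  let ?C = "mesh_cat d :: (int list, 'k set, 'k) lincat"
  show "hzero ?C x y \<in> Hom ?C x y" unfolding mesh_zero mesh_Hom by (intro imageI scalars_closed)
  show "hone ?C x \<in> Hom ?C x x" unfolding mesh_one mesh_Hom by (intro imageI scalars_closed)
  show "hadd ?C x y f g \<in> Hom ?C x y" if f: "f \<in> Hom ?C x y" and g: "g \<in> Hom ?C x y"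
  proof -
    obtain a b where "a \<in> scalars x y" "b \<in> scalars x y" "f = scalar_coset d x y a" "g = scalar_coset d x y b"
      using f g unfolding mesh_Hom by blast
    then show ?thesis by (simp add: mesh_add mesh_Hom scalars_closed)
  qed
  show "hscale ?C x y c f \<in> Hom ?C x y" if f: "f \<in> Hom ?C x y"
    using f unfolding mesh_Hom by (auto simp: mesh_scale scalars_closed)
  show "hcomp ?C x y z g f \<in> Hom ?C x z" if f: "f \<in> Hom ?C x y" and g: "g \<in> Hom ?C y z"
  proof -
    obtain a b where "a \<in> scalars x y" "b \<in> scalars y z" "f = scalar_coset d x y a" "g = scalar_coset d y z b"
      using f g unfolding mesh_Hom by blast
    then show ?thesis by (simp add: mesh_comp mesh_Hom scalars_closed)
  qed
  show "hadd ?C x y f (hzero ?C x y) = f" if f: "f \<in> Hom ?C x y"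
    using f unfolding mesh_Hom mesh_zero by (auto simp: mesh_add)
qed

section \<open>Direct sums of interval modules\<close>

lemma tuples_iff [simp]: "x \<in> tuples m \<longleftrightarrow> length x = m"
  by (simp add: tuples_def)

lemma sorted_nth_Suc: "sorted (x :: int list) \<longleftrightarrow> (\<forall>i. Suc i < length x \<longrightarrow> x ! i \<le> x ! Suc i)"
  by (rule sorted_iff_nth_Suc)

lemma msupp_iff:
  "y \<in> msupp d x \<longleftrightarrow> length y = d \<and> (\<forall>i<d. x ! i \<le> y ! i \<and> y ! i \<le> x ! Suc i)"
  unfolding msupp_def os_def by (auto simp: sorted_nth_Suc) (meson Suc_lessD order_trans)

text \<open>
  Convexity of the supports makes the interval modules functorial: if the action from one point of
  the support to another is nonzero, it does not pass outside.
\<close>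

lemma msupp_convex:
  assumes "y \<in> msupp d x" "z \<in> msupp d x" "prod_le y w" "prod_le w z"
  shows "w \<in> msupp d x"
  using assms unfolding msupp_iff prod_le_nth by (metis order_trans)

lemma msupp_os: "y \<in> msupp d x \<Longrightarrow> y \<in> os d"
  by (simp add: msupp_def)

lemma msupp_not_hit: "y \<in> msupp d x \<Longrightarrow> z \<in> msupp d x \<Longrightarrow> \<not> hit d y z"
  unfolding hit_def using msupp_convex msupp_os by blast

lemma finite_msupp: "finite (msupp d x)"
proof -
  have "msupp d x \<subseteq> {y. set y \<subseteq> (\<Union>i<d. {x ! i..x ! Suc i}) \<and> length y = d}"
  proof (intro subsetI CollectI conjI)
    fix y a assume y: "y \<in> msupp d x"
    then show "length y = d" by (simp add: msupp_iff)
    assume "a \<in> set y"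
    then obtain i where "i < length y" "a = y ! i" by (auto simp: in_set_conv_nth)
    then have "i < d" "a \<in> {x ! i..x ! Suc i}" using y by (auto simp: msupp_iff)
    then show "a \<in> (\<Union>i<d. {x ! i..x ! Suc i})" by blast
  qed
  moreover have "finite {y. set y \<subseteq> (\<Union>i<d. {x ! i..x ! Suc i}) \<and> length y = d}"
    by (rule finite_lists_length_eq) simp
  ultimately show ?thesis by (rule finite_subset)
qed

text \<open>
  The direct sum of \<open>n\<close> interval modules in coordinates: entry \<open>m\<close> of a vector is its component in the
  \<open>m\<close>-th summand. Tuples with empty support are allowed and contribute a zero summand.
\<close>

definition dsum_module :: "nat \<Rightarrow> nat \<Rightarrow> (nat \<Rightarrow> int list) \<Rightarrow> (int list, 'k::field set, 'k) rmod" where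
  "dsum_module d n x =
    \<lparr>car = (\<lambda>y. {v. \<forall>m. v m \<noteq> 0 \<longrightarrow> m < n \<and> y \<in> msupp d (x m)}),
     act = (\<lambda>y z c v. (\<lambda>m. if y \<in> msupp d (x m) \<and> z \<in> msupp d (x m) then the_elem c * v m else 0))\<rparr>"

lemma dsum_car: "v \<in> car (dsum_module d n x) y \<longleftrightarrow> (\<forall>m. v m \<noteq> 0 \<longrightarrow> m < n \<and> y \<in> msupp d (x m))"
  by (simp add: dsum_module_def)

lemma dsum_act: "act (dsum_module d n x) y z c v m =
    (if y \<in> msupp d (x m) \<and> z \<in> msupp d (x m) then the_elem c * v m else 0)"
  by (simp add: dsum_module_def)

lemma the_elem_scalar_coset [simp]: "\<not> hit d x y \<Longrightarrow> the_elem (scalar_coset d x y c) = c"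
  by (simp add: scalar_coset_def)

lemma support_subspace: "kvec.subspace {v :: 'k::field kvec. \<forall>m. v m \<noteq> 0 \<longrightarrow> P m}"
proof (rule kvec.subspaceI)
  fix u v :: "'k kvec"
  assume *: "u \<in> {v. \<forall>m. v m \<noteq> 0 \<longrightarrow> P m}" "v \<in> {v. \<forall>m. v m \<noteq> 0 \<longrightarrow> P m}"
  have "u m + v m \<noteq> 0 \<Longrightarrow> u m \<noteq> 0 \<or> v m \<noteq> 0" for m by auto
  then show "u + v \<in> {v. \<forall>m. v m \<noteq> 0 \<longrightarrow> P m}" using * by (auto simp: plus_fun_apply)
qed (auto simp: vscale_def zero_fun_apply)

lemma dsum_right_module: "right_module (mesh_cat d :: (int list, 'k::field set, 'k) lincat) (dsum_module d n x)"
proof -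
  let ?C = "mesh_cat d :: (int list, 'k set, 'k) lincat"
  let ?M = "dsum_module d n x :: (int list, 'k set, 'k) rmod"
  have sub: "kvec.subspace (car ?M y)" for y
    using support_subspace[of "\<lambda>m. m < n \<and> y \<in> msupp d (x m)"] by (simp add: dsum_module_def)
  have in_car: "act ?M y z c v \<in> car ?M y" if "v \<in> car ?M z" for y z c v
    using that by (auto simp: dsum_car dsum_act split: if_splits)
  have lin: "linear_between (car ?M z) (car ?M y) (act ?M y z c)" for y z c
    unfolding linear_between_def using in_car
    by (auto simp: fun_eq_iff dsum_act vscale_def plus_fun_apply algebra_simps)
  show ?thesis
    unfolding right_module_def
  proof (intro conjI ballI allI)
    fix y z and f assume "f \<in> Hom ?C y z"
    then obtain a where f: "a \<in> scalars y z" "f = scalar_coset d y z a" unfolding mesh_Hom by blast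
    show "act ?M y z (hscale ?C y z c f) v = vscale c (act ?M y z f v)" for c v
      unfolding f(2) mesh_scale using msupp_not_hit by (auto simp: fun_eq_iff dsum_act vscale_def)
    fix g assume "g \<in> Hom ?C y z"
    then obtain b where g: "b \<in> scalars y z" "g = scalar_coset d y z b" unfolding mesh_Hom by blast
    show "act ?M y z (hadd ?C y z f g) v = act ?M y z f v + act ?M y z g v" for v
      unfolding f(2) g(2) mesh_add using msupp_not_hit
      by (auto simp: fun_eq_iff dsum_act plus_fun_apply algebra_simps)
  next
    fix y v assume v: "v \<in> car ?M y"
    show "act ?M y y (hone ?C y) v = v"
      unfolding mesh_one using v msupp_not_hit by (auto simp: fun_eq_iff dsum_act dsum_car)
  next
    fix w y z and f g v
    assume "f \<in> Hom ?C w y" "g \<in> Hom ?C y z"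
    then obtain a b where f: "a \<in> scalars w y" "f = scalar_coset d w y a"
      and g: "b \<in> scalars y z" "g = scalar_coset d y z b" unfolding mesh_Hom by blast
    have comp: "hcomp ?C w y z g f = scalar_coset d w z (b * a)"
      unfolding f(2) g(2) by (rule mesh_comp[OF f(1) g(1)])
    show "act ?M w z (hcomp ?C w y z g f) v = act ?M w y f (act ?M y z g v)"
    proof
      fix m
      show "act ?M w z (hcomp ?C w y z g f) v m = act ?M w y f (act ?M y z g v) m"
      proof (cases "w \<in> msupp d (x m) \<and> z \<in> msupp d (x m)")
        case True
        show ?thesis
        proof (cases "y \<in> msupp d (x m)")
          case y: True
          then show ?thesis unfolding comp unfolding f(2) g(2)
            using True msupp_not_hit[of w d "x m" z] msupp_not_hit[of w d "x m" y] msupp_not_hit[of y d "x m" z]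
            by (simp add: dsum_act)
        next
          case False
          then have "b * a = 0"
            using msupp_convex[of w d "x m" z y] True f(1) g(1) by (auto simp: scalars_def split: if_splits)
          then show ?thesis unfolding comp using False True msupp_not_hit[of w d "x m" z]
            by (simp add: dsum_act)
        qed
      qed (auto simp: dsum_act)
    qed
  qed (use sub lin in auto)
qed

lemma finite_support_span:
  fixes T :: "nat set"
  assumes "finite T"
  shows "\<exists>B. finite B \<and> {v :: 'k::field kvec. \<forall>m. v m \<noteq> 0 \<longrightarrow> m \<in> T} = kvec.span B"
proof -
  define \<delta> where "\<delta> m = (\<lambda>k. if k = m then 1 else 0 :: 'k)" for m :: nat
  have "kvec.span (\<delta> ` T) \<subseteq> {v. \<forall>m. v m \<noteq> 0 \<longrightarrow> m \<in> T}"
    by (rule kvec.span_minimal[OF _ support_subspace]) (auto simp: \<delta>_def split: if_splits)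
  moreover have "v \<in> kvec.span (\<delta> ` T)" if v: "\<forall>m. v m \<noteq> 0 \<longrightarrow> m \<in> T" for v
  proof -
    have apply_sum: "(\<Sum>m\<in>S. g m) k = (\<Sum>m\<in>S. g m k)" if "finite S" for S k and g :: "nat \<Rightarrow> 'k kvec"
      using that by induction (auto simp: zero_fun_apply plus_fun_apply)
    have "v = (\<Sum>m\<in>T. vscale (v m) (\<delta> m))"
    proof
      fix k
      have "(\<Sum>m\<in>T. vscale (v m) (\<delta> m)) k = (\<Sum>m\<in>T. if m = k then v k else 0)"
        unfolding apply_sum[OF assms] by (intro sum.cong) (auto simp: vscale_def \<delta>_def)
      also have "\<dots> = v k" using v assms by auto
      finally show "v k = (\<Sum>m\<in>T. vscale (v m) (\<delta> m)) k" by simp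
    qed
    also have "\<dots> \<in> kvec.span (\<delta> ` T)"
      by (intro kvec.span_sum kvec.span_scale kvec.span_base) auto
    finally show ?thesis .
  qed
  ultimately show ?thesis using assms by (intro exI[of _ "\<delta> ` T"]) blast
qed

lemma dsum_fd: "(dsum_module d n x :: (int list, 'k::field set, 'k) rmod) \<in> fd_modules (mesh_cat d)"
proof -
  let ?M = "dsum_module d n x :: (int list, 'k set, 'k) rmod"
  have "{y \<in> Ob (mesh_cat d :: (int list, 'k set, 'k) lincat). car ?M y \<noteq> {0}} \<subseteq> (\<Union>m<n. msupp d (x m))"
  proof
    fix y assume "y \<in> {y \<in> Ob (mesh_cat d :: (int list, 'k set, 'k) lincat). car ?M y \<noteq> {0}}"
    then obtain v where "v \<in> car ?M y" "v \<noteq> 0"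
      using kvec.subspace_0[OF right_module_subspace[OF dsum_right_module], of y d n x] by auto
    then obtain m where "v m \<noteq> 0" "v \<in> car ?M y" by (auto simp: fun_eq_iff zero_fun_apply)
    then show "y \<in> (\<Union>m<n. msupp d (x m))" by (auto simp: dsum_car)
  qed
  then have "finite {y \<in> Ob (mesh_cat d :: (int list, 'k set, 'k) lincat). car ?M y \<noteq> {0}}"
    by (rule finite_subset) (simp add: finite_msupp)
  moreover have "\<exists>B. finite B \<and> car ?M y = kvec.span B" for y
    using finite_support_span[of "{m. m < n \<and> y \<in> msupp d (x m)}"] by (simp add: dsum_module_def)
  ultimately show ?thesis unfolding fd_modules_def using dsum_right_module by blast
qed

lemma fd_modules_cong:
  assumes N: "N \<in> fd_modules C" and car: "car M = car N"
    and act: "\<And>x y f v. v \<in> car N y \<Longrightarrow> act M x y f v = act N x y f v"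
  shows "M \<in> fd_modules C"
proof -
  have m: "right_module C N" using N by (simp add: fd_modules_def)
  have "right_module C M"
    unfolding right_module_def car
  proof (intro conjI ballI allI)
    fix x y z f g v assume x: "x \<in> Ob C" and y: "y \<in> Ob C" and z: "z \<in> Ob C" and f: "f \<in> Hom C x y"
      and g: "g \<in> Hom C y z" and v: "v \<in> car N z"
    show "act M x z (hcomp C x y z g f) v = act M x y f (act M y z g v)"
      using right_moduleD(4)[OF m x y z f g v] right_module_act_in[OF m y z g v] v by (simp add: act)
  next
    fix x y f assume x: "x \<in> Ob C" and y: "y \<in> Ob C" and f: "f \<in> Hom C x y"
    show "linear_between (car N y) (car N x) (act M x y f)"
      using right_module_linear[OF m x y f] kvec.subspace_add[OF right_module_subspace[OF m y]]
        kvec.subspace_scale[OF right_module_subspace[OF m y]]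
      unfolding linear_between_def by (auto simp: act)
  qed (auto simp: act right_module_subspace[OF m] right_moduleD[OF m])
  then show ?thesis using N by (simp add: fd_modules_def car)
qed

lemma interval_car: "car (interval_module d x) = car (dsum_module d 1 (\<lambda>_. x))"
proof (rule ext, rule set_eqI)
  fix y v
  show "v \<in> car (interval_module d x) y \<longleftrightarrow> v \<in> car (dsum_module d 1 (\<lambda>_. x)) y"
  proof (cases "y \<in> msupp d x")
    case True
    then show ?thesis by (auto simp: interval_module_def dsum_car)
  next
    case False
    then show ?thesis by (simp add: interval_module_def dsum_car fun_eq_iff zero_fun_apply)
  qed
qed

lemma interval_car_iff: "v \<in> car (interval_module d x) y \<longleftrightarrow> (\<forall>m. v m \<noteq> 0 \<longrightarrow> m = 0 \<and> y \<in> msupp d x)"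
  unfolding interval_car dsum_car by auto

lemma interval_act:
  "act (interval_module d x) y z c v = (if y \<in> msupp d x \<and> z \<in> msupp d x then vscale (the_elem c) v else 0)"
  by (simp add: interval_module_def)

lemma interval_fd: "interval_module d x \<in> fd_modules (mesh_cat d)"
  by (rule fd_modules_cong[OF dsum_fd interval_car])
    (auto simp: interval_act dsum_act fun_eq_iff vscale_def zero_fun_apply)

lemma interval_right_module: "right_module (mesh_cat d) (interval_module d x)"
  using interval_fd unfolding fd_modules_def by blast

section \<open>Morphisms between interval modules\<close>

text \<open>
  The identity on the intersection of the two supports. It is natural only for interlaced tuples, so
  it is set to zero otherwise.
\<close>

definition eps :: "nat \<Rightarrow> int list \<Rightarrow> int list \<Rightarrow> int list \<Rightarrow> 'k::field kvec \<Rightarrow> 'k kvec" where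
  "eps d x y = (\<lambda>w v. if interlaced d x y \<and> w \<in> msupp d x \<and> w \<in> msupp d y \<and> (\<forall>m. v m \<noteq> 0 \<longrightarrow> m = 0)
    then v else 0)"

lemma interlaced_iff: "interlaced d x y \<longleftrightarrow> length x = Suc d \<and> length y = Suc d \<and>
    (\<forall>i\<le>d. x ! i \<le> y ! i) \<and> (\<forall>i<d. y ! i \<le> x ! Suc i)"
  by (simp add: interlaced_def)

lemma line_plus:
  fixes u v :: "'k::field kvec"
  assumes "\<forall>m. u m \<noteq> 0 \<longrightarrow> m = 0" "\<forall>m. v m \<noteq> 0 \<longrightarrow> m = 0"
  shows "\<forall>m. (u + v) m \<noteq> 0 \<longrightarrow> m = 0"
  using assms by (metis add.right_neutral plus_fun_apply)

text \<open>
  Let a point in the support of \<open>x\<close> lie above a point in the support of \<open>y\<close>. By interlacing the upper one is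
  in the support of \<open>y\<close> iff the lower one is in the support of \<open>x\<close>, so the two sides of the naturality
  square vanish together.
\<close>

lemma eps_mhom:
  assumes R: "interlaced d x y"
  shows "eps d x y \<in> mhom (mesh_cat d :: (int list, 'k::field set, 'k) lincat) (interval_module d x) (interval_module d y)"
proof (rule mhomI)
  fix w and v :: "'k kvec" assume "v \<in> car (interval_module d x) w"
  then show "eps d x y w v \<in> car (interval_module d y) w"
    by (auto simp: interval_car_iff eps_def zero_fun_apply)
next
  fix w and u v :: "'k kvec" assume "u \<in> car (interval_module d x) w" "v \<in> car (interval_module d x) w"
  then have line: "\<forall>m. u m \<noteq> 0 \<longrightarrow> m = 0" "\<forall>m. v m \<noteq> 0 \<longrightarrow> m = 0" unfolding interval_car_iff by blast+
  then show "eps d x y w (u + v) = eps d x y w u + eps d x y w v"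
    using line_plus[OF line] unfolding eps_def by simp
next
  fix w c and v :: "'k kvec" assume "v \<in> car (interval_module d x) w"
  then have "\<forall>m. v m \<noteq> 0 \<longrightarrow> m = 0" "\<forall>m. vscale c v m \<noteq> 0 \<longrightarrow> m = 0"
    by (auto simp: interval_car_iff vscale_def)
  then show "eps d x y w (vscale c v) = vscale c (eps d x y w v)" by (simp add: eps_def)
next
  fix w w' f and v :: "'k kvec"
  assume f: "f \<in> Hom (mesh_cat d :: (int list, 'k set, 'k) lincat) w w'" and v: "v \<in> car (interval_module d x) w'"
  obtain a where a: "a \<in> scalars w w'" "f = scalar_coset d w w' a" using f unfolding mesh_Hom by blast
  have line: "\<forall>m. vscale a v m \<noteq> 0 \<longrightarrow> m = 0" "\<forall>m. v m \<noteq> 0 \<longrightarrow> m = 0"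
    using v unfolding interval_car_iff by (auto simp: vscale_def)
  show "eps d x y w (act (interval_module d x) w w' f v) = act (interval_module d y) w w' f (eps d x y w' v)"
  proof (cases "w' \<in> msupp d x \<and> w \<in> msupp d y")
    case False
    have "v = 0" if "w' \<notin> msupp d x" using v that unfolding interval_car_iff by (auto simp: fun_eq_iff zero_fun_apply)
    then show ?thesis using False by (auto simp: eps_def interval_act)
  next
    case True
    then have nh: "\<not> hit d w w'" if "w \<in> msupp d x \<or> w' \<in> msupp d y" using msupp_not_hit that by blast
    show ?thesis
    proof (cases "prod_le w w'")
      case True
      have "w \<in> msupp d x \<longleftrightarrow> w' \<in> msupp d y"
      proof
        assume "w \<in> msupp d x"
        then show "w' \<in> msupp d y"
          using \<open>w' \<in> msupp d x \<and> w \<in> msupp d y\<close> True R unfolding msupp_iff interlaced_iff prod_le_nth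
          by (metis Suc_leI order_trans)
      next
        assume "w' \<in> msupp d y"
        then show "w \<in> msupp d x"
          using \<open>w' \<in> msupp d x \<and> w \<in> msupp d y\<close> True R unfolding msupp_iff interlaced_iff prod_le_nth
          by (metis less_imp_le order_trans)
      qed
      then show ?thesis using \<open>w' \<in> msupp d x \<and> w \<in> msupp d y\<close> R nh line
        by (auto simp: eps_def interval_act a(2))
    next
      case False
      then have "a = 0" using a(1) by (simp add: scalars_def)
      then show ?thesis using \<open>w' \<in> msupp d x \<and> w \<in> msupp d y\<close> nh
        by (auto simp: eps_def interval_act a(2))
    qed
  qed
next
  fix w and v :: "'k kvec"
  assume "w \<notin> Ob (mesh_cat d :: (int list, 'k set, 'k) lincat) \<or> v \<notin> car (interval_module d x) w"
  then show "eps d x y w v = 0" by (auto simp: eps_def interval_car_iff mesh_Ob msupp_iff)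
qed

definition unit_vec :: "'k::field kvec" where
  "unit_vec = (\<lambda>m. if m = 0 then 1 else 0)"

lemma line_eq_unit: "\<forall>m. v m \<noteq> 0 \<longrightarrow> m = 0 \<Longrightarrow> v = vscale (v 0) unit_vec"
  by (auto simp: unit_vec_def vscale_def fun_eq_iff)

lemma interval_car_zero: "w \<notin> msupp d x \<Longrightarrow> v \<in> car (interval_module d x) w \<Longrightarrow> v = 0"
  unfolding interval_car_iff by (auto simp: fun_eq_iff zero_fun_apply)

text \<open>
  The intersection of the supports is a box. On it a morphism is multiplication by scalars, which by
  naturality agree with the scalar at the smallest point, so there is only one scalar. If \<open>x \<leadsto> y\<close> fails, then
  one can step out of exactly one of the two supports, below the smallest point or above the largest
  one, and naturality along that step shows that the scalar is zero.
\<close>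

lemma interval_hom_scalar:
  assumes d: "d \<ge> 1" and x: "length x = Suc d" and y: "length y = Suc d"
    and \<phi>: "\<phi> \<in> mhom (mesh_cat d :: (int list, 'k::field set, 'k) lincat) (interval_module d x) (interval_module d y)"
  shows "\<exists>c. \<phi> = msmul c (eps d x y)"
proof -
  let ?C = "mesh_cat d :: (int list, 'k set, 'k) lincat"
  define S where "S = msupp d x \<inter> msupp d y"
  define b where "b w = \<phi> w unit_vec 0" for w
  have unit: "unit_vec \<in> car (interval_module d z) w" if "w \<in> msupp d z" for w z
    using that by (simp add: interval_car_iff unit_vec_def)
  have ob: "w \<in> Ob ?C" if "w \<in> msupp d z" for w z using that by (simp add: mesh_Ob msupp_iff)
  have on_S: "\<phi> w v = vscale (b w) v" if w: "w \<in> S" and v: "v \<in> car (interval_module d x) w" for w v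
  proof -
    have wx: "w \<in> msupp d x" and wy: "w \<in> msupp d y" using w by (auto simp: S_def)
    have "\<phi> w unit_vec \<in> car (interval_module d y) w" by (rule mhom_in[OF \<phi> ob[OF wx] unit[OF wx]])
    then have 1: "\<phi> w unit_vec = vscale (b w) unit_vec" unfolding b_def interval_car_iff by (blast intro: line_eq_unit)
    have 2: "v = vscale (v 0) unit_vec" using v unfolding interval_car_iff by (blast intro: line_eq_unit)
    have "\<phi> w (vscale (v 0) unit_vec) = vscale (v 0) (\<phi> w unit_vec)"
      by (rule mhom_scale_arg[OF \<phi> ob[OF wx] unit[OF wx]])
    also have "\<dots> = vscale (b w) (vscale (v 0) unit_vec)" unfolding 1 by (simp add: mult.commute)
    finally show ?thesis using 2 by simp
  qed
  have nat: "\<phi> w (if w \<in> msupp d x \<and> w' \<in> msupp d x then v else 0) =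
      (if w \<in> msupp d y \<and> w' \<in> msupp d y then \<phi> w' v else 0)"
    if le: "prod_le w w'" and w: "length w = d" "length w' = d" and v: "v \<in> car (interval_module d x) w'" for w w' v
  proof -
    have f: "scalar_coset d w w' (1::'k) \<in> Hom ?C w w'" using le by (simp add: mesh_Hom scalars_def)
    have "\<phi> w (act (interval_module d x) w w' (scalar_coset d w w' 1) v) =
        act (interval_module d y) w w' (scalar_coset d w w' 1) (\<phi> w' v)"
      by (rule mhom_nat[OF \<phi> _ _ f v]) (simp_all add: mesh_Ob w)
    moreover have "act (interval_module d z) w w' (scalar_coset d w w' 1) u =
        (if w \<in> msupp d z \<and> w' \<in> msupp d z then u else 0)" for z and u :: "'k kvec"
      using msupp_not_hit[of w d z w'] by (simp add: interval_act)
    ultimately show ?thesis by simp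
  qed
  have b_mono: "b w = b w'" if "w \<in> S" "w' \<in> S" "prod_le w w'" for w w'
  proof -
    have "\<phi> w (if w \<in> msupp d x \<and> w' \<in> msupp d x then unit_vec else 0) =
        (if w \<in> msupp d y \<and> w' \<in> msupp d y then \<phi> w' unit_vec else 0)"
      using that(1,2) by (intro nat[OF that(3)] unit) (auto simp: S_def msupp_iff)
    then show ?thesis using that(1,2) by (simp add: S_def b_def)
  qed
  \<comment> \<open>The smallest and the largest point of the common support, if it is not empty.\<close>
  define lo where "lo = map (\<lambda>i. max (x ! i) (y ! i)) [0..<d]"
  define hi where "hi = map (\<lambda>i. min (x ! Suc i) (y ! Suc i)) [0..<d]"
  have box: "lo \<in> S \<and> hi \<in> S" if "w \<in> S" for w
  proof -
    have "x ! i \<le> w ! i \<and> w ! i \<le> x ! Suc i \<and> y ! i \<le> w ! i \<and> w ! i \<le> y ! Suc i" if "i < d" for i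
      using \<open>w \<in> S\<close> that by (simp add: S_def msupp_iff)
    then have "x ! i \<le> x ! Suc i \<and> x ! i \<le> y ! Suc i \<and> y ! i \<le> x ! Suc i \<and> y ! i \<le> y ! Suc i" if "i < d" for i
      using that by (meson order_trans)
    then show ?thesis by (simp add: S_def msupp_iff lo_def hi_def)
  qed
  have b_const: "b w = b lo" if "w \<in> S" for w
  proof (rule b_mono[symmetric])
    show "lo \<in> S" using box[OF that] by blast
    show "prod_le lo w" using that by (simp add: S_def msupp_iff prod_le_nth lo_def)
  qed (rule that)
  have b_zero: "b lo = 0" if w: "w \<in> S" and R: "\<not> interlaced d x y" for w
  proof -
    have lohi: "lo \<in> S" "hi \<in> S" using box[OF w] by simp_all
    have cross: "x ! i \<le> y ! Suc i \<and> y ! i \<le> x ! Suc i" if "i < d" for i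
      using w that by (auto simp: S_def msupp_iff intro: order_trans)
    then obtain i where i: "i \<le> d" "y ! i < x ! i" using R x y unfolding interlaced_iff by (meson not_le)
    show ?thesis
    proof (cases "i < d")
      case True
      \<comment> \<open>One step below the smallest point: this leaves the support of \<open>x\<close> but not that of \<open>y\<close>.\<close>
      define w' where "w' = lo[i := x ! i - 1]"
      have w': "w' \<in> msupp d y" "w' \<notin> msupp d x" "prod_le w' lo"
      proof -
        have ly: "\<forall>j<d. y ! j \<le> lo ! j \<and> lo ! j \<le> y ! Suc j" "length lo = d"
          using lohi(1) by (auto simp: S_def msupp_iff)
        have first: "lo ! i = x ! i" using True i(2) by (simp add: lo_def)
        show "w' \<in> msupp d y"
          unfolding msupp_iff w'_def
        proof (intro conjI allI impI)
          fix j assume j: "j < d"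
          show "y ! j \<le> lo[i := x ! i - 1] ! j"
            using ly j i(2) by (cases "j = i") (auto simp: nth_list_update)
          show "lo[i := x ! i - 1] ! j \<le> y ! Suc j"
            using ly(1)[rule_format, OF j] ly(2) j first by (cases "j = i") (auto simp: nth_list_update)
        qed (simp add: ly)
        show "w' \<notin> msupp d x"
        proof
          assume "w' \<in> msupp d x"
          then have "x ! i \<le> w' ! i" using True unfolding msupp_iff by blast
          then show False using True ly(2) by (simp add: w'_def)
        qed
        have "lo[i := x ! i - 1] ! j \<le> lo ! j" if "j < d" for j
          using first ly(2) that by (cases "j = i") auto
        then show "prod_le w' lo" using ly(2) by (simp add: prod_le_nth w'_def)
      qed
      have "\<phi> w' (if w' \<in> msupp d x \<and> lo \<in> msupp d x then unit_vec else 0) =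
          (if w' \<in> msupp d y \<and> lo \<in> msupp d y then \<phi> lo unit_vec else 0)"
        using lohi(1) w'(1) by (intro nat[OF w'(3)] unit) (auto simp: S_def msupp_iff)
      then have "\<phi> lo unit_vec = 0" using w' lohi(1) mhom_at_zero[OF \<phi>] by (simp add: S_def)
      then show ?thesis by (simp add: b_def zero_fun_apply)
    next
      case False
      then have id: "i = d" "d - 1 < d" "Suc (d - 1) = d" using i d by auto
      \<comment> \<open>One step above the largest point: this leaves the support of \<open>y\<close> but not that of \<open>x\<close>.\<close>
      define w' where "w' = hi[d - 1 := y ! d + 1]"
      have w': "w' \<in> msupp d x" "w' \<notin> msupp d y" "prod_le hi w'"
      proof -
        have hx: "\<forall>j<d. x ! j \<le> hi ! j \<and> hi ! j \<le> x ! Suc j" "length hi = d"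
          using lohi(2) by (auto simp: S_def msupp_iff)
        have last: "hi ! (d - 1) = y ! d" using id i(2) by (simp add: hi_def)
        show "w' \<in> msupp d x"
          unfolding msupp_iff w'_def
        proof (intro conjI allI impI)
          fix j assume j: "j < d"
          have hj: "x ! j \<le> hi ! j" "hi ! j \<le> x ! Suc j" using hx(1) j by blast+
          show "x ! j \<le> hi[d - 1 := y ! d + 1] ! j"
            using hj hx(2) j last by (cases "j = d - 1") simp_all
          show "hi[d - 1 := y ! d + 1] ! j \<le> x ! Suc j"
          proof (cases "j = d - 1")
            case True
            then have "Suc j = d" using id by simp
            then show ?thesis using True hx(2) j i(2) id(1) by simp
          qed (use hj hx(2) j in simp)
        qed (simp add: hx)
        show "w' \<notin> msupp d y"
        proof
          assume "w' \<in> msupp d y"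
          then have "w' ! (d - 1) \<le> y ! Suc (d - 1)" using id unfolding msupp_iff by blast
          then show False using id hx(2) by (simp add: w'_def)
        qed
        have "hi ! j \<le> hi[d - 1 := y ! d + 1] ! j" if "j < d" for j
          using last hx(2) that by (cases "j = d - 1") auto
        then show "prod_le hi w'" using hx(2) by (simp add: prod_le_nth w'_def)
      qed
      have "\<phi> hi (if hi \<in> msupp d x \<and> w' \<in> msupp d x then unit_vec else 0) =
          (if hi \<in> msupp d y \<and> w' \<in> msupp d y then \<phi> w' unit_vec else 0)"
        using lohi(2) w'(1) by (intro nat[OF w'(3)] unit) (auto simp: S_def msupp_iff)
      then have "\<phi> hi unit_vec = 0" using w' lohi(2) by (simp add: S_def)
      then have "b hi = 0" by (simp add: b_def zero_fun_apply)
      then show ?thesis using b_const[OF lohi(2)] by simp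
    qed
  qed
  have "\<phi> w v = msmul (b lo) (eps d x y) w v" for w v
  proof (cases "w \<in> S \<and> v \<in> car (interval_module d x) w")
    case True
    then have "\<forall>m. v m \<noteq> 0 \<longrightarrow> m = 0" unfolding interval_car_iff by blast
    then have "msmul (b lo) (eps d x y) w v = vscale (b lo) v"
      using True b_zero[of w] by (cases "interlaced d x y") (auto simp: msmul_def eps_def S_def)
    then show ?thesis using on_S[of w v] b_const[of w] True by simp
  next
    case False
    have "\<phi> w v = 0"
    proof (cases "w \<in> Ob ?C \<and> v \<in> car (interval_module d x) w")
      case True
      then have "\<phi> w v \<in> car (interval_module d y) w" using mhom_in[OF \<phi>] by blast
      show ?thesis
      proof (cases "w \<in> msupp d x")
        case wx: True
        then have "w \<notin> msupp d y" using False True by (simp add: S_def)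
        then show ?thesis using \<open>\<phi> w v \<in> car (interval_module d y) w\<close> by (rule interval_car_zero)
      next
        case wx: False
        then have "v = 0" using True interval_car_zero by blast
        then show ?thesis using mhom_at_zero[OF \<phi>] by simp
      qed
    qed (use mhom_out[OF \<phi>] in blast)
    moreover have "eps d x y w v = 0" using False by (auto simp: eps_def S_def interval_car_iff)
    ultimately show ?thesis by (simp add: msmul_def)
  qed
  then show ?thesis by blast
qed

text \<open>
  A point in the supports of \<open>x\<close> and \<open>z\<close> also lies in the support of \<open>y\<close>, and its existence entails \<open>x \<leadsto> z\<close>.
\<close>

lemma eps_comp_interlaced:
  assumes "interlaced d x y" "interlaced d y z"
  shows "eps d y z \<odot> eps d x y = eps d x z"
proof (rule ext, rule ext)
  fix w and v :: "'a kvec"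
  have 1: "interlaced d x z" if "w \<in> msupp d x" "w \<in> msupp d z"
    using assms that unfolding interlaced_iff msupp_iff by (meson order_trans)
  have 2: "w \<in> msupp d y" if "w \<in> msupp d x" "w \<in> msupp d z"
    using assms that unfolding interlaced_iff msupp_iff by (meson less_imp_le order_trans Suc_leI)
  show "(eps d y z \<odot> eps d x y) w v = eps d x z w v"
  proof (cases "w \<in> msupp d x \<and> w \<in> msupp d z")
    case True
    then have "interlaced d x z" "w \<in> msupp d y" using 1 2 by blast+
    then show ?thesis using True assms
      by (cases "\<forall>m. v m \<noteq> 0 \<longrightarrow> m = 0") (simp_all add: mcomp_def eps_def zero_fun_apply)
  next
    case False
    then have "eps d x y w v = 0 \<or> w \<notin> msupp d z" by (auto simp: eps_def)
    moreover have "eps d y z w 0 = 0" "w \<notin> msupp d z \<Longrightarrow> eps d y z w u = 0" for u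
      by (simp_all add: eps_def)
    ultimately have "eps d y z w (eps d x y w v) = 0" by metis
    moreover have "eps d x z w v = 0" using False by (auto simp: eps_def)
    ultimately show ?thesis by (simp add: mcomp_def)
  qed
qed

lemma eps_self: "eps d x x = mone (mesh_cat d :: (int list, 'k::field set, 'k) lincat) (interval_module d x)"
  if "length x = Suc d"
proof (rule ext, rule ext)
  fix w and v :: "'k kvec"
  have "interlaced d x x" if "w \<in> msupp d x"
    using that \<open>length x = Suc d\<close> unfolding interlaced_iff msupp_iff by (auto intro: order_trans)
  then show "eps d x x w v = mone (mesh_cat d :: (int list, 'k set, 'k) lincat) (interval_module d x) w v"
    by (auto simp: eps_def mone_def interval_car_iff mesh_Ob fun_eq_iff zero_fun_apply msupp_iff)
qed

lemma eps_zero: "\<not> interlaced d x y \<Longrightarrow> eps d x y = 0"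
  by (auto simp: eps_def fun_eq_iff zero_fun_apply)

lemma eps_nonzero:
  assumes R: "interlaced d x y" and 0: "msmul c (eps d x y) = 0"
  shows "c = 0"
proof -
  have "take d y \<in> msupp d x" "take d y \<in> msupp d y"
    using R unfolding interlaced_iff msupp_iff by (auto intro: order_trans)
  then have "msmul c (eps d x y) (take d y) unit_vec 0 = c"
    using R by (simp add: msmul_def eps_def unit_vec_def vscale_def)
  then show ?thesis unfolding 0 by (simp add: zero_fun_apply)
qed

lemma thin_intervals:
  assumes d: "d \<ge> 1"
  shows "thin_family (mesh_cat d :: (int list, 'k::field set, 'k) lincat) (tuples (Suc d)) (interval_module d)
    (interlaced d) (eps d) (\<lambda>x. \<Sum>i\<le>d. x ! i)"
proof
  let ?C = "mesh_cat d :: (int list, 'k set, 'k) lincat"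
  show "right_module ?C (interval_module d x)" for x by (rule interval_right_module)
  show "mhom ?C (interval_module d x) (interval_module d y) = range (\<lambda>c. msmul c (eps d x y))"
    if "x \<in> tuples (Suc d)" "y \<in> tuples (Suc d)" for x y
  proof
    show "mhom ?C (interval_module d x) (interval_module d y) \<subseteq> range (\<lambda>c. msmul c (eps d x y))"
      using interval_hom_scalar[OF d] that by (auto simp: image_iff)
    have "eps d x y \<in> mhom ?C (interval_module d x) (interval_module d y)"
    proof (cases "interlaced d x y")
      case False
      then show ?thesis using mhom_zero[OF interval_right_module] by (simp add: eps_zero)
    qed (rule eps_mhom)
    then show "range (\<lambda>c. msmul c (eps d x y)) \<subseteq> mhom ?C (interval_module d x) (interval_module d y)"
      using mhom_smul[OF interval_right_module] by blast
  qed
  show "eps d x y = (0 :: int list \<Rightarrow> 'k kvec \<Rightarrow> 'k kvec)" if "\<not> interlaced d x y" for x y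
    by (rule eps_zero[OF that])
  show "c = 0" if "interlaced d x y" "msmul c (eps d x y) = 0" for x y and c :: 'k
    by (rule eps_nonzero[OF that])
  show "eps d y z \<odot> eps d x y = (eps d x z :: int list \<Rightarrow> 'k kvec \<Rightarrow> 'k kvec)"
    if "interlaced d x y" "interlaced d y z" for x y z by (rule eps_comp_interlaced[OF that])
  show "eps d x x = mone ?C (interval_module d x)" if "x \<in> tuples (Suc d)" for x
    by (rule eps_self) (use that in simp)
  show "(\<Sum>i\<le>d. x ! i) < (\<Sum>i\<le>d. y ! i)" if R: "interlaced d x y" and ne: "x \<noteq> y" for x y
  proof (rule sum_strict_mono_ex1)
    show "\<forall>i\<in>{..d}. x ! i \<le> y ! i" using R by (simp add: interlaced_iff)
    show "\<exists>i\<in>{..d}. x ! i < y ! i"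
    proof (rule ccontr)
      assume "\<not> (\<exists>i\<in>{..d}. x ! i < y ! i)"
      then have "x ! i = y ! i" if "i < Suc d" for i using R that unfolding interlaced_iff
        by (meson atMost_iff less_Suc_eq_le order_antisym not_le)
      then have "x = y" using R unfolding interlaced_iff by (intro nth_equalityI) auto
      then show False using ne by blast
    qed
  qed simp
qed

lemma fun_sum_apply3: "(\<Sum>i\<in>S. \<phi> i) w v m = (\<Sum>i\<in>S. \<phi> i w v m)" if "finite S"
  for \<phi> :: "nat \<Rightarrow> 'o \<Rightarrow> 'k::field kvec \<Rightarrow> 'k kvec"
  using that by induction (auto simp: zero_fun_apply plus_fun_apply)

lemma dsum_decomp:
  "\<exists>a b. decomp (mesh_cat d :: (int list, 'k::field set, 'k) lincat) n (dsum_module d n x) (\<lambda>i. interval_module d (x i)) a b"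
proof -
  let ?C = "mesh_cat d :: (int list, 'k set, 'k) lincat"
  let ?M = "dsum_module d n x :: (int list, 'k set, 'k) rmod"
  let ?I = "\<lambda>i. interval_module d (x i) :: (int list, 'k set, 'k) rmod"
  define a :: "nat \<Rightarrow> int list \<Rightarrow> 'k kvec \<Rightarrow> 'k kvec" where
    "a i = (\<lambda>w v. if w \<in> Ob ?C \<and> v \<in> car (?I i) w then (\<lambda>m. if m = i then v 0 else 0) else 0)" for i
  define b :: "nat \<Rightarrow> int list \<Rightarrow> 'k kvec \<Rightarrow> 'k kvec" where
    "b i = (\<lambda>w v. if w \<in> Ob ?C \<and> v \<in> car ?M w then (\<lambda>m. if m = 0 then v i else 0) else 0)" for i
  have subI: "u + v \<in> car (?I i) w" "vscale c v \<in> car (?I i) w"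
    if "w \<in> Ob ?C" "u \<in> car (?I i) w" "v \<in> car (?I i) w" for i w u v c
    using right_module_subspace[OF interval_right_module that(1), of "x i"] that(2,3)
    by (auto intro: kvec.subspace_add kvec.subspace_scale)
  have subM: "u + v \<in> car ?M w" "vscale c v \<in> car ?M w"
    if "w \<in> Ob ?C" "u \<in> car ?M w" "v \<in> car ?M w" for w u v c
    using right_module_subspace[OF dsum_right_module that(1), of n x] that(2,3)
    by (auto intro: kvec.subspace_add kvec.subspace_scale)
  have a: "a i \<in> mhom ?C (?I i) ?M" if i: "i < n" for i
  proof (rule mhomI)
    fix w v assume "w \<in> Ob ?C" "v \<in> car (?I i) w"
    then show "a i w v \<in> car ?M w" using i by (auto simp: a_def dsum_car interval_car_iff)
  next
    fix w w' f v assume *: "w \<in> Ob ?C" "w' \<in> Ob ?C" "f \<in> Hom ?C w w'" and v: "v \<in> car (?I i) w'"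
    have "act (?I i) w w' f v \<in> car (?I i) w"
      by (rule right_module_act_in[OF interval_right_module * v])
    then show "a i w (act (?I i) w w' f v) = act ?M w w' f (a i w' v)"
      using * v by (auto simp: a_def fun_eq_iff dsum_act interval_act vscale_def zero_fun_apply)
  qed (auto simp: a_def fun_eq_iff plus_fun_apply vscale_def subI subI[unfolded vscale_def] zero_fun_apply)
  have b: "b i \<in> mhom ?C ?M (?I i)" if i: "i < n" for i
  proof (rule mhomI)
    fix w v assume "w \<in> Ob ?C" "v \<in> car ?M w"
    then show "b i w v \<in> car (?I i) w" using i by (auto simp: b_def dsum_car interval_car_iff)
  next
    fix w w' f v assume *: "w \<in> Ob ?C" "w' \<in> Ob ?C" "f \<in> Hom ?C w w'" and v: "v \<in> car ?M w'"
    have "act ?M w w' f v \<in> car ?M w" by (rule right_module_act_in[OF dsum_right_module * v])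
    then show "b i w (act ?M w w' f v) = act (?I i) w w' f (b i w' v)"
      using * v by (auto simp: b_def fun_eq_iff dsum_act interval_act vscale_def zero_fun_apply)
  qed (auto simp: b_def fun_eq_iff plus_fun_apply vscale_def subM subM[unfolded vscale_def] zero_fun_apply)
  have ba: "b j \<odot> a i = (if i = j then mone ?C (?I i) else 0)" if i: "i < n" "j < n" for i j
  proof (rule ext, rule ext, rule ext)
    fix w v m
    show "(b j \<odot> a i) w v m = (if i = j then mone ?C (?I i) else 0) w v m"
    proof (cases "w \<in> Ob ?C \<and> v \<in> car (?I i) w")
      case True
      then have "a i w v \<in> car ?M w" using mhom_in[OF a[OF i(1)]] by blast
      then show ?thesis using True
        by (auto simp: mcomp_def a_def b_def mone_def interval_car_iff zero_fun_apply)
    next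
      case False
      then show ?thesis using mhom_at_zero[OF b[OF i(2)]]
        by (auto simp: mcomp_def a_def mone_def zero_fun_apply)
    qed
  qed
  have "(\<Sum>i<n. a i \<odot> b i) = mone ?C ?M"
  proof (rule ext, rule ext, rule ext)
    fix w v m
    show "(\<Sum>i<n. a i \<odot> b i) w v m = mone ?C ?M w v m"
    proof (cases "w \<in> Ob ?C \<and> v \<in> car ?M w")
      case True
      have "(\<Sum>i<n. a i \<odot> b i) w v m = (\<Sum>i<n. if i = m then v m else 0)"
        unfolding fun_sum_apply3[OF finite_lessThan]
      proof (intro sum.cong refl)
        fix i assume "i \<in> {..<n}"
        then have "b i w v \<in> car (?I i) w" using mhom_in[OF b] True by blast
        then show "(a i \<odot> b i) w v m = (if i = m then v m else 0)"
          using True by (auto simp: mcomp_def a_def b_def)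
      qed
      also have "\<dots> = v m" using True by (auto simp: dsum_car)
      finally show ?thesis using True by (simp add: mone_def)
    next
      case False
      have "(a i \<odot> b i) w v m = 0" if "i < n" for i
        using False mhom_at_zero[OF a[OF that]] by (auto simp: mcomp_def b_def zero_fun_apply)
      then show ?thesis using False unfolding fun_sum_apply3[OF finite_lessThan]
        by (auto simp: mone_def zero_fun_apply)
    qed
  qed
  then show ?thesis unfolding decomp_def using a b ba by blast
qed

section \<open>The subcategories generated by interval modules\<close>

lemma kupisch_drop:
  assumes "kupisch_series l"
  shows "l b \<le> l (b - int n) + enat n"
proof (induction n)
  case (Suc n)
  have "l (b - int n) \<le> l (b - int n - 1) + 1" using assms unfolding kupisch_series_def by blast
  then have "l (b - int n) + enat n \<le> l (b - int n - 1) + 1 + enat n" by (rule add_right_mono)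
  also have "\<dots> = l (b - int (Suc n)) + enat (Suc n)" by (simp add: one_enat_def add.assoc algebra_simps)
  finally show ?case using Suc.IH by (rule order_trans[rotated])
qed (simp add: zero_enat_def[symmetric])

text \<open>
  A Kupisch series drops by at most \<open>b - b'\<close> on the way from \<open>b\<close> down to \<open>b'\<close>, so an interval inside an
  admissible interval is admissible.
\<close>

lemma kupisch_shrink:
  assumes l: "kupisch_series l" and ab: "enat (nat (b - a + 1)) \<le> l b" and "a \<le> a'" "b' \<le> b"
  shows "enat (nat (b' - a' + 1)) \<le> l b'"
proof (cases "l b'")
  case (enat k)
  have "enat (nat (b - a + 1)) \<le> enat k + enat (nat (b - b'))"
    using order_trans[OF ab kupisch_drop[OF l, of b "nat (b - b')"]] assms(4) enat by simp
  then have "nat (b - a + 1) \<le> k + nat (b - b')" by simp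
  then have "nat (b' - a' + 1) \<le> k" using assms(3,4) by linarith
  then show ?thesis using enat by simp
qed simp

lemma os_kup_iff:
  "x \<in> os_kup l (Suc d) \<longleftrightarrow> length x = Suc d \<and> sorted x \<and> enat (nat (x ! d - x ! 0 + 1)) \<le> l (x ! d)"
  by (auto simp: os_kup_def os_def)

lemma sorted_interlaced: "sorted x \<and> length x = Suc d \<longleftrightarrow> interlaced d x x"
  unfolding interlaced_iff sorted_nth_Suc by auto

lemma os_kupI:
  assumes l: "kupisch_series l" and x: "x \<in> os_kup l (Suc d)" and y: "interlaced d y y"
    and "x ! 0 \<le> y ! 0" "y ! d \<le> x ! d"
  shows "y \<in> os_kup l (Suc d)"
  using kupisch_shrink[OF l _ assms(4,5)] x y unfolding os_kup_iff
  by (simp add: sorted_interlaced[of y d, symmetric])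

lemma msupp_kup:
  assumes l: "kupisch_series l" and d: "d \<ge> 1" and x: "x \<in> os_kup l (Suc d)" and w: "w \<in> msupp d x"
  shows "w \<in> os_kup l d"
proof -
  have e: "0 < d" "d - 1 < d" "Suc (d - 1) = d" using d by auto
  have 1: "x ! 0 \<le> w ! 0" using w e(1) unfolding msupp_iff by blast
  have "w ! (d - 1) \<le> x ! Suc (d - 1)" using w e(2) unfolding msupp_iff by blast
  then have 2: "w ! (d - 1) \<le> x ! d" using e(3) by simp
  have "enat (nat (w ! (d - 1) - w ! 0 + 1)) \<le> l (w ! (d - 1))"
    by (rule kupisch_shrink[OF l _ 1 2]) (use x in \<open>simp add: os_kup_iff\<close>)
  then show ?thesis using msupp_os[OF w] by (simp add: os_kup_def)
qed

lemma msupp_empty: "\<not> sorted x \<Longrightarrow> length x = Suc d \<Longrightarrow> msupp d x = {}"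
  unfolding sorted_nth_Suc by (auto simp: msupp_iff) (meson order_trans)

lemma fd_nakayama_right_module: "M \<in> fd_nakayama l d \<Longrightarrow> right_module (mesh_cat d) M"
  unfolding fd_nakayama_def fd_modules_quot_def fd_modules_def by blast

lemma dsum_nakayama:
  assumes l: "kupisch_series l" and d: "d \<ge> 1"
    and x: "\<And>i. i < n \<Longrightarrow> x i \<in> os_kup l (Suc d) \<or> msupp d (x i) = {}"
  shows "(dsum_module d n x :: (int list, 'a::field set, 'a) rmod) \<in> fd_nakayama l d"
  unfolding fd_nakayama_def
proof (rule lincat_closed.fd_modules_quotI[OF lincat_closed_mesh dsum_fd], intro ballI impI)
  fix w assume w: "w \<in> os d - os_kup l d"
  have "w \<notin> msupp d (x i)" if "i < n" for i using x[OF that] msupp_kup[OF l d] w by blast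
  then have "v \<in> car (dsum_module d n x) w \<longleftrightarrow> (\<forall>m. v m = 0)" for v :: "'a kvec"
    unfolding dsum_car by blast
  then show "car (dsum_module d n x :: (int list, 'a set, 'a) rmod) w = {0}"
    by (auto simp: fun_eq_iff zero_fun_apply)
qed

lemma interval_nakayama:
  assumes l: "kupisch_series l" and d: "d \<ge> 1" and x: "x \<in> os_kup l (Suc d)"
  shows "interval_module d x \<in> fd_nakayama l d"
  unfolding fd_nakayama_def
proof (rule lincat_closed.fd_modules_quotI[OF lincat_closed_mesh interval_fd], intro ballI impI)
  fix w assume "w \<in> os d - os_kup l d"
  then have "w \<notin> msupp d x" using msupp_kup[OF l d x] by blast
  then show "car (interval_module d x) w = {0}" by (simp add: interval_module_def)
qed

lemma os_kup_tuples: "J \<subseteq> os_kup l (Suc d) \<Longrightarrow> J \<subseteq> tuples (Suc d)"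
  by (auto simp: os_kup_iff)

text \<open>
  The right-hand side is a subcategory that contains the intervals. Conversely, each of its objects is a
  finite direct sum of intervals by the Krull-Schmidt argument, hence lies in every such subcategory.
\<close>

lemma add_intervals_eq:
  assumes l: "kupisch_series l" and d: "d \<ge> 1" and J: "J \<subseteq> os_kup l (Suc d)"
  shows "(add_intervals l d J :: (int list, 'k::field set, 'k) rmod set) =
    retracts (mesh_cat d) (fd_nakayama l d) (interval_module d ` J)"
proof
  let ?C = "mesh_cat d :: (int list, 'k set, 'k) lincat"
  let ?A = "fd_nakayama l d :: (int list, 'k set, 'k) rmod set"
  let ?R = "retracts ?C ?A (interval_module d ` J)"
  interpret thin_family ?C "tuples (Suc d)" "interval_module d" "interlaced d" "eps d" "\<lambda>x. \<Sum>i\<le>d. x ! i"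
    by (rule thin_intervals[OF d])
  have "interval_module d x \<in> ?R" if "x \<in> J" for x
  proof -
    have m: "mone ?C (interval_module d x) \<in> mhom ?C (interval_module d x) (interval_module d x)"
      by (rule mone_mhom[OF module])
    have "mone ?C (interval_module d x) \<odot> mone ?C (interval_module d x) \<in>
        factor_ideal ?C (interval_module d ` J) (interval_module d x) (interval_module d x)"
      by (rule factor_ideal.comp[OF _ m m]) (use that in blast)
    then show ?thesis
      unfolding retracts_def mone_left[OF m] using interval_nakayama[OF l d] that J by blast
  qed
  moreover have "subcategory ?C ?A ?R" by (rule subcategory_retracts[OF fd_nakayama_right_module])
  ultimately show "add_intervals l d J \<subseteq> ?R"
    unfolding add_intervals_def add_closure_def by blast
  show "?R \<subseteq> add_intervals l d J"
    unfolding add_intervals_def add_closure_def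
  proof (intro subsetI InterI)
    fix Y \<U> assume Y: "Y \<in> ?R" and "\<U> \<in> {\<U>. subcategory ?C ?A \<U> \<and> interval_module d ` J \<subseteq> \<U>}"
    then have sub: "subcategory ?C ?A \<U>" and gen: "interval_module d ` J \<subseteq> \<U>" by blast+
    have YA: "Y \<in> ?A" "mone ?C Y \<in> factor_ideal ?C (interval_module d ` J) Y Y" using Y by (auto simp: retracts_def)
    obtain xs a b where xs: "set xs \<subseteq> J" and dec: "decomp ?C (length xs) Y (\<lambda>i. interval_module d (xs ! i)) a b"
      using retract_decomp[OF fd_nakayama_right_module[OF YA(1)] os_kup_tuples[OF J] YA(2)] by blast
    have "decomp ?C (length (map (interval_module d) xs)) Y (\<lambda>i. map (interval_module d) xs ! i) a b"
      using dec unfolding decomp_def by (simp cong: if_cong)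
    then have "is_dsum ?C Y (map (interval_module d) xs)" unfolding is_dsum_decomp by blast
    moreover have "set (map (interval_module d) xs) \<subseteq> \<U>" using xs gen by auto
    moreover have "\<forall>Xs. \<forall>Y\<in>?A. set Xs \<subseteq> \<U> \<longrightarrow> is_dsum ?C Y Xs \<longrightarrow> Y \<in> \<U>"
      using sub unfolding subcategory_def by - (elim conjE, assumption)
    ultimately show "Y \<in> \<U>" using YA(1) by blast
  qed
qed

lemma dsum_add_intervals:
  assumes l: "kupisch_series l" and d: "d \<ge> 1" and J: "J \<subseteq> os_kup l (Suc d)"
    and x: "\<And>i. i < n \<Longrightarrow> x i \<in> J \<or> msupp d (x i) = {}"
  shows "(dsum_module d n x :: (int list, 'k::field set, 'k) rmod) \<in> add_intervals l d J"
proof -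
  let ?C = "mesh_cat d :: (int list, 'k set, 'k) lincat"
  let ?M = "dsum_module d n x :: (int list, 'k set, 'k) rmod"
  obtain a b where dec: "decomp ?C n ?M (\<lambda>i. interval_module d (x i)) a b" using dsum_decomp by blast
  have "a i \<odot> b i \<in> factor_ideal ?C (interval_module d ` J) ?M ?M" if i: "i < n" for i
  proof (cases "x i \<in> J")
    case True
    then show ?thesis using factor_ideal.comp[OF _ decompD(1)[OF dec i] decompD(2)[OF dec i]] by blast
  next
    case False
    then have "msupp d (x i) = {}" using x[OF i] by blast
    then have "mone ?C (interval_module d (x i)) = (0 :: int list \<Rightarrow> 'k kvec \<Rightarrow> 'k kvec)"
      using interval_car_zero[of _ d "x i"] by (auto simp: mone_def fun_eq_iff zero_fun_apply)
    then have "b i = 0" using mone_left[OF decompD(2)[OF dec i]] by simp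
    then show ?thesis using mcomp_zero_right[OF decompD(1)[OF dec i]] factor_ideal.zero by simp
  qed
  then have "mone ?C ?M \<in> factor_ideal ?C (interval_module d ` J) ?M ?M"
    unfolding decomp_sum[OF dec, symmetric] by (intro factor_ideal_sum) simp
  moreover have "?M \<in> fd_nakayama l d" by (rule dsum_nakayama[OF l d]) (use x J in blast)
  ultimately show ?thesis unfolding add_intervals_eq[OF l d J] retracts_def by blast
qed

section \<open>Staircases\<close>

text \<open>
  The \<open>k\<close>-th term of the \<open>d\<close>-exact sequence that starts at \<open>s\<close> and continues with \<open>s\<close> with its last entry
  raised to \<open>p\<close>. From one term to the next a single entry changes, at the place \<open>d - k\<close>, and the place
  moves from right to left.
\<close>

definition stair :: "nat \<Rightarrow> int list \<Rightarrow> int \<Rightarrow> nat \<Rightarrow> int list" where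
  "stair d s p k = map (\<lambda>i. if i + k \<le> d then s ! i else if i < d then s ! Suc i + 1 else p) [0..<Suc d]"

text \<open>
  Weaker than \<open>s\<close> being sorted: an entry may fall one below its left neighbour. If this happens at the last
  entry, then the terms one and two of the staircase coincide and the others have empty support.
\<close>

definition stair_data :: "nat \<Rightarrow> int list \<Rightarrow> int \<Rightarrow> bool" where
  "stair_data d s p \<longleftrightarrow> length s = Suc d \<and> (\<forall>i<d. s ! i \<le> s ! Suc i + 1) \<and> s ! d \<le> p"

lemma stair_length [simp]: "length (stair d s p k) = Suc d"
  by (simp add: stair_def)

lemma stair_nth: "i \<le> d \<Longrightarrow> stair d s p k ! i =
    (if i + k \<le> d then s ! i else if i < d then s ! Suc i + 1 else p)"
  unfolding stair_def by (simp del: upt_Suc)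

lemma stair_0: "length s = Suc d \<Longrightarrow> stair d s p 0 = s"
  by (intro nth_equalityI) (simp_all add: stair_nth)

lemma stair_1: "length s = Suc d \<Longrightarrow> stair d s p (Suc 0) = s[d := p]"
  by (intro nth_equalityI) (auto simp: stair_nth nth_list_update)

lemma stair_up: "k \<le> d \<Longrightarrow> stair d s p (Suc k) =
    (stair d s p k)[d - k := (if k = 0 then p else s ! Suc (d - k) + 1)]"
  by (intro nth_equalityI) (auto simp: stair_nth nth_list_update)

lemma stair_down: "k \<le> d \<Longrightarrow> stair d s p k = (stair d s p (Suc k))[d - k := s ! (d - k)]"
  by (intro nth_equalityI) (auto simp: stair_nth nth_list_update)

lemma interlaced_update_right:
  assumes "interlaced d u x" "j \<le> d"
  shows "interlaced d u (x[j := c]) \<longleftrightarrow> u ! j \<le> c \<and> (j < d \<longrightarrow> c \<le> u ! Suc j)"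
proof -
  have len: "length x = Suc d" using assms unfolding interlaced_iff by blast
  have "x[j := c] ! i = (if i = j then c else x ! i)" if "i \<le> d" for i using that len assms(2) by simp
  then show ?thesis using assms len unfolding interlaced_iff by (auto split: if_splits)
qed

lemma interlaced_update_left:
  assumes "interlaced d x u" "j \<le> d"
  shows "interlaced d (x[j := c]) u \<longleftrightarrow> c \<le> u ! j \<and> (0 < j \<longrightarrow> u ! (j - 1) \<le> c)"
proof -
  have len: "length x = Suc d" using assms unfolding interlaced_iff by blast
  have *: "x[j := c] ! i = (if i = j then c else x ! i)" if "i \<le> d" for i using that len assms(2) by simp
  show ?thesis
  proof
    assume "interlaced d (x[j := c]) u"
    then have 1: "\<forall>i\<le>d. x[j := c] ! i \<le> u ! i" and 2: "\<forall>i<d. u ! i \<le> x[j := c] ! Suc i"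
      unfolding interlaced_iff by blast+
    have "u ! (j - 1) \<le> c" if "0 < j"
    proof -
      have "j - 1 < d" "Suc (j - 1) = j" using that assms(2) by auto
      then show ?thesis using 2 *[OF assms(2)] by metis
    qed
    then show "c \<le> u ! j \<and> (0 < j \<longrightarrow> u ! (j - 1) \<le> c)" using 1 *[OF assms(2)] assms(2) by auto
  next
    assume c: "c \<le> u ! j \<and> (0 < j \<longrightarrow> u ! (j - 1) \<le> c)"
    have "u ! i \<le> x[j := c] ! Suc i" if "i < d" for i
      using assms c *[of "Suc i"] that unfolding interlaced_iff by (cases "Suc i = j") auto
    moreover have "x[j := c] ! i \<le> u ! i" if "i \<le> d" for i
      using assms c *[of i] that unfolding interlaced_iff by (cases "i = j") auto
    ultimately show "interlaced d (x[j := c]) u" using assms len unfolding interlaced_iff by simp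
  qed
qed

lemma stair_step:
  assumes S: "stair_data d s p" and k: "k \<le> d"
    and 1: "interlaced d (stair d s p k) (stair d s p k)"
    and 2: "interlaced d (stair d s p (Suc k)) (stair d s p (Suc k))"
  shows "interlaced d (stair d s p k) (stair d s p (Suc k))"
proof -
  let ?c = "if k = 0 then p else s ! Suc (d - k) + 1"
  have "stair d s p k ! (d - k) \<le> ?c"
    using S k unfolding stair_data_def by (auto simp: stair_nth)
  moreover have "?c \<le> stair d s p k ! Suc (d - k)" if "d - k < d"
  proof -
    have "stair d s p (Suc k) ! (d - k) \<le> stair d s p (Suc k) ! Suc (d - k)"
      using 2 that unfolding interlaced_iff by blast
    then show ?thesis using that by (simp add: stair_nth split: if_splits)
  qed
  ultimately show ?thesis unfolding stair_up[OF k] interlaced_update_right[OF 1 diff_le_self] by blast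
qed

text \<open>
  The neighbours of a term differ from it in one entry each, at the adjacent places \<open>j\<close> and \<open>j - 1\<close>. All
  interlacing conditions at these places hold automatically except for a bound on \<open>u ! j\<close>: at most \<open>s ! j\<close>
  for one neighbour, at least \<open>s ! j + 1\<close> for the other.
\<close>

lemma stair_row:
  assumes S: "stair_data d s p" and k: "k < d" and u: "interlaced d u (stair d s p (Suc k))"
  shows "interlaced d u (stair d s p k) \<longleftrightarrow> \<not> interlaced d u (stair d s p (Suc (Suc k)))"
proof -
  define j where "j = d - k"
  have j: "0 < j" "j \<le> d" "d - Suc k = j - 1" "Suc (j - 1) = j" using k by (auto simp: j_def)
  have "j < d \<Longrightarrow> stair d s p (Suc k) ! j \<le> u ! Suc j" "u ! (j - 1) \<le> stair d s p (Suc k) ! (j - 1)"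
    using u j unfolding interlaced_iff by auto
  moreover have "j < d \<Longrightarrow> stair d s p (Suc k) ! j = s ! Suc j + 1" "stair d s p (Suc k) ! (j - 1) = s ! (j - 1)"
    using j k by (auto simp: stair_nth j_def)
  moreover have "j < d \<Longrightarrow> s ! j \<le> s ! Suc j + 1" "s ! (j - 1) \<le> s ! j + 1"
    using S j unfolding stair_data_def by (blast, metis Suc_le_lessD)
  ultimately have "j < d \<Longrightarrow> s ! j \<le> u ! Suc j" "u ! (j - 1) \<le> s ! j + 1" by linarith+
  then have "interlaced d u (stair d s p k) \<longleftrightarrow> u ! j \<le> s ! j"
    "interlaced d u (stair d s p (Suc (Suc k))) \<longleftrightarrow> s ! j + 1 \<le> u ! j"
    using stair_down[of k d s p] stair_up[of "Suc k" d s p] interlaced_update_right[OF u] j k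
    by (auto simp: j_def[symmetric])
  then show ?thesis by auto
qed

lemma stair_row_start:
  assumes S: "stair_data d s p" and u: "interlaced d u (stair d s p 0)"
  shows "interlaced d u (stair d s p (Suc 0))"
proof -
  have "u ! d \<le> s ! d" using u unfolding interlaced_iff by (simp add: stair_nth)
  then show ?thesis
    using S unfolding stair_up[of 0 d s p, OF le0] stair_data_def
    by (simp add: interlaced_update_right[OF u])
qed

text \<open>
  Here the two neighbours are distinguished by the bounds \<open>s ! j\<close> and \<open>s ! j + 1\<close> on \<open>u ! (j - 1)\<close>.
\<close>

lemma stair_col:
  assumes S: "stair_data d s p" and k: "k < d" and u: "interlaced d (stair d s p (Suc k)) u"
  shows "interlaced d (stair d s p (Suc (Suc k))) u \<longleftrightarrow> \<not> interlaced d (stair d s p k) u"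
proof -
  define j where "j = d - k"
  have j: "0 < j" "j \<le> d" "d - Suc k = j - 1" "Suc (j - 1) = j" using k by (auto simp: j_def)
  have a: "stair d s p (Suc k) ! j \<le> u ! j" using u j unfolding interlaced_iff by blast
  have b: "0 < j - 1 \<Longrightarrow> u ! (j - 1 - 1) \<le> stair d s p (Suc k) ! (j - 1)"
  proof -
    assume "0 < j - 1"
    then have "j - 1 - 1 < d" "Suc (j - 1 - 1) = j - 1" using j by auto
    then show "u ! (j - 1 - 1) \<le> stair d s p (Suc k) ! (j - 1)" using u unfolding interlaced_iff by metis
  qed
  have c: "stair d s p (Suc k) ! j = (if j < d then s ! Suc j + 1 else p)" "stair d s p (Suc k) ! (j - 1) = s ! (j - 1)"
    using j k by (auto simp: stair_nth j_def)
  have e: "j < d \<Longrightarrow> s ! j \<le> s ! Suc j + 1" "s ! (j - 1) \<le> s ! j + 1" "s ! d \<le> p"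
    using S j unfolding stair_data_def by (blast, metis Suc_le_lessD, blast)
  have f: "s ! j \<le> u ! j" using a c(1) e j by (cases "j < d") auto
  have g: "0 < j - 1 \<Longrightarrow> u ! (j - 1 - 1) \<le> s ! j + 1" using b c(2) e(2) by linarith
  have "interlaced d (stair d s p k) u \<longleftrightarrow> u ! (j - 1) \<le> s ! j"
    using stair_down[of k d s p] interlaced_update_left[OF u j(2)] j k f by (simp add: j_def[symmetric])
  moreover have "interlaced d (stair d s p (Suc (Suc k))) u \<longleftrightarrow> s ! j + 1 \<le> u ! (j - 1)"
    using stair_up[of "Suc k" d s p] interlaced_update_left[OF u, of "j - 1"] j k g by simp
  ultimately show ?thesis by auto
qed

lemma stair_col_start:
  assumes S: "stair_data d s p" and d: "d \<ge> 1" and u: "interlaced d (stair d s p (Suc d)) u"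
  shows "interlaced d (stair d s p d) u"
proof -
  have "s ! Suc 0 + 1 \<le> u ! 0" using u d unfolding interlaced_iff by (auto simp: stair_nth)
  moreover have "s ! 0 \<le> s ! Suc 0 + 1" using S d unfolding stair_data_def by auto
  ultimately show ?thesis
    using stair_down[of d d s p] interlaced_update_left[OF u, of 0 "s ! 0"] by simp
qed

section \<open>Staircase sequences\<close>

definition torsion_exact :: "('o, 'm, 'k::field) lincat \<Rightarrow> nat \<Rightarrow> ('o, 'm, 'k) rmod \<Rightarrow>
    (nat \<Rightarrow> ('o, 'm, 'k) rmod) \<Rightarrow> (nat \<Rightarrow> 'o \<Rightarrow> 'k kvec \<Rightarrow> 'k kvec) \<Rightarrow> bool" where
  "torsion_exact C d U X f \<longleftrightarrow>
    exact_at id {0} (\<lambda>h. f 2 \<odot> h) (mhom C U (X 2)) \<and>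
    (\<forall>i\<in>{3..d}. exact_at (\<lambda>h. f (i - 1) \<odot> h) (mhom C U (X (i - 1)))
                         (\<lambda>h. f i \<odot> h) (mhom C U (X i))) \<and>
    exact_at (\<lambda>h. f d \<odot> h) (mhom C U (X d)) (\<lambda>_. 0 :: nat) (mhom C U (X (d + 1)))"

lemma d_torsion_class_alt:
  "d_torsion_class C d \<M> \<U> \<longleftrightarrow> subcategory C \<M> \<U> \<and>
    (\<forall>M\<in>\<M>. \<exists>X f. d_exact C d \<M> X f \<and> X 0 \<in> \<U> \<and> X 1 = M \<and> (\<forall>U\<in>\<U>. torsion_exact C d U X f))"
  unfolding d_torsion_class_def torsion_exact_def ..

lemma add_intervals_nakayama:
  assumes "kupisch_series l" "d \<ge> 1" "J \<subseteq> os_kup l (Suc d)" "M \<in> add_intervals l d J"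
  shows "M \<in> fd_nakayama l d" "right_module (mesh_cat d) M"
    "mone (mesh_cat d) M \<in> factor_ideal (mesh_cat d) (interval_module d ` J) M M"
  using assms(4) fd_nakayama_right_module unfolding add_intervals_eq[OF assms(1-3)] retracts_def by blast+

lemma M_kup_eq: "M_kup l d = add_intervals l d (os_kup l (Suc d))"
  by (simp add: M_kup_def)

lemma add_intervals_subset_M_kup:
  assumes "kupisch_series l" "d \<ge> 1" "J \<subseteq> os_kup l (Suc d)"
  shows "add_intervals l d J \<subseteq> M_kup l d"
  unfolding M_kup_eq add_intervals_eq[OF assms] add_intervals_eq[OF assms(1,2) subset_refl] retracts_def
  using factor_ideal_mono[OF image_mono[OF assms(3)]] by blast

lemma interval_add_intervals:
  assumes l: "kupisch_series l" and d: "d \<ge> 1" and J: "J \<subseteq> os_kup l (Suc d)" and x: "x \<in> J"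
  shows "(interval_module d x :: (int list, 'k::field set, 'k) rmod) \<in> add_intervals l d J"
proof -
  let ?I = "interval_module d x :: (int list, 'k set, 'k) rmod"
  have m: "mone (mesh_cat d) ?I \<in> mhom (mesh_cat d) ?I ?I" by (rule mone_mhom[OF interval_right_module])
  have "mone (mesh_cat d) ?I \<odot> mone (mesh_cat d) ?I \<in> factor_ideal (mesh_cat d) (interval_module d ` J) ?I ?I"
    by (rule factor_ideal.comp[OF _ m m]) (use x in blast)
  then show ?thesis
    unfolding add_intervals_eq[OF l d J] retracts_def mone_left[OF m]
    using interval_nakayama[OF l d] x J by blast
qed

lemma subcategory_add_intervals:
  assumes "kupisch_series l" "d \<ge> 1" "J \<subseteq> os_kup l (Suc d)"
  shows "subcategory (mesh_cat d) (M_kup l d) (add_intervals l d J)"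
proof (rule subcategory_subset)
  show "subcategory (mesh_cat d) (fd_nakayama l d) (add_intervals l d J)"
    unfolding add_intervals_eq[OF assms] by (rule subcategory_retracts[OF fd_nakayama_right_module])
  show "add_intervals l d J \<subseteq> M_kup l d" by (rule add_intervals_subset_M_kup[OF assms])
  show "M_kup l d \<subseteq> fd_nakayama l d"
    unfolding M_kup_eq using add_intervals_nakayama(1)[OF assms(1,2) subset_refl] by blast
qed

lemma interlaced_sorted:
  assumes "interlaced d x y"
  shows "interlaced d x x" "interlaced d y y"
proof -
  have len: "length x = Suc d" "length y = Suc d" and le: "\<And>i. i \<le> d \<Longrightarrow> x ! i \<le> y ! i"
    and ge: "\<And>i. i < d \<Longrightarrow> y ! i \<le> x ! Suc i" using assms unfolding interlaced_iff by blast+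
  have "x ! i \<le> x ! Suc i" if "i < d" for i using order_trans[OF le[of i] ge[OF that]] that by simp
  moreover have "y ! i \<le> y ! Suc i" if "i < d" for i using order_trans[OF ge[OF that] le[of "Suc i"]] that by simp
  ultimately show "interlaced d x x" "interlaced d y y" using len unfolding interlaced_iff by simp_all
qed

text \<open>
  The two conditions on \<open>u\<close> under which the sequence of morphisms from \<open>u\<close> to the terms \<open>2, \<dots>, d + 1\<close> of a
  staircase is exact at its two ends. In between, exactness always holds.
\<close>

definition exact_ends :: "nat \<Rightarrow> int list \<Rightarrow> int \<Rightarrow> int list \<Rightarrow> bool" where
  "exact_ends d s p u \<longleftrightarrow>
    (interlaced d u (stair d s p 2) \<longrightarrow> \<not> interlaced d u (stair d s p 1)) \<and>
    (interlaced d u (stair d s p (Suc d)) \<longrightarrow> interlaced d u (stair d s p d))"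

text \<open>
  The sequence of a direct sum of staircases, for any choice of objects that realise the direct sums.
  The freedom in the choice matters: the first term will be a prescribed object.
\<close>

lemma stair_d_exact:
  fixes X :: "nat \<Rightarrow> (int list, 'k::field set, 'k) rmod"
  assumes l: "kupisch_series l" and d: "d \<ge> 2"
    and S: "\<And>i. i < n \<Longrightarrow> stair_data d (s i) (p i)"
    and X: "\<And>k. k \<le> Suc d \<Longrightarrow> X k \<in> M_kup l d"
    and dec: "\<And>k. k \<le> Suc d \<Longrightarrow>
      decomp (mesh_cat d) n (X k) (\<lambda>i. interval_module d (stair d (s i) (p i) k)) (a k) (b k)"
  shows "\<exists>f. d_exact (mesh_cat d) d (M_kup l d) X f \<and>
    (\<forall>I U. I \<subseteq> os_kup l (Suc d) \<longrightarrow> U \<in> add_intervals l d I \<longrightarrow>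
      (\<forall>u\<in>I. \<forall>i<n. exact_ends d (s i) (p i) u) \<longrightarrow> torsion_exact (mesh_cat d) d U X f)"
proof -
  let ?C = "mesh_cat d :: (int list, 'k set, 'k) lincat"
  let ?O = "os_kup l (Suc d)"
  have d1: "d \<ge> 1" using d by simp
  note M = add_intervals_nakayama[OF l d1 subset_refl, folded M_kup_eq]
  interpret thin_family ?C "tuples (Suc d)" "interval_module d" "interlaced d" "eps d" "\<lambda>x. \<Sum>i\<le>d. x ! i"
    by (rule thin_intervals[OF d1])
  interpret diag_sequence ?C "tuples (Suc d)" "interval_module d" "interlaced d" "eps d" "\<lambda>x. \<Sum>i\<le>d. x ! i"
    d n "M_kup l d" ?O X "\<lambda>k i. stair d (s i) (p i) k" a b
  proof
    show "interlaced d (stair d (s i) (p i) k) (stair d (s i) (p i) (Suc k))"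
      if "k \<le> d" "i < n" "interlaced d (stair d (s i) (p i) k) (stair d (s i) (p i) k)"
        "interlaced d (stair d (s i) (p i) (Suc k)) (stair d (s i) (p i) (Suc k))" for k i
      by (rule stair_step[OF S[OF that(2)] that(1,3,4)])
    show "interlaced d x x \<and> interlaced d y y" if "interlaced d x y" for x y
      using interlaced_sorted[OF that] by blast
    show "?O \<subseteq> tuples (Suc d)" by (rule os_kup_tuples[OF subset_refl])
  qed (use X dec M(2,3) in auto)
  have ker: "d_kernel ?C d (M_kup l d) X f"
    using stair_row_start[OF S] stair_row[OF S] by (intro d_kernelI) auto
  have coker: "d_cokernel ?C d (M_kup l d) X f"
    using stair_col_start[OF S d1] stair_col[OF S] by (intro d_cokernelI) auto
  have tor: "torsion_exact ?C d U X f"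
    if I: "I \<subseteq> ?O" and U: "U \<in> add_intervals l d I"
      and 1: "\<And>u i. u \<in> I \<Longrightarrow> i < n \<Longrightarrow> interlaced d u (stair d (s i) (p i) 2) \<Longrightarrow> \<not> interlaced d u (stair d (s i) (p i) 1)"
      and 2: "\<And>u i. u \<in> I \<Longrightarrow> i < n \<Longrightarrow> interlaced d u (stair d (s i) (p i) (Suc d)) \<Longrightarrow> interlaced d u (stair d (s i) (p i) d)"
    for I U
  proof -
    note Um = add_intervals_nakayama(2,3)[OF l d1 I U] and IV = os_kup_tuples[OF I]
    have "exact_at id {0} (\<lambda>h. f 2 \<odot> h) (mhom ?C U (X 2))"
    proof (rule exact_start[OF d IV Um])
      fix u i assume u: "u \<in> I" "i < n" "interlaced d u (stair d (s i) (p i) 2)"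
      then show "interlaced d u (stair d (s i) (p i) (Suc 2))"
        using stair_row[OF S[OF u(2)], of 1 u] d 1[OF u] by (simp add: numeral_2_eq_2)
    qed
    moreover have "exact_at (\<lambda>h. f (i - 1) \<odot> h) (mhom ?C U (X (i - 1))) (\<lambda>h. f i \<odot> h) (mhom ?C U (X i))"
      if "i \<in> {3..d}" for i
    proof -
      obtain k where k: "i = Suc k" "k < d" using \<open>i \<in> {3..d}\<close> by (cases i) auto
      show ?thesis using exact_mid[OF k(2) IV Um stair_row[OF S k(2)]] by (simp add: k(1))
    qed
    moreover have "exact_at (\<lambda>h. f d \<odot> h) (mhom ?C U (X d)) (\<lambda>_. 0 :: nat) (mhom ?C U (X (d + 1)))"
      unfolding Suc_eq_plus1[symmetric] by (rule exact_end[OF order_refl IV Um 2])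
    ultimately show ?thesis unfolding torsion_exact_def by blast
  qed
  show ?thesis
  proof (intro exI[of _ f] conjI allI impI)
    show "d_exact ?C d (M_kup l d) X f" by (simp add: d_exact_def ker coker)
  next
    fix I and U :: "(int list, 'k set, 'k) rmod"
    assume I: "I \<subseteq> os_kup l (Suc d)" and U: "U \<in> add_intervals l d I"
      and c: "\<forall>u\<in>I. \<forall>i<n. exact_ends d (s i) (p i) u"
    show "torsion_exact ?C d U X f" by (rule tor[OF I U]) (use c in \<open>unfold exact_ends_def, blast\<close>)+
  qed
qed

section \<open>From the closure conditions to a torsion class\<close>

definition closed_family :: "(int \<Rightarrow> enat) \<Rightarrow> nat \<Rightarrow> int list set \<Rightarrow> bool" where
  "closed_family l d I \<longleftrightarrow>
    (\<forall>x\<in>os_kup l (Suc d). \<forall>z\<in>os_kup l (Suc d).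
       (prod_le x z \<and> x ! d = z ! d \<longrightarrow> x \<in> I \<longrightarrow> z \<in> I) \<and>
       (interlaced d x (tau z) \<and> x \<in> I \<and> z \<in> I \<longrightarrow>
          (\<forall>y\<in>os_kup l (Suc d). (\<forall>i\<le>d. y ! i \<in> {x ! i, z ! i}) \<longrightarrow> y \<in> I)))"

lemma closed_family_upward:
  assumes "closed_family l d I" "I \<subseteq> os_kup l (Suc d)" "x \<in> I" "z \<in> os_kup l (Suc d)" "prod_le x z" "x ! d = z ! d"
  shows "z \<in> I"
  using assms(1)[unfolded closed_family_def, THEN bspec, OF subsetD[OF assms(2,3)], THEN bspec, OF assms(4)] assms(3-)
  by blast

lemma closed_family_mixed:
  assumes "closed_family l d I" "I \<subseteq> os_kup l (Suc d)" "x \<in> I" "z \<in> I" "interlaced d x (tau z)"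
    and "y \<in> os_kup l (Suc d)" "\<forall>i\<le>d. y ! i \<in> {x ! i, z ! i}"
  shows "y \<in> I"
  using assms(1)[unfolded closed_family_def, THEN bspec, OF subsetD[OF assms(2,3)], THEN bspec,
      OF subsetD[OF assms(2,4)]] assms(3-)
  by blast

lemma interlaced_tau_iff:
  "interlaced d x (tau z) \<longleftrightarrow> length x = Suc d \<and> length z = Suc d \<and>
    (\<forall>i\<le>d. x ! i \<le> z ! i - 1) \<and> (\<forall>i<d. z ! i - 1 \<le> x ! Suc i)"
  unfolding interlaced_iff by (auto simp: tau_def)

lemma os_kup_nth:
  assumes "x \<in> os_kup l (Suc d)"
  shows "length x = Suc d" "i < d \<Longrightarrow> x ! i \<le> x ! Suc i" "interlaced d x x"
  using assms sorted_interlaced[of x d] unfolding os_kup_iff sorted_nth_Suc by auto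

text \<open>
  The torsion part \<open>s\<close> of a single interval \<open>x\<close>. It is unsorted, hence zero, if no element of \<open>I\<close> maps to \<open>x\<close>;
  otherwise the last entry of \<open>s\<close> is the largest last entry of such an element.
\<close>

lemma torsion_stair_exists:
  assumes l: "kupisch_series l" and d: "d \<ge> 2" and I: "I \<subseteq> os_kup l (Suc d)" and cl: "closed_family l d I"
    and x: "x \<in> os_kup l (Suc d)"
  shows "\<exists>s. stair_data d s (x ! d) \<and> s[d := x ! d] = x \<and> (s \<in> I \<or> \<not> sorted s) \<and> x ! 0 \<le> s ! 0 \<and>
    (\<forall>u\<in>I. exact_ends d s (x ! d) u)"
proof -
  note xl = os_kup_nth(1)[OF x] and xs = os_kup_nth(2)[OF x]
  have d1: "d - 1 < d" "Suc (d - 1) = d" "0 < d" using d by auto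
  define st where "st t = x[d := t]" for t
  have st_nth: "st t ! i = (if i = d then t else x ! i)" if "i \<le> d" for t i using xl that by (simp add: st_def)
  have st_len: "length (st t) = Suc d" for t using xl by (simp add: st_def)
  have data: "stair_data d (st t) (x ! d)" if "x ! (d - 1) \<le> t + 1" "t \<le> x ! d" for t
    unfolding stair_data_def
  proof (intro conjI allI impI st_len)
    fix i assume "i < d"
    then show "st t ! i \<le> st t ! Suc i + 1"
      using xs[of i] that(1) d1 by (cases "Suc i = d") (auto simp: st_nth)
  qed (use that in \<open>simp add: st_nth\<close>)
  have st_x: "(st t)[d := x ! d] = x" for t using xl by (simp add: st_def)
  have st1: "stair d (st t) (x ! d) 1 = x" for t using stair_1[OF st_len, of t "x ! d"] st_x by simp
  have st0: "x ! 0 \<le> st t ! 0" for t using d1 by (simp add: st_nth)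
  show ?thesis
  proof (cases "\<exists>u\<in>I. interlaced d u x")
    case False
    \<comment> \<open>The largest last entry for which \<open>s\<close> is unsorted; then the terms one and two are \<open>x\<close> and the others zero.\<close>
    define t where "t = x ! (d - 1) - 1"
    have "\<not> interlaced d u (stair d (st t) (x ! d) (Suc d))" for u
    proof
      assume u: "interlaced d u (stair d (st t) (x ! d) (Suc d))"
      define j where "j = d - 2"
      have j: "j < d" "Suc j = d - 1" "Suc j < d" "Suc (Suc j) = d" using d by (auto simp: j_def)
      have "stair d (st t) (x ! d) (Suc d) ! j \<le> u ! Suc j" "u ! Suc j \<le> stair d (st t) (x ! d) (Suc d) ! Suc j"
        using u j(1,3) unfolding interlaced_iff by simp_all
      moreover have "stair d (st t) (x ! d) (Suc d) ! j = x ! Suc j + 1"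
        using j(1,3) by (simp add: stair_nth st_nth)
      moreover have "stair d (st t) (x ! d) (Suc d) ! Suc j = t + 1"
        using j(3,4) by (simp add: stair_nth st_nth)
      moreover have "t = x ! Suc j - 1" unfolding t_def j(2) ..
      ultimately show False by linarith
    qed
    moreover have "\<not> interlaced d u (stair d (st t) (x ! d) 1)" if "u \<in> I" for u using False that st1 by simp
    moreover have "\<not> sorted (st t)"
    proof
      assume "sorted (st t)"
      moreover have "Suc (d - 1) < length (st t)" using st_len d1(2) by simp
      ultimately have "st t ! (d - 1) \<le> st t ! Suc (d - 1)" unfolding sorted_nth_Suc by blast
      moreover have "d - 1 \<noteq> d" "d - 1 \<le> d" using d1(1) by linarith+
      ultimately show False unfolding d1(2) st_nth[OF order_refl] using st_nth[of "d - 1" t] by (simp add: t_def)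
    qed
    moreover have "stair_data d (st t) (x ! d)" using data[of t] xs[OF d1(1)] d1(2) by (simp add: t_def)
    ultimately show ?thesis using st_x st0 unfolding exact_ends_def by blast
  next
    case True
    obtain u0 where u0: "u0 \<in> I" "interlaced d u0 x"
      and max: "\<And>u. u \<in> I \<Longrightarrow> interlaced d u x \<Longrightarrow> u ! d \<le> u0 ! d"
    proof -
      obtain v where v: "v \<in> I" "interlaced d v x"
        and m: "\<And>u. u \<in> I \<and> interlaced d u x \<Longrightarrow> nat (x ! d - v ! d) \<le> nat (x ! d - u ! d)"
        using ex_has_least_nat[of "\<lambda>u. u \<in> I \<and> interlaced d u x" _ "\<lambda>u. nat (x ! d - u ! d)"] True by metis
      have "u ! d \<le> v ! d" if "u \<in> I" "interlaced d u x" for u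
        using m[of u] that v(2) unfolding interlaced_iff by (simp add: nat_le_eq_zle)
      then show ?thesis using that v by blast
    qed
    define t where "t = u0 ! d"
    have u0O: "u0 \<in> os_kup l (Suc d)" using u0 I by blast
    have tx: "t \<le> x ! d" using u0(2) unfolding t_def interlaced_iff by blast
    have xt: "x ! (d - 1) \<le> t" using u0(2) d1 unfolding t_def interlaced_iff by metis
    have srt: "interlaced d (st c) (st c)" if "x ! (d - 1) \<le> c" for c
      unfolding interlaced_iff
    proof (intro conjI allI impI st_len)
      fix i assume "i < d"
      then show "st c ! i \<le> st c ! Suc i" using xs[of i] that d1 by (cases "Suc i = d") (auto simp: st_nth)
    qed simp
    have stO: "st c \<in> os_kup l (Suc d)" if "x ! (d - 1) \<le> c" "c \<le> x ! d" for c
      by (rule os_kupI[OF l x srt[OF that(1)]]) (use that(2) st0 in \<open>simp_all add: st_nth\<close>)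
    have le: "prod_le u0 (st t)"
    proof -
      have "u0 ! i \<le> st t ! i" if "i \<le> d" for i
        using that u0(2) by (simp add: st_nth t_def interlaced_iff)
      then show ?thesis using os_kup_nth(1)[OF u0O] st_len by (simp add: prod_le_nth less_Suc_eq_le)
    qed
    have sI: "st t \<in> I"
      by (rule closed_family_upward[OF cl I u0(1) stO[OF xt tx] le]) (simp add: st_nth t_def)
    have c2: "\<not> interlaced d u (stair d (st t) (x ! d) 1)" if u: "u \<in> I" "interlaced d u (stair d (st t) (x ! d) 2)" for u
    proof
      assume "interlaced d u (stair d (st t) (x ! d) 1)"
      then have "u ! d \<le> t" using max[OF u(1)] unfolding st1 t_def by blast
      moreover have "stair d (st t) (x ! d) 2 ! (d - 1) \<le> u ! Suc (d - 1)"
        using u(2) d1(1) unfolding interlaced_iff by blast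
      then have "t + 1 \<le> u ! d" using d1 d by (simp add: stair_nth st_nth)
      ultimately show False by simp
    qed
    have cd: "interlaced d u (stair d (st t) (x ! d) d)"
      if u: "u \<in> I" "interlaced d u (stair d (st t) (x ! d) (Suc d))" for u
    proof (rule ccontr)
      let ?v = "stair d (st t) (x ! d) (Suc d)"
      \<comment> \<open>The last two terms differ only in entry \<open>0\<close>, so \<open>u\<close> has its first entry above that of \<open>s\<close>. Together
        with the interlacing this says \<open>s \<leadsto> \<tau>(u)\<close>, and the second closure property applies.\<close>
      assume n: "\<not> interlaced d u (stair d (st t) (x ! d) d)"
      have uO: "u \<in> os_kup l (Suc d)" using u(1) I by blast
      have v: "?v ! i = st t ! Suc i + 1" if "i < d" for i using that by (simp add: stair_nth)
      have u_le: "u ! i \<le> st t ! Suc i + 1" "st t ! Suc i + 1 \<le> u ! Suc i" if "i < d" for i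
        using u(2) v[OF that] that unfolding interlaced_iff by (metis less_imp_le)+
      have "x ! 0 \<le> x ! Suc 0" using xs d1(3) by blast
      then have "st t ! 0 \<le> st t ! Suc 0 + 1" using data[of t] tx xt d1(3) unfolding stair_data_def by auto
      then have s0: "st t ! 0 < u ! 0"
        using n stair_down[of d d "st t" "x ! d"] interlaced_update_right[OF u(2), of 0 "st t ! 0"] u_le(2)[OF d1(3)] d1(3)
        by auto
      have tau: "interlaced d (st t) (tau u)"
        unfolding interlaced_tau_iff
      proof (intro conjI allI impI st_len)
        show "length u = Suc d" by (rule os_kup_nth(1)[OF uO])
        fix i
        show "u ! i - 1 \<le> st t ! Suc i" if "i < d" using u_le(1)[OF that] by simp
        show "st t ! i \<le> u ! i - 1" if "i \<le> d"
        proof (cases i)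
          case (Suc j)
          then show ?thesis using u_le(2)[of j] that by simp
        qed (use s0 in simp)
      qed
      have "st t ! d \<le> u ! d - 1" using tau unfolding interlaced_tau_iff by blast
      then have ud: "t + 1 \<le> u ! d" by (simp add: st_nth)
      have "u ! d \<le> ?v ! d" using u(2) unfolding interlaced_iff by blast
      then have ux: "u ! d \<le> x ! d" by (simp add: stair_nth)
      have wO: "st (u ! d) \<in> os_kup l (Suc d)" by (rule stO) (use xt ud ux in linarith)+
      have "\<forall>i\<le>d. st (u ! d) ! i \<in> {st t ! i, u ! i}" by (simp add: st_nth)
      then have "st (u ! d) \<in> I"
        by (rule closed_family_mixed[OF cl I sI u(1) tau wO])
      moreover have "interlaced d (st (u ! d)) x"
        using interlaced_update_left[OF os_kup_nth(3)[OF x] order_refl, of "u ! d"] ux xt ud d1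
        unfolding st_def by simp
      ultimately have "st (u ! d) ! d \<le> t" using max unfolding t_def by blast
      then show False using ud by (simp add: st_nth)
    qed
    have "stair_data d (st t) (x ! d)" using data[of t] xt tx by simp
    then show ?thesis using sI st_x st0 c2 cd unfolding exact_ends_def by blast
  qed
qed

text \<open>
  The torsion sequence of a direct sum is the sum of the staircase sequences of its summands.
\<close>

lemma closed_family_torsion:
  assumes l: "kupisch_series l" and d: "d \<ge> 2" and I: "I \<subseteq> os_kup l (Suc d)" and cl: "closed_family l d I"
  shows "d_torsion_class (mesh_cat d :: (int list, 'k::field set, 'k) lincat) d (M_kup l d) (add_intervals l d I)"
  unfolding d_torsion_class_alt
proof (intro conjI ballI)
  let ?C = "mesh_cat d :: (int list, 'k set, 'k) lincat"
  have d1: "d \<ge> 1" using d by simp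
  interpret thin_family ?C "tuples (Suc d)" "interval_module d" "interlaced d" "eps d" "\<lambda>x. \<Sum>i\<le>d. x ! i"
    by (rule thin_intervals[OF d1])
  show "subcategory ?C (M_kup l d) (add_intervals l d I)" by (rule subcategory_add_intervals[OF l d1 I])
  fix M :: "(int list, 'k set, 'k) rmod" assume M: "M \<in> M_kup l d"
  note Mp = add_intervals_nakayama[OF l d1 subset_refl M[unfolded M_kup_eq]]
  obtain xs a1 b1 where xs: "set xs \<subseteq> os_kup l (Suc d)"
    and dec1: "decomp ?C (length xs) M (\<lambda>i. interval_module d (xs ! i)) a1 b1"
    using retract_decomp[OF Mp(2) os_kup_tuples[OF subset_refl] Mp(3)] by blast
  define n where "n = length xs"
  define p where "p i = xs ! i ! d" for i
  have xi: "xs ! i \<in> os_kup l (Suc d)" if "i < n" for i using xs that nth_mem unfolding n_def by blast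
  define Q where "Q i s \<longleftrightarrow> stair_data d s (p i) \<and> s[d := p i] = xs ! i \<and> (s \<in> I \<or> \<not> sorted s) \<and> xs ! i ! 0 \<le> s ! 0 \<and>
    (\<forall>u\<in>I. exact_ends d s (p i) u)" for i s
  have "\<forall>i. \<exists>s. i < n \<longrightarrow> Q i s"
    using torsion_stair_exists[OF l d I cl xi] unfolding p_def Q_def by blast
  then obtain s where s: "\<And>i. i < n \<Longrightarrow> Q i (s i)" by metis
  have S: "stair_data d (s i) (p i)" and sx: "(s i)[d := p i] = xs ! i" and sI: "s i \<in> I \<or> \<not> sorted (s i)"
    and s0: "xs ! i ! 0 \<le> s i ! 0"
    and tor: "\<And>u. u \<in> I \<Longrightarrow> exact_ends d (s i) (p i) u" if "i < n" for i using s[OF that] unfolding Q_def by blast+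
  have sl: "length (s i) = Suc d" if "i < n" for i using S[OF that] unfolding stair_data_def by blast
  let ?e = "\<lambda>k i. stair d (s i) (p i) k"
  define X where "X k = (if k = 1 then M else dsum_module d n (?e k))" for k
  have e1: "?e 1 i = xs ! i" if "i < n" for i using stair_1[OF sl[OF that]] sx[OF that] by simp
  have e0: "?e 0 i \<in> I \<or> msupp d (?e 0 i) = {}" if "i < n" for i
    using sI[OF that] stair_0[OF sl[OF that]] msupp_empty[of "s i" d] sl[OF that] by auto
  have ek: "?e k i \<in> os_kup l (Suc d) \<or> msupp d (?e k i) = {}" if "i < n" "k \<le> Suc d" for i k
  proof (cases "k = 0")
    case True
    then show ?thesis using e0[OF that(1)] I by blast
  next
    case False
    show ?thesis
    proof (cases "sorted (?e k i)")
      case True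
      have "s i ! 0 \<le> ?e k i ! 0"
        using S[OF that(1)] d1 unfolding stair_data_def by (auto simp: stair_nth)
      then have "xs ! i ! 0 \<le> ?e k i ! 0" using s0[OF that(1)] by linarith
      moreover have "?e k i ! d = p i" using False by (simp add: stair_nth)
      ultimately have "?e k i \<in> os_kup l (Suc d)"
        using True sorted_interlaced[of "?e k i" d] by (intro os_kupI[OF l xi[OF that(1)]]) (simp_all add: p_def)
      then show ?thesis by blast
    qed (use msupp_empty[of "?e k i" d] in simp)
  qed
  have XM: "X k \<in> M_kup l d" if "k \<le> Suc d" for k
    unfolding X_def using M dsum_add_intervals[OF l d1 subset_refl, of n "?e k"] ek that by (auto simp: M_kup_eq)
  have "\<exists>a b. decomp ?C n (X k) (\<lambda>i. interval_module d (?e k i)) a b" for k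
  proof (cases "k = 1")
    case True
    have "decomp ?C n M (\<lambda>i. interval_module d (?e 1 i)) a1 b1"
      using dec1 e1 unfolding decomp_def n_def[symmetric] by simp
    then show ?thesis using True unfolding X_def by auto
  next
    case False
    then show ?thesis unfolding X_def using dsum_decomp by simp
  qed
  then obtain a b where dec: "\<And>k. decomp ?C n (X k) (\<lambda>i. interval_module d (?e k i)) (a k) (b k)" by metis
  obtain f where f: "d_exact ?C d (M_kup l d) X f"
    and ft: "\<forall>I U. I \<subseteq> os_kup l (Suc d) \<longrightarrow> U \<in> add_intervals l d I \<longrightarrow>
      (\<forall>u\<in>I. \<forall>i<n. exact_ends d (s i) (p i) u) \<longrightarrow> torsion_exact ?C d U X f"
    using stair_d_exact[OF l d S XM dec] by blast
  have "X 0 \<in> add_intervals l d I"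
    unfolding X_def using dsum_add_intervals[OF l d1 I, of n "?e 0"] e0 by simp
  moreover have "X 1 = M" by (simp add: X_def)
  moreover have "\<forall>U\<in>add_intervals l d I. torsion_exact ?C d U X f" using ft I tor by blast
  ultimately show "\<exists>X f. d_exact ?C d (M_kup l d) X f \<and> X 0 \<in> add_intervals l d I \<and> X 1 = M \<and>
      (\<forall>U\<in>add_intervals l d I. torsion_exact ?C d U X f)"
    using f by blast
qed

section \<open>From a torsion class to the closure conditions\<close>

text \<open>
  Every morphism from a torsion object to \<open>M\<close> is killed by the map out of \<open>M\<close>, since its composite with that
  map is killed by the next one, which is injective on morphisms from torsion objects.
\<close>

lemma torsion_sequence:
  assumes l: "kupisch_series l" and d: "d \<ge> 2" and I: "I \<subseteq> os_kup l (Suc d)"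
    and T: "d_torsion_class (mesh_cat d :: (int list, 'k::field set, 'k) lincat) d (M_kup l d) (add_intervals l d I)"
    and M: "M \<in> M_kup l d"
  obtains X f where "d_kernel (mesh_cat d :: (int list, 'k set, 'k) lincat) d (M_kup l d) X f"
    "X 0 \<in> add_intervals l d I" "X 1 = M"
    "\<forall>u\<in>I. \<forall>h\<in>mhom (mesh_cat d) (interval_module d u) M. f 1 \<odot> h = 0"
    "\<forall>u\<in>I. \<forall>h\<in>mhom (mesh_cat d) (interval_module d u) (X (Suc d)).
      \<exists>h'\<in>mhom (mesh_cat d) (interval_module d u) (X d). f d \<odot> h' = h"
proof -
  let ?C = "mesh_cat d :: (int list, 'k set, 'k) lincat"
  have d1: "d \<ge> 1" using d by simp
  note M_mod = add_intervals_nakayama(2)[OF l d1 subset_refl, folded M_kup_eq]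
  obtain X f where ex: "d_exact ?C d (M_kup l d) X f" and X: "X 0 \<in> add_intervals l d I" "X 1 = M"
    and tor: "\<And>U. U \<in> add_intervals l d I \<Longrightarrow> torsion_exact ?C d U X f"
    using T M unfolding d_torsion_class_alt by blast
  have k: "d_kernel ?C d (M_kup l d) X f" using ex unfolding d_exact_def by blast
  note s = d_kernel_is_sequence[OF k]
  have "f 1 \<odot> h = 0" if u: "u \<in> I" and h: "h \<in> mhom ?C (interval_module d u) M" for u h
  proof -
    have f1: "f 1 \<in> mhom ?C (X 1) (X 2)" using is_sequence_mhom[OF s, of 1] d by (simp add: numeral_2_eq_2)
    have f2: "f 2 \<in> mhom ?C (X 2) (X (Suc 2))" using is_sequence_mhom[OF s, of 2] d by simp
    have in2: "f 1 \<odot> h \<in> mhom ?C (interval_module d u) (X 2)" using mhom_comp[OF _ f1] h X(2) by blast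
    have "f (Suc 1) \<odot> f 1 = 0" by (rule d_kernel_complex[OF k M_mod]) (use d in auto)
    then have "f 2 \<odot> f 1 \<odot> h = 0" unfolding mcomp_assoc[symmetric] by (simp add: numeral_2_eq_2)
    moreover have "exact_at id {0} (\<lambda>h. f 2 \<odot> h) (mhom ?C (interval_module d u) (X 2))"
      using tor[OF interval_add_intervals[OF l d1 I u]] unfolding torsion_exact_def by blast
    ultimately show ?thesis using in2 unfolding exact_at_iff by fastforce
  qed
  moreover have "\<exists>h'\<in>mhom ?C (interval_module d u) (X d). f d \<odot> h' = h"
    if u: "u \<in> I" and h: "h \<in> mhom ?C (interval_module d u) (X (Suc d))" for u h
  proof -
    have "exact_at (\<lambda>h. f d \<odot> h) (mhom ?C (interval_module d u) (X d)) (\<lambda>_. 0 :: nat)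
        (mhom ?C (interval_module d u) (X (d + 1)))"
      using tor[OF interval_add_intervals[OF l d1 I u]] unfolding torsion_exact_def by blast
    then show ?thesis using h unfolding exact_at_iff by auto
  qed
  ultimately show ?thesis using that[OF k X] by blast
qed

text \<open>
  The identity of an object of the torsion class is a sum of maps through intervals in \<open>I\<close>, and at least
  one summand of the composite survives.
\<close>

lemma interval_factorization:
  assumes l: "kupisch_series l" and d: "d \<ge> 1" and I: "I \<subseteq> os_kup l (Suc d)"
    and X0: "X0 \<in> add_intervals l d I"
    and x: "x \<in> os_kup l (Suc d)" and z: "z \<in> os_kup l (Suc d)"
    and f: "f \<in> mhom (mesh_cat d :: (int list, 'k::field set, 'k) lincat) X0 (interval_module d z)"
    and h: "h \<in> mhom (mesh_cat d) (interval_module d x) X0" and nz: "f \<odot> h \<noteq> 0"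
  obtains y a b c where "y \<in> I" "interlaced d x y" "interlaced d y z"
    "a \<in> mhom (mesh_cat d) (interval_module d y) X0" "b \<in> mhom (mesh_cat d) X0 (interval_module d y)"
    "b \<odot> a = mone (mesh_cat d) (interval_module d y)" "f \<odot> a = msmul c (eps d y z)"
proof -
  let ?C = "mesh_cat d :: (int list, 'k set, 'k) lincat"
  interpret thin_family ?C "tuples (Suc d)" "interval_module d" "interlaced d" "eps d" "\<lambda>x. \<Sum>i\<le>d. x ! i"
    by (rule thin_intervals[OF d])
  note X0' = add_intervals_nakayama(2,3)[OF l d I X0]
  obtain ys a b where ys: "set ys \<subseteq> I" and dec: "decomp ?C (length ys) X0 (\<lambda>i. interval_module d (ys ! i)) a b"
    using retract_decomp[OF X0'(1) os_kup_tuples[OF I] X0'(2)] by blast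
  have ab: "a i \<odot> b i \<in> mhom ?C X0 X0" if "i < length ys" for i
    by (rule mhom_comp[OF decompD(2)[OF dec that] decompD(1)[OF dec that]])
  have "f \<odot> h = (f \<odot> mone ?C X0) \<odot> h" by (simp add: mone_right[OF f])
  also have "f \<odot> mone ?C X0 = (\<Sum>i<length ys. f \<odot> a i \<odot> b i)"
    unfolding decomp_sum[OF dec, symmetric] by (rule mcomp_sum_right[OF X0'(1) ab f]) simp
  finally have sum: "f \<odot> h = (\<Sum>i<length ys. (f \<odot> a i) \<odot> (b i \<odot> h))"
    unfolding mcomp_sum_left by (simp add: mcomp_assoc)
  have "\<exists>i<length ys. (f \<odot> a i) \<odot> (b i \<odot> h) \<noteq> 0"
  proof (rule ccontr)
    assume "\<not> (\<exists>i<length ys. (f \<odot> a i) \<odot> (b i \<odot> h) \<noteq> 0)"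
    then have "(\<Sum>i<length ys. (f \<odot> a i) \<odot> (b i \<odot> h)) = 0" by (intro sum.neutral) blast
    then show False using nz sum by simp
  qed
  then obtain i where i: "i < length ys" "(f \<odot> a i) \<odot> (b i \<odot> h) \<noteq> 0" by blast
  have yI: "ys ! i \<in> I" using ys nth_mem[OF i(1)] by blast
  have tup: "y \<in> tuples (Suc d)" if "y \<in> os_kup l (Suc d)" for y using os_kup_tuples[OF subset_refl] that by blast
  have yt: "ys ! i \<in> tuples (Suc d)" by (rule subsetD[OF os_kup_tuples[OF I] yI])
  note a = decompD(1)[OF dec i(1)] and b = decompD(2)[OF dec i(1)]
  obtain c where c: "f \<odot> a i = msmul c (eps d (ys ! i) z)"
    using homE[OF yt tup[OF z] mhom_comp[OF a f]] by blast
  obtain c' where c': "b i \<odot> h = msmul c' (eps d x (ys ! i))"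
    using homE[OF tup[OF x] yt mhom_comp[OF h b]] by blast
  have "interlaced d (ys ! i) z" using i(2) unfolding c by (rule contrapos_np) (simp add: eps_zero)
  moreover have "interlaced d x (ys ! i)"
  proof (rule ccontr)
    assume "\<not> interlaced d x (ys ! i)"
    then have "b i \<odot> h = 0" unfolding c' by (simp add: eps_zero)
    then show False using i(2) mcomp_zero_right[OF mhom_comp[OF a f]] by simp
  qed
  ultimately show ?thesis using that[OF yI _ _ a b _ c] decompD(3)[OF dec i(1) i(1)] by simp
qed

text \<open>
  The morphism from \<open>x\<close> to \<open>z\<close> factors through the torsion part of \<open>z\<close>, hence through some \<open>y\<close> in \<open>I\<close> with
  \<open>x \<leadsto> y \<leadsto> z\<close> and the same last entry. As the map from \<open>y\<close> to \<open>z\<close> is a monomorphism with respect to intervals,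
  the two have the same socle and so are equal.
\<close>

lemma torsion_upward_step:
  assumes l: "kupisch_series l" and d: "d \<ge> 2" and I: "I \<subseteq> os_kup l (Suc d)"
    and T: "d_torsion_class (mesh_cat d :: (int list, 'k::field set, 'k) lincat) d (M_kup l d) (add_intervals l d I)"
    and x: "x \<in> I" and z: "z \<in> os_kup l (Suc d)" and xz: "interlaced d x z" "x ! d = z ! d"
  shows "z \<in> I"
proof -
  let ?C = "mesh_cat d :: (int list, 'k set, 'k) lincat"
  let ?M = "M_kup l d :: (int list, 'k set, 'k) rmod set"
  have d1: "d \<ge> 1" using d by simp
  interpret thin_family ?C "tuples (Suc d)" "interval_module d" "interlaced d" "eps d" "\<lambda>x. \<Sum>i\<le>d. x ! i"
    by (rule thin_intervals[OF d1])
  have M: "interval_module d y \<in> ?M" if "y \<in> os_kup l (Suc d)" for y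
    unfolding M_kup_eq by (rule interval_add_intervals[OF l d1 subset_refl that])
  have tup: "y \<in> tuples (Suc d)" if "y \<in> os_kup l (Suc d)" for y using os_kup_tuples[OF subset_refl] that by blast
  have xO: "x \<in> os_kup l (Suc d)" using x I by blast
  obtain X f where k: "d_kernel ?C d ?M X f" and X: "X 0 \<in> add_intervals l d I" "X 1 = interval_module d z"
    and f1: "\<forall>u\<in>I. \<forall>h\<in>mhom ?C (interval_module d u) (interval_module d z). f 1 \<odot> h = 0"
    and "\<forall>u\<in>I. \<forall>h\<in>mhom ?C (interval_module d u) (X (Suc d)).
      \<exists>h'\<in>mhom ?C (interval_module d u) (X d). f d \<odot> h' = h"
    by (rule torsion_sequence[OF l d I T M[OF z]])
  have f0: "f 0 \<in> mhom ?C (X 0) (interval_module d z)"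
    using is_sequence_mhom[OF d_kernel_is_sequence[OF k], of 0] X(2) by simp
  have e: "eps d x z \<in> mhom ?C (interval_module d x) (interval_module d z)"
    by (rule eps_hom[OF tup[OF xO] tup[OF z]])
  obtain h where h: "h \<in> mhom ?C (interval_module d x) (X 0)" "f 0 \<odot> h = eps d x z"
    using d_kernel_exact[OF k M[OF xO], of 0] f1[rule_format, OF x e] e d X(2) unfolding exact_at_iff by auto
  have "f 0 \<odot> h \<noteq> 0" using eps_nonzero[OF xz(1), of 1] h(2) by auto
  then obtain y a b c where y: "y \<in> I" and xy: "interlaced d x y" and yz: "interlaced d y z"
    and a: "a \<in> mhom ?C (interval_module d y) (X 0)" and b: "b \<in> mhom ?C (X 0) (interval_module d y)"
    and ba: "b \<odot> a = mone ?C (interval_module d y)" and c: "f 0 \<odot> a = msmul c (eps d y z)"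
    by (rule interval_factorization[OF l d1 I X(1) xO z f0 h(1)])
  have yO: "y \<in> os_kup l (Suc d)" using y I by blast
  have "y = z"
  proof (rule ccontr)
    assume ne: "y \<noteq> z"
    have "y ! d = z ! d" using xy yz xz(2) unfolding interlaced_iff by (metis order_antisym order_refl)
    moreover have le: "y ! i \<le> z ! i" if "i \<le> d" for i using yz that unfolding interlaced_iff by blast
    moreover have len: "length y = Suc d" "length z = Suc d" using yz unfolding interlaced_iff by blast+
    ultimately obtain i where i: "i < d" "y ! i < z ! i"
    proof -
      have "\<exists>i<Suc d. y ! i \<noteq> z ! i" using ne len nth_equalityI[of y z] by auto
      then obtain j where "j \<le> d" "y ! j \<noteq> z ! j" by (auto simp: less_Suc_eq_le)
      then show ?thesis using that[of j] le[of j] \<open>y ! d = z ! d\<close> by (cases "j = d") auto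
    qed
    \<comment> \<open>A test object concentrated at the socle of \<open>y\<close>, from which it does map to \<open>y\<close> but not to \<open>z\<close>.\<close>
    define u where "u = y ! 0 # take d y"
    have u_nth: "u ! Suc j = y ! j" if "j < d" for j using that by (simp add: u_def)
    have u_0: "u ! 0 = y ! 0" by (simp add: u_def)
    have y_mono: "y ! j \<le> y ! Suc j" if "j < d" for j by (rule os_kup_nth(2)[OF yO that])
    have u_le: "u ! j \<le> y ! j" if "j \<le> d" for j
      using that y_mono[of "j - 1"] u_nth[of "j - 1"] u_0 by (cases j) auto
    have uy: "interlaced d u y"
      unfolding interlaced_iff using len u_le u_nth by (auto simp: u_def)
    have uO: "u \<in> os_kup l (Suc d)"
      by (rule os_kupI[OF l yO interlaced_sorted(1)[OF uy]]) (use u_0 u_le in auto)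
    have "\<not> interlaced d u z"
    proof
      assume "interlaced d u z"
      then have "z ! i \<le> u ! Suc i" using i(1) unfolding interlaced_iff by blast
      then show False using u_nth[OF i(1)] i(2) by simp
    qed
    then have uz: "eps d u z = (0 :: int list \<Rightarrow> 'k kvec \<Rightarrow> 'k kvec)" by (rule eps_zero)
    have eu: "eps d u y \<in> mhom ?C (interval_module d u) (interval_module d y)"
      by (rule eps_hom[OF tup[OF uO] tup[OF yO]])
    have "f 0 \<odot> a \<odot> eps d u y = msmul c (eps d y z \<odot> eps d u y)"
      unfolding mcomp_assoc[symmetric] c by (rule mcomp_smul_left)
    also have "\<dots> = 0" unfolding eps_comp[OF uy yz] uz by simp
    finally have "f 0 \<odot> a \<odot> eps d u y = 0" .
    moreover have "exact_at id {0} (\<lambda>h. f 0 \<odot> h) (mhom ?C (interval_module d u) (X 0))"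
      using k M[OF uO] unfolding d_kernel_def by blast
    ultimately have "a \<odot> eps d u y = 0"
      using mhom_comp[OF eu a] unfolding exact_at_iff by fastforce
    then have "b \<odot> a \<odot> eps d u y = 0" using mcomp_zero_right[OF b] by simp
    then have "eps d u y = (0 :: int list \<Rightarrow> 'k kvec \<Rightarrow> 'k kvec)"
      unfolding mcomp_assoc[symmetric] ba mone_left[OF eu] .
    then show False using eps_nonzero[OF uy, of "1 :: 'k"] by simp
  qed
  then show ?thesis using y by simp
qed

text \<open>
  From \<open>x\<close> to \<open>z\<close> one entry is raised at a time, from right to left, so that all tuples on the way are sorted
  and consecutive ones are interlaced.
\<close>

lemma torsion_upward:
  assumes l: "kupisch_series l" and d: "d \<ge> 2" and I: "I \<subseteq> os_kup l (Suc d)"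
    and T: "d_torsion_class (mesh_cat d :: (int list, 'k::field set, 'k) lincat) d (M_kup l d) (add_intervals l d I)"
    and x: "x \<in> I" and z: "z \<in> os_kup l (Suc d)" and xz: "prod_le x z" "x ! d = z ! d"
  shows "z \<in> I"
proof -
  have xO: "x \<in> os_kup l (Suc d)" using x I by blast
  note xn = os_kup_nth[OF xO] and zn = os_kup_nth[OF z]
  have le: "x ! i \<le> z ! i" if "i \<le> d" for i using xz(1) xn(1) that unfolding prod_le_nth by simp
  define w where "w j = map (\<lambda>i. if i < j then x ! i else z ! i) [0..<Suc d]" for j
  have w_nth: "w j ! i = (if i < j then x ! i else z ! i)" if "i \<le> d" for i j
    using that unfolding w_def by (simp del: upt_Suc)
  have w_len: "length (w j) = Suc d" for j by (simp add: w_def)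
  have w_sorted: "interlaced d (w j) (w j)" for j
  proof -
    have "w j ! i \<le> w j ! Suc i" if "i < d" for i
      using xn(2)[OF that] zn(2)[OF that] le[of i] that by (auto simp: w_nth)
    then show ?thesis using w_len unfolding interlaced_iff by simp
  qed
  have wO: "w j \<in> os_kup l (Suc d)" if "j \<le> d" for j
    by (rule os_kupI[OF l xO w_sorted]) (use that le[of 0] xz(2) in \<open>simp_all add: w_nth\<close>)
  have step: "w j \<in> I" if "w (Suc j) \<in> I" "j < d" for j
  proof (rule torsion_upward_step[OF l d I T that(1) wO])
    have "w (Suc j) ! i \<le> w j ! i" if "i \<le> d" for i using le[OF that] that by (auto simp: w_nth)
    moreover have "w j ! i \<le> w (Suc j) ! Suc i" if "i < d" for i
    proof (cases "i < j")
      case True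
      then show ?thesis using xn(2)[OF that] that by (simp add: w_nth)
    next
      case False
      then show ?thesis using zn(2)[OF that] that by (simp add: w_nth)
    qed
    ultimately show "interlaced d (w (Suc j)) (w j)" unfolding interlaced_iff using w_len by simp
    show "w (Suc j) ! d = w j ! d" using that(2) by (simp add: w_nth)
  qed (use that in simp)
  have "w d = x" by (rule nth_equalityI) (use xn(1) w_len xz(2) in \<open>auto simp: w_nth less_Suc_eq\<close>)
  then have "w (d - j) \<in> I" if "j \<le> d" for j
    using that
  proof (induction j)
    case (Suc j)
    have "Suc (d - Suc j) = d - j" "d - Suc j < d" using Suc.prems by auto
    then show ?case using step[of "d - Suc j"] Suc by simp
  qed (use x in simp)
  from this[of d] have "w 0 \<in> I" by simp
  moreover have "w 0 = z" by (rule nth_equalityI) (use zn(1) w_len in \<open>auto simp: w_nth less_Suc_eq\<close>)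
  ultimately show ?thesis by simp
qed

text \<open>
  The last term of the staircase represents an extension class that cannot survive. The staircase is
  mapped to the torsion sequence of its second term \<open>w\<close>, with the identity on \<open>w\<close>. Since the last term lies
  in \<open>I\<close>, the last component lifts and the chain map is homotopic to zero. The third term has no nonzero map
  back to \<open>w\<close>, so the homotopy exhibits \<open>w\<close> as a direct summand of its torsion part.
\<close>

lemma torsion_stair:
  assumes l: "kupisch_series l" and d: "d \<ge> 2" and I: "I \<subseteq> os_kup l (Suc d)"
    and T: "d_torsion_class (mesh_cat d :: (int list, 'k::field set, 'k) lincat) d (M_kup l d) (add_intervals l d I)"
    and s: "s \<in> I" and u: "stair d s p (Suc d) \<in> I" and w: "s[d := p] \<in> os_kup l (Suc d)" and sp: "s ! d < p"
  shows "s[d := p] \<in> I"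
proof -
  let ?C = "mesh_cat d :: (int list, 'k set, 'k) lincat"
  let ?M = "M_kup l d :: (int list, 'k set, 'k) rmod set"
  let ?w = "s[d := p]" and ?e = "stair d s p"
  have d1: "d \<ge> 1" using d by simp
  interpret thin_family ?C "tuples (Suc d)" "interval_module d" "interlaced d" "eps d" "\<lambda>x. \<Sum>i\<le>d. x ! i"
    by (rule thin_intervals[OF d1])
  have M: "interval_module d y \<in> ?M" if "y \<in> os_kup l (Suc d)" for y
    unfolding M_kup_eq by (rule interval_add_intervals[OF l d1 subset_refl that])
  have tup: "y \<in> tuples (Suc d)" if "y \<in> os_kup l (Suc d)" for y using os_kup_tuples[OF subset_refl] that by blast
  have sO: "s \<in> os_kup l (Suc d)" using s I by blast
  note sn = os_kup_nth[OF sO]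
  have e0: "?e 0 = s" by (rule stair_0[OF sn(1)])
  have e1: "?e 1 = ?w" using stair_1[OF sn(1)] by simp
  have data: "stair_data d s p" unfolding stair_data_def using sn(1,2) sp by force
  have e_sorted: "interlaced d (?e k) (?e k)" if "k \<le> Suc d" for k
  proof -
    have "?e k ! i \<le> ?e k ! Suc i" if i: "i < d" for i
    proof -
      have "s ! i \<le> s ! Suc i" by (rule sn(2)[OF i])
      moreover have "Suc i < d \<Longrightarrow> s ! Suc i \<le> s ! Suc (Suc i)" by (rule sn(2))
      moreover have "Suc i = d \<Longrightarrow> s ! Suc i < p" using sp by simp
      ultimately show ?thesis using i by (cases "Suc i = d") (auto simp: stair_nth)
    qed
    then show ?thesis unfolding interlaced_iff by simp
  qed
  have eO: "?e k \<in> os_kup l (Suc d)" if k: "k \<le> Suc d" for k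
  proof (cases "k = 0")
    case False
    have "s ! 0 \<le> ?e k ! 0" using sn(2)[of 0] d1 by (auto simp: stair_nth)
    then show ?thesis
      using False d1 sn(1) by (intro os_kupI[OF l w e_sorted[OF k]]) (auto simp: stair_nth nth_list_update)
  qed (use e0 sO in simp)
  define E where "E k = (interval_module d (?e k) :: (int list, 'k set, 'k) rmod)" for k
  have EM: "E k \<in> ?M" if "k \<le> Suc d" for k unfolding E_def by (rule M[OF eO[OF that]])
  have dec: "decomp ?C 1 (E k) (\<lambda>i. interval_module d (?e k)) (\<lambda>_. mone ?C (E k)) (\<lambda>_. mone ?C (E k))" for k
    unfolding decomp_def E_def using mone_mhom[OF module, of "?e k"] mone_left[OF mone_mhom[OF module, of "?e k"]] by simp
  obtain g where g: "d_exact ?C d ?M E g"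
    using stair_d_exact[OF l d data EM dec] by blast
  have gk: "d_kernel ?C d ?M E g" and gc: "d_cokernel ?C d ?M E g" using g unfolding d_exact_def by blast+
  obtain X f where k: "d_kernel ?C d ?M X f" and X: "X 0 \<in> add_intervals l d I" "X 1 = interval_module d ?w"
    and f1: "\<forall>u\<in>I. \<forall>h\<in>mhom ?C (interval_module d u) (interval_module d ?w). f 1 \<odot> h = 0"
    and fd: "\<forall>u\<in>I. \<forall>h\<in>mhom ?C (interval_module d u) (X (Suc d)).
      \<exists>h'\<in>mhom ?C (interval_module d u) (X d). f d \<odot> h' = h"
    by (rule torsion_sequence[OF l d I T M[OF w]])
  note M_mod = add_intervals_nakayama(2)[OF l d1 subset_refl, folded M_kup_eq]
  have E1: "E 1 = interval_module d ?w" unfolding E_def e1 ..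
  have id: "mone ?C (E 1) \<in> mhom ?C (E 1) (X 1)" unfolding X(2) E1 by (rule mone_mhom[OF module])
  have f1m: "f 1 \<in> mhom ?C (X 1) (X (Suc 1))" using is_sequence_mhom[OF d_kernel_is_sequence[OF k], of 1] d by simp
  have "g 0 \<in> mhom ?C (interval_module d s) (interval_module d ?w)"
    using is_sequence_mhom[OF d_kernel_is_sequence[OF gk], of 0] E1 by (simp add: E_def e0)
  then have "f 1 \<odot> g 0 = 0" by (rule f1[rule_format, OF s])
  then have "(f 1 \<odot> mone ?C (E 1)) \<odot> g 0 = 0" using mone_right[OF f1m] X(2) E1 by simp
  then obtain \<phi> where \<phi>: "\<phi> 0 = mone ?C (E 1)" "\<forall>k\<le>d. \<phi> k \<in> mhom ?C (E (Suc k)) (X (Suc k))"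
    "\<forall>k<d. \<phi> (Suc k) \<odot> g (Suc k) = f (Suc k) \<odot> \<phi> k"
    using chain_map_extension[OF gc k M_mod id _ order_refl] by blast
  have "\<phi> d \<in> mhom ?C (interval_module d (?e (Suc d))) (X (Suc d))" using \<phi>(2) by (simp add: E_def)
  then obtain h where h: "h \<in> mhom ?C (E (Suc d)) (X d)" "\<phi> d = f d \<odot> h"
    using fd[rule_format, OF u] unfolding E_def by metis
  obtain h1 h2 where h1: "h1 \<in> mhom ?C (E 1) (X 0)" and h2: "h2 \<in> mhom ?C (E 2) (X 1)"
    and split: "\<phi> 0 = h2 \<odot> g 1 + f 0 \<odot> h1"
    using chain_homotopy_descent[where \<phi> = \<phi>, OF gk k M_mod \<phi>(2)[rule_format] \<phi>(3)[rule_format] h d1]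
    by blast
  have h2': "h2 \<in> mhom ?C (interval_module d (?e 2)) (interval_module d ?w)"
    using h2 unfolding X(2) E_def .
  have e2: "?e 2 \<in> tuples (Suc d)" by (rule tup[OF eO]) (use d in simp)
  \<comment> \<open>Entry \<open>d - 1\<close> of the third term exceeds that of \<open>w\<close>.\<close>
  have no_map: "\<not> interlaced d (?e 2) ?w"
  proof
    assume "interlaced d (?e 2) ?w"
    moreover have "d - 1 \<le> d" by simp
    ultimately have "?e 2 ! (d - 1) \<le> ?w ! (d - 1)" unfolding interlaced_iff by blast
    moreover have "?e 2 ! (d - 1) = s ! d + 1" using d by (simp add: stair_nth Suc_diff_le)
    moreover have "?w ! (d - 1) = s ! (d - 1)" using d by simp
    moreover have "s ! (d - 1) \<le> s ! Suc (d - 1)" by (rule sn(2)) (use d in simp)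
    ultimately show False using d by simp
  qed
  obtain c2 where "h2 = msmul c2 (eps d (?e 2) ?w)" by (rule homE[OF e2 tup[OF w] h2'])
  then have "h2 = 0" unfolding eps_zero[OF no_map] by simp
  then have id_eq: "f 0 \<odot> h1 = eps d ?w ?w"
    using split \<phi>(1) eps_id[OF tup[OF w]] unfolding E1 by simp
  have ww: "interlaced d ?w ?w" by (rule os_kup_nth(3)[OF w])
  have f0: "f 0 \<in> mhom ?C (X 0) (interval_module d ?w)"
    using is_sequence_mhom[OF d_kernel_is_sequence[OF k], of 0] X(2) by simp
  have h1': "h1 \<in> mhom ?C (interval_module d ?w) (X 0)" using h1 unfolding E1 .
  have "f 0 \<odot> h1 \<noteq> 0" using eps_nonzero[OF ww, of 1] id_eq by auto
  then obtain y a b c where y: "y \<in> I" and wy: "interlaced d ?w y" and yw: "interlaced d y ?w"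
    and "a \<in> mhom ?C (interval_module d y) (X 0)" "b \<in> mhom ?C (X 0) (interval_module d y)"
      "b \<odot> a = mone ?C (interval_module d y)" "f 0 \<odot> a = msmul c (eps d y ?w)"
    by (rule interval_factorization[OF l d1 I X(1) w w f0 h1'])
  have "prod_le y ?w" "prod_le ?w y" using yw wy unfolding interlaced_iff prod_le_nth by (auto simp: less_Suc_eq_le)
  then have "y = ?w" by (rule prod_le_antisym)
  then show ?thesis using y by simp
qed

text \<open>
  For the second condition, \<open>x\<close> and \<open>z\<close> are first replaced by larger elements of \<open>I\<close> with the same last entries
  that are the end terms of a staircase, whose second term lies below \<open>y\<close>.
\<close>

lemma torsion_closed_family:
  assumes l: "kupisch_series l" and d: "d \<ge> 2" and I: "I \<subseteq> os_kup l (Suc d)"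
    and T: "d_torsion_class (mesh_cat d :: (int list, 'k::field set, 'k) lincat) d (M_kup l d) (add_intervals l d I)"
  shows "closed_family l d I"
  unfolding closed_family_def
proof (intro ballI conjI impI)
  note up = torsion_upward[OF l d I T]
  fix x z assume xO: "x \<in> os_kup l (Suc d)" and zO: "z \<in> os_kup l (Suc d)"
  show "z \<in> I" if "prod_le x z \<and> x ! d = z ! d" "x \<in> I" using up[OF that(2) zO] that(1) by blast
  fix y
  assume *: "interlaced d x (tau z) \<and> x \<in> I \<and> z \<in> I" and yO: "y \<in> os_kup l (Suc d)"
    and mix: "\<forall>i\<le>d. y ! i \<in> {x ! i, z ! i}"
  have x: "x \<in> I" and z: "z \<in> I" using * by blast+
  note xn = os_kup_nth[OF xO] and yn = os_kup_nth[OF yO] and zn = os_kup_nth[OF zO]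
  have lt: "x ! i < z ! i" if "i \<le> d" for i using * that unfolding interlaced_tau_iff by force
  have zx: "z ! i \<le> x ! Suc i + 1" if "i < d" for i using * that unfolding interlaced_tau_iff by force
  have xy: "x ! i \<le> y ! i" if "i \<le> d" for i using mix lt[OF that] that by force
  show "y \<in> I"
  proof (cases "y ! d = x ! d")
    case True
    have "prod_le x y" using xy xn(1) yn(1) by (simp add: prod_le_nth less_Suc_eq_le)
    then show ?thesis using up[OF x yO] True by simp
  next
    case False
    then have yd: "y ! d = z ! d" using mix by blast
    show ?thesis
    proof (cases "\<exists>i\<le>d. y ! i \<noteq> z ! i")
      case False
      then have "y = z" using yn(1) zn(1) by (intro nth_equalityI) (auto simp: less_Suc_eq_le)
      then show ?thesis using z by simp
    next
      case True
      define j where "j = (LEAST i. i \<le> d \<and> y ! i \<noteq> z ! i)"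
      have j: "j \<le> d" "y ! j \<noteq> z ! j" using LeastI_ex[OF True] unfolding j_def by blast+
      have before: "y ! i = z ! i" if "i < j" for i
        using not_less_Least[of i "\<lambda>i. i \<le> d \<and> y ! i \<noteq> z ! i"] that j(1) unfolding j_def by auto
      have jd: "j < d" using j yd by (cases "j = d") auto
      have yj: "y ! j = x ! j" using mix j by blast
      \<comment> \<open>\<open>x\<close> is raised to agree with \<open>y\<close> before the first place \<open>j\<close> where \<open>y\<close> follows \<open>x\<close>. The first entry then is
        that of \<open>y\<close>, which keeps \<open>s\<close> with last entry \<open>z ! d\<close> admissible for the Kupisch series.\<close>
      define s where "s = map (\<lambda>i. if i < j then z ! i else x ! i) [0..<Suc d]"
      have s_nth: "s ! i = (if i < j then z ! i else x ! i)" if "i \<le> d" for i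
        using that unfolding s_def by (simp del: upt_Suc)
      have s_len: "length s = Suc d" by (simp add: s_def)
      have s_le: "s ! i \<le> s ! Suc i" if i: "i < d" for i
      proof -
        have "Suc i = j \<Longrightarrow> z ! i \<le> x ! Suc i" using yn(2)[OF i] before[of i] yj by auto
        then show ?thesis using xn(2)[OF i] zn(2)[OF i] i by (cases "Suc i = j") (auto simp: s_nth)
      qed
      have s_sorted: "interlaced d s s" using s_le s_len unfolding interlaced_iff by simp
      have xs: "x ! i \<le> s ! i" if "i \<le> d" for i using lt[OF that] that by (simp add: s_nth less_imp_le)
      have sd: "s ! d = x ! d" using jd by (simp add: s_nth)
      have sO: "s \<in> os_kup l (Suc d)"
        by (rule os_kupI[OF l xO s_sorted]) (use xs[of 0] sd in simp_all)
      have sI: "s \<in> I"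
        by (rule up[OF x sO]) (use xs xn(1) s_len sd in \<open>simp_all add: prod_le_nth less_Suc_eq_le\<close>)
      let ?p = "z ! d"
      have sp: "s ! d < ?p" using lt[of d] sd by simp
      let ?w = "s[d := ?p]" and ?u = "stair d s ?p (Suc d)"
      have w_nth: "?w ! i = (if i = d then ?p else s ! i)" if "i \<le> d" for i using that s_len by simp
      have "?w ! i \<le> ?w ! Suc i" if "i < d" for i
        using s_le[OF that] sp that by (cases "Suc i = d") (auto simp: w_nth)
      then have w_sorted: "interlaced d ?w ?w" using s_len unfolding interlaced_iff by simp
      have wy: "?w ! i \<le> y ! i" if "i \<le> d" for i
        using xy[OF that] before[of i] yd that by (auto simp: w_nth s_nth)
      have w0: "?w ! 0 = y ! 0"
        using jd before[of 0] yj by (cases "j = 0") (auto simp: w_nth s_nth)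
      have wO: "?w \<in> os_kup l (Suc d)"
        by (rule os_kupI[OF l yO w_sorted]) (use w0 yd w_nth in simp_all)
      have u_nth: "?u ! i = (if i < d then s ! Suc i + 1 else ?p)" if "i \<le> d" for i using that by (simp add: stair_nth)
      have "?u ! i \<le> ?u ! Suc i" if "i < d" for i
        using s_le[of "Suc i"] sp that by (cases "Suc i = d") (auto simp: u_nth)
      then have u_sorted: "interlaced d ?u ?u" unfolding interlaced_iff by simp
      have zu: "z ! i \<le> ?u ! i" if "i \<le> d" for i
        using zn(2)[of i] zx[of i] that by (auto simp: u_nth s_nth)
      have uO: "?u \<in> os_kup l (Suc d)"
        by (rule os_kupI[OF l zO u_sorted]) (use zu[of 0] u_nth in simp_all)
      have uI: "?u \<in> I"
        by (rule up[OF z uO]) (use zu zn(1) u_nth in \<open>simp_all add: prod_le_nth less_Suc_eq_le\<close>)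
      have "?w \<in> I" by (rule torsion_stair[OF l d I T sI uI wO sp])
      then show "y \<in> I"
        by (rule up[OF _ yO]) (use wy yn(1) s_len yd w_nth in \<open>simp_all add: prod_le_nth less_Suc_eq_le\<close>)
    qed
  qed
qed

theorem theorem6p5:
  fixes d :: nat and l :: "int \<Rightarrow> enat" and I :: "int list set"
  assumes "d \<ge> 2" and "kupisch_series l" and "I \<subseteq> os_kup l (d + 1)"
  shows "d_torsion_class (mesh_cat d :: (int list, 'k::field set, 'k) lincat) d
           (M_kup l d) (add_intervals l d I) \<longleftrightarrow>
    (\<forall>x\<in>os_kup l (d + 1). \<forall>z\<in>os_kup l (d + 1).
       (prod_le x z \<and> x ! d = z ! d \<longrightarrow> x \<in> I \<longrightarrow> z \<in> I) \<and>
       (interlaced d x (tau z) \<and> x \<in> I \<and> z \<in> I \<longrightarrow>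
          (\<forall>y\<in>os_kup l (d + 1). (\<forall>i\<le>d. y ! i \<in> {x ! i, z ! i}) \<longrightarrow> y \<in> I)))"
proof -
  have I: "I \<subseteq> os_kup l (Suc d)" using assms(3) by simp
  have "d_torsion_class (mesh_cat d :: (int list, 'k set, 'k) lincat) d (M_kup l d) (add_intervals l d I) \<longleftrightarrow>
      closed_family l d I"
    using torsion_closed_family[OF assms(2,1) I] closed_family_torsion[OF assms(2,1) I] by blast
  then show ?thesis unfolding closed_family_def Suc_eq_plus1 .
qed

end
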